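(* Let $n\ge 2$ and $G_n=\mathbb{Z}^n\rtimes SL_n(\mathbb{Z})$. A von Neumann subalgebra $P\subseteq L(G_n)$ is $G_n$-invariant if and only if either $P=L(H)$ for some normal subgroup $H$ of $G_n$, or $P=A_d$ for some integer $d\ge 1$, where $$A_d:=\{x\in L(d\mathbb{Z}^n):\ \tau(xu_g)=\tau(xu_{g^{-1}})\ \text{ for all } g\in d\mathbb{Z}^n\}\subsetneq L(d\mathbb{Z}^n).$$
   Context: $SL_n(\mathbb{Z})$ acts on $\mathbb{Z}^n$ (column vectors) by left matrix multiplication, and $G_n=\mathbb{Z}^n\rtimes SL_n(\mathbb{Z})$ is the corresponding semidirect product. For a countable discrete group $G$, $L(G)\subseteq B(\ell^2(G))$ is the group von Neumann algebra generated by the left regular representation, $u_g\in L(G)$ is the canonical unitary corresponding to $g\in G$, and $\tau(x)=\langle x\delta_e,\delta_e\rangle$ is the canonical trace. For a subgroup $H\le G$, $L(H)$ is viewed as the von Neumann subalgebra of $L(G)$ generated by $\{u_h:h\in H\}$. A von Neumann subalgebra $P\subseteq L(G)$ is $G$-invariant if $u_gPu_g^{*}=P$ for all $g\in G$. For $d\ge 1$, $d\mathbb{Z}^n=(d\mathbb{Z})^n$, viewed as a subgroup of $\mathbb{Z}^n\le G_n$. *)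

theory Defs
  imports "HOL-Analysis.Analysis" "HOL-Algebra.Coset"
begin

section \<open>The Hilbert space of square-summable functions\<close>

typedef 'a ell2 = "{f :: 'a \<Rightarrow> complex. (\<lambda>x. (cmod (f x))\<^sup>2) summable_on UNIV}"
  morphisms apply_ell2 Abs_ell2
  by (rule exI[of _ "\<lambda>_. 0"]) simp

setup_lifting type_definition_ell2

lemma ell2_mult_summable:
  assumes "(\<lambda>x. (cmod (f x))\<^sup>2) summable_on A" "(\<lambda>x. (cmod (g x))\<^sup>2) summable_on A"
  shows "(\<lambda>x. f x * cnj (g x)) summable_on A"
proof -
  have "(\<lambda>x. norm (f x * cnj (g x))) summable_on A"
  proof (rule summable_on_comparison_test)
    show "(\<lambda>x. (cmod (f x))\<^sup>2 + (cmod (g x))\<^sup>2) summable_on A"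
      using assms by (rule summable_on_add)
    show "norm (f x * cnj (g x)) \<le> (cmod (f x))\<^sup>2 + (cmod (g x))\<^sup>2" for x
    proof -
      have "2 * (cmod (f x) * cmod (g x)) \<le> (cmod (f x))\<^sup>2 + (cmod (g x))\<^sup>2"
        using sum_squares_bound[of "cmod (f x)" "cmod (g x)"] by simp
      moreover have "0 \<le> cmod (f x) * cmod (g x)" by simp
      ultimately show ?thesis
        unfolding norm_mult complex_mod_cnj by linarith
    qed
  qed auto
  then show ?thesis
    by (rule abs_summable_summable)
qed

lemma ell2_add_summable:
  assumes "(\<lambda>x. (cmod (f x))\<^sup>2) summable_on A" "(\<lambda>x. (cmod (g x))\<^sup>2) summable_on A"
  shows "(\<lambda>x. (cmod (f x + g x))\<^sup>2) summable_on A"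
proof (rule summable_on_comparison_test)
  show "(\<lambda>x. 2 * (cmod (f x))\<^sup>2 + 2 * (cmod (g x))\<^sup>2) summable_on A"
    using assms by (intro summable_on_add summable_on_cmult_right)
  show "(cmod (f x + g x))\<^sup>2 \<le> 2 * (cmod (f x))\<^sup>2 + 2 * (cmod (g x))\<^sup>2" for x
  proof -
    have "(cmod (f x + g x))\<^sup>2 \<le> (cmod (f x) + cmod (g x))\<^sup>2"
      by (intro power_mono norm_triangle_ineq) simp
    also have "\<dots> \<le> 2 * (cmod (f x))\<^sup>2 + 2 * (cmod (g x))\<^sup>2"
      using sum_squares_bound[of "cmod (f x)" "cmod (g x)"] by (simp add: power2_sum)
    finally show ?thesis .
  qed
qed auto

lift_definition cscale :: "complex \<Rightarrow> 'a ell2 \<Rightarrow> 'a ell2" is "\<lambda>c f x. c * f x"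
  by (auto simp: norm_mult power_mult_distrib intro: summable_on_cmult_right)

lift_definition cinner :: "'a ell2 \<Rightarrow> 'a ell2 \<Rightarrow> complex"
  is "\<lambda>f g. \<Sum>\<^sub>\<infinity>x. f x * cnj (g x)" .

lift_definition delta :: "'a \<Rightarrow> 'a ell2" is "\<lambda>a x. if x = a then 1 else 0"
  subgoal for a
    by (rule summable_on_cong_neutral[THEN iffD1, OF _ _ _ summable_on_finite[of "{a}"]]) auto
  done

instantiation ell2 :: (type) real_vector
begin

lift_definition zero_ell2 :: "'a ell2" is "\<lambda>_. 0" by simp

lift_definition plus_ell2 :: "'a ell2 \<Rightarrow> 'a ell2 \<Rightarrow> 'a ell2" is "\<lambda>f g x. f x + g x"
  by (auto intro: ell2_add_summable)

lift_definition uminus_ell2 :: "'a ell2 \<Rightarrow> 'a ell2" is "\<lambda>f x. - f x" by simp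

lift_definition minus_ell2 :: "'a ell2 \<Rightarrow> 'a ell2 \<Rightarrow> 'a ell2" is "\<lambda>f g x. f x - g x"
  subgoal for f g using ell2_add_summable[of f UNIV "\<lambda>x. - g x"] by simp
  done

lift_definition scaleR_ell2 :: "real \<Rightarrow> 'a ell2 \<Rightarrow> 'a ell2" is "\<lambda>r f x. complex_of_real r * f x"
  by (auto simp: norm_mult power_mult_distrib intro: summable_on_cmult_right)

instance
proof
  fix f g h :: "'a ell2" and r s :: real
  show "f + g + h = f + (g + h)" by transfer (simp add: add.assoc)
  show "f + g = g + f" by transfer (simp add: add.commute)
  show "0 + f = f" by transfer simp
  show "- f + f = 0" by transfer simp
  show "f - g = f + - g" by transfer simp
  show "r *\<^sub>R (f + g) = r *\<^sub>R f + r *\<^sub>R g" by transfer (simp add: distrib_left)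
  show "(r + s) *\<^sub>R f = r *\<^sub>R f + s *\<^sub>R f" by transfer (simp add: distrib_right)
  show "r *\<^sub>R s *\<^sub>R f = (r * s) *\<^sub>R f" by transfer (simp add: mult.assoc)
  show "1 *\<^sub>R f = f" by transfer simp
qed

end

instantiation ell2 :: (type) real_inner
begin

definition inner_ell2 :: "'a ell2 \<Rightarrow> 'a ell2 \<Rightarrow> real" where "inner_ell2 f g = Re (cinner f g)"

definition norm_ell2 :: "'a ell2 \<Rightarrow> real" where "norm_ell2 f = sqrt (inner f f)"

definition sgn_ell2 :: "'a ell2 \<Rightarrow> 'a ell2" where "sgn_ell2 f = f /\<^sub>R norm f"

definition dist_ell2 :: "'a ell2 \<Rightarrow> 'a ell2 \<Rightarrow> real" where "dist_ell2 f g = norm (f - g)"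

definition uniformity_ell2 :: "('a ell2 \<times> 'a ell2) filter"
  where "uniformity_ell2 = (INF e\<in>{0<..}. principal {(f, g). dist f g < e})"

definition open_ell2 :: "'a ell2 set \<Rightarrow> bool"
  where "open_ell2 U = (\<forall>f\<in>U. \<forall>\<^sub>F (f', g) in uniformity. f' = f \<longrightarrow> g \<in> U)"

instance
proof
  fix f g h :: "'a ell2" and r :: real
  show "dist f g = norm (f - g)" by (rule dist_ell2_def)
  show "sgn f = f /\<^sub>R norm f" by (rule sgn_ell2_def)
  show "(uniformity :: ('a ell2 \<times> 'a ell2) filter) =
      (INF e\<in>{0<..}. principal {(f, g). dist f g < e})"
    by (rule uniformity_ell2_def)
  show "open U = (\<forall>f\<in>U. \<forall>\<^sub>F (f', g) in uniformity. f' = f \<longrightarrow> g \<in> U)" for U :: "'a ell2 set"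
    by (rule open_ell2_def)
  show "inner f g = inner g f"
  proof -
    have "cinner f g = cnj (cinner g f)"
      by transfer (simp add: infsum_cnj[symmetric] mult.commute)
    then show ?thesis by (simp add: inner_ell2_def)
  qed
  show "inner (f + g) h = inner f h + inner g h"
  proof -
    have "cinner (f + g) h = cinner f h + cinner g h"
      by transfer (simp add: distrib_right infsum_add ell2_mult_summable)
    then show ?thesis by (simp add: inner_ell2_def)
  qed
  show "inner (r *\<^sub>R f) g = r * inner f g"
  proof -
    have "cinner (r *\<^sub>R f) g = complex_of_real r * cinner f g"
      by transfer (simp add: mult.assoc infsum_cmult_right')
    then show ?thesis by (simp add: inner_ell2_def)
  qed
  have *: "cinner f f = complex_of_real (\<Sum>\<^sub>\<infinity>x. (cmod (apply_ell2 f x))\<^sup>2)"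
  proof -
    have "(\<Sum>\<^sub>\<infinity>x. complex_of_real ((cmod (apply_ell2 f x))\<^sup>2)) =
        complex_of_real (\<Sum>\<^sub>\<infinity>x. (cmod (apply_ell2 f x))\<^sup>2)"
      using apply_ell2[of f]
      by (intro infsumI has_sum_of_real has_sum_infsum) simp
    then show ?thesis
      unfolding cinner.rep_eq complex_norm_square .
  qed
  show "0 \<le> inner f f"
    by (simp add: inner_ell2_def * infsum_nonneg)
  show "(inner f f = 0) = (f = 0)"
  proof
    assume "inner f f = 0"
    then have "(\<Sum>\<^sub>\<infinity>x. (cmod (apply_ell2 f x))\<^sup>2) = 0"
      by (simp add: inner_ell2_def *)
    then have "(cmod (apply_ell2 f x))\<^sup>2 = 0" for x
      using apply_ell2[of f] by (intro nonneg_infsum_le_0D[where A = UNIV]) auto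
    then show "f = 0" by (intro apply_ell2_inject[THEN iffD1]) (auto simp: zero_ell2.rep_eq)
  next
    assume "f = 0"
    then show "inner f f = 0" unfolding inner_ell2_def by (simp add: cinner.rep_eq zero_ell2.rep_eq)
  qed
  show "norm f = sqrt (inner f f)" by (rule norm_ell2_def)
qed

end


lemma bounded_linear_cscale: "bounded_linear (cscale c)"
proof (rule bounded_linear_intro[where K = "cmod c"])
  fix f g :: "'a ell2" and r :: real
  show "cscale c (f + g) = cscale c f + cscale c g" by transfer (simp add: distrib_left)
  show "cscale c (r *\<^sub>R f) = r *\<^sub>R cscale c f" by transfer (simp add: mult.left_commute)
  have "cinner (cscale c f) (cscale c f) = complex_of_real ((cmod c)\<^sup>2) * cinner f f"
    unfolding complex_norm_square
    by transfer (simp add: infsum_cmult_right'[symmetric] mult_ac)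
  then show "norm (cscale c f) \<le> norm f * cmod c"
    by (simp add: norm_ell2_def inner_ell2_def real_sqrt_mult)
qed


section \<open>Von Neumann algebras on \<open>\<ell>\<^sup>2\<close>\<close>

text \<open>
  The library's type of bounded operators is only real linear, so membership in
  \<open>B(\<ell>\<^sup>2)\<close> is the predicate \<open>complex_linear\<close> on that type.
\<close>

definition complex_linear :: "('a ell2 \<Rightarrow>\<^sub>L 'a ell2) \<Rightarrow> bool"
  where "complex_linear T \<longleftrightarrow> (\<forall>c \<xi>. T (cscale c \<xi>) = cscale c (T \<xi>))"

definition adj :: "('a ell2 \<Rightarrow>\<^sub>L 'a ell2) \<Rightarrow> 'a ell2 \<Rightarrow>\<^sub>L 'a ell2"
  where "adj T = (THE S :: 'a ell2 \<Rightarrow>\<^sub>L 'a ell2. \<forall>\<xi> \<eta>. cinner (T \<xi>) \<eta> = cinner \<xi> (S \<eta>))"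

lifting_forget ell2.lifting

lift_definition cscale_op :: "complex \<Rightarrow> ('a ell2 \<Rightarrow>\<^sub>L 'a ell2) \<Rightarrow> 'a ell2 \<Rightarrow>\<^sub>L 'a ell2"
  is "\<lambda>c T \<xi>. cscale c (T \<xi>)"
  by (rule bounded_linear_compose[OF bounded_linear_cscale])

text \<open>
  Unital *-subalgebras of \<open>B(\<ell>\<^sup>2)\<close> that are closed in the strong operator topology. The unit is
  always the identity operator, so von Neumann subalgebras share the unit of the ambient algebra.
\<close>

definition von_neumann_algebra :: "('a ell2 \<Rightarrow>\<^sub>L 'a ell2) set \<Rightarrow> bool"
  where "von_neumann_algebra M \<longleftrightarrow>
    (\<forall>T\<in>M. complex_linear T) \<and>
    id_blinfun \<in> M \<and>
    (\<forall>S\<in>M. \<forall>T\<in>M. S + T \<in> M) \<and>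
    (\<forall>c. \<forall>T\<in>M. cscale_op c T \<in> M) \<and>
    (\<forall>S\<in>M. \<forall>T\<in>M. S o\<^sub>L T \<in> M) \<and>
    (\<forall>T\<in>M. adj T \<in> M) \<and>
    closedin strong_operator_topology M"

definition von_neumann_subalgebra ::
    "('a ell2 \<Rightarrow>\<^sub>L 'a ell2) set \<Rightarrow> ('a ell2 \<Rightarrow>\<^sub>L 'a ell2) set \<Rightarrow> bool"
  where "von_neumann_subalgebra P M \<longleftrightarrow> von_neumann_algebra P \<and> P \<subseteq> M"


section \<open>Group von Neumann algebras\<close>

text \<open>
  These notions are meant for groups whose carrier is the whole type, so that the group acts
  on \<open>\<ell>\<^sup>2\<close> of the type.
\<close>

definition left_reg :: "('g, 'b) monoid_scheme \<Rightarrow> 'g \<Rightarrow> 'g ell2 \<Rightarrow>\<^sub>L 'g ell2"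
  where "left_reg G g =
    Blinfun (\<lambda>\<xi>. Abs_ell2 (\<lambda>x. apply_ell2 \<xi> (inv\<^bsub>G\<^esub> g \<otimes>\<^bsub>G\<^esub> x)))"

definition group_vn :: "('g, 'b) monoid_scheme \<Rightarrow> 'g set \<Rightarrow> ('g ell2 \<Rightarrow>\<^sub>L 'g ell2) set"
  where "group_vn G H = von_neumann_algebra hull (left_reg G ` H)"

definition trace :: "('g, 'b) monoid_scheme \<Rightarrow> ('g ell2 \<Rightarrow>\<^sub>L 'g ell2) \<Rightarrow> complex"
  where "trace G T = cinner (T (delta \<one>\<^bsub>G\<^esub>)) (delta \<one>\<^bsub>G\<^esub>)"

definition conj_invariant :: "('g, 'b) monoid_scheme \<Rightarrow> ('g ell2 \<Rightarrow>\<^sub>L 'g ell2) set \<Rightarrow> bool"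
  where "conj_invariant G P \<longleftrightarrow>
    (\<forall>g\<in>carrier G. (\<lambda>T. left_reg G g o\<^sub>L T o\<^sub>L adj (left_reg G g)) ` P = P)"

context
  fixes G :: "('g, 'b) monoid_scheme"
  assumes G: "group G" and carrier: "carrier G = UNIV"
begin

interpretation group G by (fact G)

lemma bij_left_mult: "bij (\<lambda>x. g \<otimes>\<^bsub>G\<^esub> x)"
  by (rule o_bij[where g = "\<lambda>x. inv\<^bsub>G\<^esub> g \<otimes>\<^bsub>G\<^esub> x"])
    (auto simp: fun_eq_iff m_assoc[symmetric] carrier)

lemma translate_ell2:
  "(\<lambda>x. (cmod (apply_ell2 \<xi> (g \<otimes>\<^bsub>G\<^esub> x)))\<^sup>2) summable_on UNIV"
  using apply_ell2[of \<xi>]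
    summable_on_reindex_bij_betw[OF bij_left_mult[of g], of "\<lambda>x. (cmod (apply_ell2 \<xi> x))\<^sup>2"]
  by simp

lemma apply_left_reg:
  "apply_ell2 (left_reg G g \<xi>) x = apply_ell2 \<xi> (inv\<^bsub>G\<^esub> g \<otimes>\<^bsub>G\<^esub> x)"
proof -
  define U where "U \<xi> = Abs_ell2 (\<lambda>x. apply_ell2 \<xi> (inv\<^bsub>G\<^esub> g \<otimes>\<^bsub>G\<^esub> x))" for \<xi> :: "'g ell2"
  have U: "apply_ell2 (U \<xi>) x = apply_ell2 \<xi> (inv\<^bsub>G\<^esub> g \<otimes>\<^bsub>G\<^esub> x)" for \<xi> x
    unfolding U_def by (subst Abs_ell2_inverse) (auto intro: translate_ell2)
  have "cinner (U \<xi>) (U \<xi>) = cinner \<xi> \<xi>" for \<xi>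
    unfolding cinner.rep_eq U
    by (rule infsum_reindex_bij_betw[OF bij_left_mult])
  then have "norm (U \<xi>) = norm \<xi>" for \<xi>
    by (simp add: norm_ell2_def inner_ell2_def)
  then have "bounded_linear U"
    by (intro bounded_linear_intro[where K = 1])
      (auto simp: apply_ell2_inject[symmetric] U plus_ell2.rep_eq scaleR_ell2.rep_eq fun_eq_iff)
  then have "left_reg G g \<xi> = U \<xi>"
    unfolding left_reg_def U_def by (simp add: bounded_linear_Blinfun_apply)
  then show ?thesis by (simp add: U)
qed

lemma left_reg_delta: "left_reg G g (delta h) = delta (g \<otimes>\<^bsub>G\<^esub> h)"
proof -
  have "inv\<^bsub>G\<^esub> g \<otimes>\<^bsub>G\<^esub> x = h \<longleftrightarrow> x = g \<otimes>\<^bsub>G\<^esub> h" for x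
    using inv_solve_left'[of h g x] by (auto simp: carrier)
  then show ?thesis
    by (simp add: apply_ell2_inject[symmetric] fun_eq_iff apply_left_reg delta.rep_eq)
qed

lemma adj_left_reg: "adj (left_reg G g) = left_reg G (inv\<^bsub>G\<^esub> g)"
  unfolding adj_def
proof (rule the_equality)
  have *: "cinner (left_reg G g \<xi>) \<eta> = cinner \<xi> (left_reg G (inv\<^bsub>G\<^esub> g) \<eta>)" for \<xi> \<eta>
    unfolding cinner.rep_eq apply_left_reg
    by (subst infsum_reindex_bij_betw[OF bij_left_mult[of g], symmetric])
      (simp add: m_assoc[symmetric] carrier)
  then show "\<forall>\<xi> \<eta>. cinner (left_reg G g \<xi>) \<eta> = cinner \<xi> (left_reg G (inv\<^bsub>G\<^esub> g) \<eta>)"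
    by blast
  fix S :: "'g ell2 \<Rightarrow>\<^sub>L 'g ell2"
  assume S: "\<forall>\<xi> \<eta>. cinner (left_reg G g \<xi>) \<eta> = cinner \<xi> (S \<eta>)"
  show "S = left_reg G (inv\<^bsub>G\<^esub> g)"
  proof (rule blinfun_eqI)
    fix \<eta>
    have "inner \<xi> (S \<eta>) = inner \<xi> (left_reg G (inv\<^bsub>G\<^esub> g) \<eta>)" for \<xi>
      using S * by (simp add: inner_ell2_def)
    then show "S \<eta> = left_reg G (inv\<^bsub>G\<^esub> g) \<eta>"
      using vector_eq_ldot by blast
  qed
qed

end


section \<open>The group \<open>\<int>\<^sup>n \<rtimes> SL\<^sub>n(\<int>)\<close>\<close>

typedef ('n :: finite) sl = "{A :: int^'n^'n. det A = 1}"
  morphisms sl_mat Abs_sl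
  by (rule exI[of _ "mat 1"]) simp

setup_lifting type_definition_sl

lift_definition sl_one :: "'n::finite sl" is "mat 1" by simp

lift_definition sl_mult :: "'n::finite sl \<Rightarrow> 'n sl \<Rightarrow> 'n sl" is "\<lambda>A B. A ** B"
  by (simp add: det_mul)

type_synonym 'n affine = "(int^'n) \<times> 'n sl"

definition affine_sl :: "'n::finite affine monoid"
  where "affine_sl =
    \<lparr>carrier = UNIV,
     mult = (\<lambda>(v, A) (w, B). (v + sl_mat A *v w, sl_mult A B)),
     one = (0, sl_one)\<rparr>"

lemma det_of_int:
  fixes A :: "int^'n^'n"
  shows "det (\<chi> i j. real_of_int (A $ i $ j)) = real_of_int (det A)"
  by (simp add: det_def)

lemma sl_left_inverse:
  fixes A :: "'n::finite sl"
  obtains B where "sl_mult B A = sl_one"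
proof -
  let ?r = "\<lambda>M::int^'n^'n. (\<chi> i j. real_of_int (M $ i $ j)) :: real^'n^'n"
  define M where "M = sl_mat A"
  have det: "det M = 1" unfolding M_def using sl_mat[of A] by simp
  define B :: "int^'n^'n"
    where "B = (\<chi> k l. det (\<chi> i j. if j = k then (if i = l then 1 else 0) else M $ i $ j))"
  have mult: "?r (X ** Y) = ?r X ** ?r Y" for X Y
    by (simp add: matrix_matrix_mult_def vec_eq_iff)
  have inj: "X = Y" if "?r X = ?r Y" for X Y
    using that by (simp add: vec_eq_iff)
  have one: "?r (mat 1) = mat 1"
    by (simp add: mat_def vec_eq_iff)
  have "?r M *v column l (?r B) = axis l 1" for l
  proof (subst cramer)
    show "det (?r M) \<noteq> 0" by (simp add: det_of_int det)
    have "?r B $ k $ l = det (\<chi> i j. if j = k then axis l 1 $ i else ?r M $ i $ j)" for k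
    proof -
      have "(\<chi> i j. if j = k then axis l 1 $ i else ?r M $ i $ j) =
          ?r (\<chi> i j. if j = k then (if i = l then 1 else 0) else M $ i $ j)"
        by (simp add: vec_eq_iff axis_def)
      then show ?thesis by (simp only: det_of_int) (simp add: B_def)
    qed
    then show "column l (?r B) =
        (\<chi> k. det (\<chi> i j. if j = k then axis l 1 $ i else ?r M $ i $ j) / det (?r M))"
      by (simp add: vec_eq_iff column_def det_of_int det)
  qed
  then have "?r M ** ?r B = mat 1"
    by (simp add: vec_eq_iff matrix_matrix_mult_def matrix_vector_mult_def column_def axis_def mat_def)
  then have "?r B ** ?r M = mat 1"
    using matrix_left_right_inverse by blast
  then have BM: "B ** M = mat 1"
    using mult[of B M] one inj by metis
  then have "det B = 1"
    using det_mul[of B M] det by simp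
  then have "sl_mult (Abs_sl B) A = sl_one"
    using BM by (simp add: sl_mat_inject[symmetric] sl_mult.rep_eq sl_one.rep_eq Abs_sl_inverse M_def)
  then show ?thesis by (rule that)
qed

lemma group_affine_sl: "group (affine_sl :: 'n::finite affine monoid)"
proof (rule groupI)
  fix x :: "'n affine"
  obtain v A where x: "x = (v, A)" by fastforce
  obtain B where B: "sl_mult B A = sl_one" by (rule sl_left_inverse)
  show "\<exists>y\<in>carrier affine_sl. y \<otimes>\<^bsub>affine_sl\<^esub> x = \<one>\<^bsub>affine_sl\<^esub>"
    by (rule bexI[of _ "(- (sl_mat B *v v), B)"]) (auto simp: affine_sl_def x B)
qed (auto simp: affine_sl_def sl_mat_inject[symmetric] sl_mult.rep_eq sl_one.rep_eq
      matrix_mul_assoc matrix_vector_right_distrib matrix_vector_mul_assoc add.assoc)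

definition multiples :: "int \<Rightarrow> 'n::finite affine set"
  where "multiples d = {(v, sl_one) | v. \<forall>i. d dvd v $ i}"

definition symmetric_part ::
    "int \<Rightarrow> ('n::finite affine ell2 \<Rightarrow>\<^sub>L 'n affine ell2) set"
  where "symmetric_part d =
    {x \<in> group_vn affine_sl (multiples d). \<forall>g\<in>multiples d.
      trace affine_sl (x o\<^sub>L left_reg affine_sl g) =
      trace affine_sl (x o\<^sub>L left_reg affine_sl (inv\<^bsub>affine_sl\<^esub> g))}"

end

theory Submission
  imports Defs
begin

text \<open>
  A von Neumann subalgebra \<open>P\<close> of \<open>L(G)\<close> is determined by the closure \<open>K\<close> of \<open>P \<delta>\<^sub>e\<close>, because an operator of
  \<open>L(G)\<close> whose value at \<open>\<delta>\<^sub>e\<close> lies in \<open>K\<close> commutes with the commutant of \<open>P\<close>. Hence no bounded conditional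
  expectation is needed: the orthogonal projection onto \<open>K\<close> is enough, and the vectors
  \<open>\<xi>\<^sub>g = proj \<delta>\<^sub>g\<close> satisfy \<open>\<xi>\<^sub>g * f = (g f g\<^sup>-\<^sup>1) * \<xi>\<^sub>g \<in> K\<close> for \<open>f \<in> K\<close>.

  Since \<open>\<xi>\<^sub>g\<close> is square summable and invariant under the centralizer of \<open>g\<close>, for \<open>v \<in> \<int>\<^sup>n\<close> it is supported on the line
  of \<open>v\<close>. Restricting products over two independent lines to a third line shows that the part of \<open>K\<close> on
  a line is closed under pointwise products, so it consists of the functions that are constant on
  the finite blocks of a partition of a set of integers; this set is a group \<open>d\<int>\<close> and the blocks are all
  \<open>{k}\<close> or all \<open>{k, -k}\<close>. Thus the part of \<open>K\<close> over \<open>\<int>\<^sup>n\<close> is trivial, or everything on \<open>d\<int>\<^sup>n\<close>, or the even functions on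
  \<open>d\<int>\<^sup>n\<close>. In the first case \<open>\<xi>\<^sub>g = 0\<close> for \<open>g \<notin> \<int>\<^sup>n\<close> by pairing \<open>\<xi>\<^sub>g\<close> with its conjugates by generic translations. In the
  other two, \<open>\<xi>\<^sub>g\<close> is supported on \<open>\<int>\<^sup>n g\<close>; it vanishes in the even case, since there \<open>\<xi>\<^sub>g * \<xi>\<^sub>g\<^sup>*\<close> and its translates by
  \<open>z - gz\<close> are all even, and in the remaining case commuting \<open>\<xi>\<^sub>g\<close> with its conjugates by generic transvections
  forces \<open>\<xi>\<^sub>g \<in> {0, \<delta>\<^sub>g}\<close>.
\<close>

section \<open>The Hilbert space\<close>

text \<open>Vectors of \<open>K\<close> are merely square summable, so two of them cannot be
  multiplied inside \<open>K\<close>; only products with some \<open>\<xi>\<^sub>g\<close> are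
  available. This suffices for pointwise products, because the indicators of blocks turn out to be
  multiples of the \<open>\<xi>\<^sub>g\<close> on the line. How lines interact is a matter of
  linear relations: a point \<open>k v + l w\<close> on the line of \<open>u\<close> receives the
  product of the values at \<open>k\<close> and at \<open>l\<close>, so the choice of three
  primitive vectors prescribes which pairs meet. Three such choices give pointwise products,
  dilations and sums of blocks. The matrix -1 resists the generic arguments twice. It commutes with
  every matrix, so conjugation by transvections alone does not change it, and \<open>- A\<close>
  acts on even functions exactly as \<open>A\<close> does. Both exceptions are settled by bringing
  in conjugation by translations, which does distinguish them. Limits along generic elements are
  taken over the net of finite sets: for each finite set an element is chosen that pushes the
  unwanted part of a vector off that set, and the vectors converge weakly to what remains.\<close>

lemma ell2_eqI: "(\<And>x. apply_ell2 f x = apply_ell2 g x) \<Longrightarrow> f = g"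
  by (metis apply_ell2_inject ext)

lemmas apply_ell2_simps [simp] =
  plus_ell2.rep_eq minus_ell2.rep_eq uminus_ell2.rep_eq zero_ell2.rep_eq
  scaleR_ell2.rep_eq cscale.rep_eq delta.rep_eq

lemma apply_ell2_sum [simp]: "apply_ell2 (sum f A) x = (\<Sum>a\<in>A. apply_ell2 (f a) x)"
  by (induction A rule: infinite_finite_induct) auto

lemma ell2_summable: "(\<lambda>x. (cmod (apply_ell2 f x))\<^sup>2) summable_on A"
  using apply_ell2[of f] by (auto intro: summable_on_subset_banach)

lemma cinner_summable: "(\<lambda>x. apply_ell2 f x * cnj (apply_ell2 g x)) summable_on A"
  by (intro ell2_mult_summable ell2_summable)

lemma cinner_commute: "cinner g f = cnj (cinner f g)"
  by (simp add: cinner.rep_eq infsum_cnj[symmetric] mult.commute)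

lemma cinner_add_left: "cinner (f + g) h = cinner f h + cinner g h"
  by (simp add: cinner.rep_eq distrib_right infsum_add cinner_summable)

lemma cinner_diff_left: "cinner (f - g) h = cinner f h - cinner g h"
  by (metis add_diff_cancel_right' cinner_add_left diff_add_cancel)

lemma cinner_add_right: "cinner h (f + g) = cinner h f + cinner h g"
  by (metis cinner_add_left cinner_commute complex_cnj_add)

lemma cinner_diff_right: "cinner h (f - g) = cinner h f - cinner h g"
  by (metis cinner_diff_left cinner_commute complex_cnj_diff)

lemma cinner_cscale_left: "cinner (cscale c f) g = c * cinner f g"
  by (simp add: cinner.rep_eq mult.assoc infsum_cmult_right')

lemma cinner_cscale_right: "cinner f (cscale c g) = cnj c * cinner f g"
  by (metis cinner_commute cinner_cscale_left complex_cnj_cnj complex_cnj_mult)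

lemma cinner_zero_left [simp]: "cinner 0 f = 0"
  by (simp add: cinner.rep_eq)

lemma cinner_zero_right [simp]: "cinner f 0 = 0"
  by (simp add: cinner.rep_eq)

lemma cinner_sum_left: "cinner (sum f A) g = (\<Sum>a\<in>A. cinner (f a) g)"
  by (induction A rule: infinite_finite_induct) (auto simp: cinner_add_left)

lemma cinner_delta_right [simp]: "cinner f (delta a) = apply_ell2 f a"
proof -
  have "cinner f (delta a) = (\<Sum>\<^sub>\<infinity>x\<in>{a}. apply_ell2 f x)"
    unfolding cinner.rep_eq by (rule infsum_cong_neutral) auto
  then show ?thesis by simp
qed

lemma cinner_delta_left [simp]: "cinner (delta a) f = cnj (apply_ell2 f a)"
  by (metis cinner_commute cinner_delta_right)

lemma norm_ell2_sq: "(norm f)\<^sup>2 = (\<Sum>\<^sub>\<infinity>x. (cmod (apply_ell2 f x))\<^sup>2)"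
  and cinner_self: "cinner f f = complex_of_real ((norm f)\<^sup>2)"
proof -
  have *: "cinner f f = complex_of_real (\<Sum>\<^sub>\<infinity>x. (cmod (apply_ell2 f x))\<^sup>2)"
  proof -
    have "(\<Sum>\<^sub>\<infinity>x. complex_of_real ((cmod (apply_ell2 f x))\<^sup>2)) =
        complex_of_real (\<Sum>\<^sub>\<infinity>x. (cmod (apply_ell2 f x))\<^sup>2)"
      by (intro infsumI has_sum_of_real has_sum_infsum ell2_summable)
    then show ?thesis
      unfolding cinner.rep_eq complex_norm_square .
  qed
  have "(norm f)\<^sup>2 = Re (cinner f f)"
    unfolding power2_norm_eq_inner inner_ell2_def ..
  with * show "(norm f)\<^sup>2 = (\<Sum>\<^sub>\<infinity>x. (cmod (apply_ell2 f x))\<^sup>2)" by simp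
  with * show "cinner f f = complex_of_real ((norm f)\<^sup>2)" by simp
qed

lemma finite_sum_le_norm_ell2:
  "finite F \<Longrightarrow> (\<Sum>x\<in>F. (cmod (apply_ell2 f x))\<^sup>2) \<le> (norm f)\<^sup>2"
  unfolding norm_ell2_sq by (intro finite_sum_le_infsum ell2_summable) auto

lemma cmod_apply_le_norm: "cmod (apply_ell2 f x) \<le> norm f"
  by (rule power2_le_imp_le) (use finite_sum_le_norm_ell2[of "{x}" f] in auto)

lemma norm_delta [simp]: "norm (delta a) = 1"
proof -
  have "complex_of_real ((norm (delta a))\<^sup>2) = 1"
    unfolding cinner_self[symmetric] by simp
  then have "(norm (delta a))\<^sup>2 = 1"
    by (metis of_real_eq_1_iff)
  then show ?thesis
    using norm_ge_zero[of "delta a"] by (auto simp: power2_eq_1_iff)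
qed

lemma norm_cscale [simp]: "norm (cscale c f) = cmod c * norm f"
proof -
  have "complex_of_real ((norm (cscale c f))\<^sup>2) = c * cnj c * cinner f f"
    unfolding cinner_self[symmetric] by (simp add: cinner_cscale_left cinner_cscale_right)
  also have "\<dots> = complex_of_real ((cmod c * norm f)\<^sup>2)"
    unfolding cinner_self complex_norm_square[symmetric] power_mult_distrib by simp
  finally have "(norm (cscale c f))\<^sup>2 = (cmod c * norm f)\<^sup>2"
    unfolding of_real_eq_iff .
  then show ?thesis by (simp add: power2_eq_iff_nonneg)
qed

lemma cinner_Cauchy_Schwarz: "cmod (cinner f g) \<le> norm f * norm g"
proof (cases "cinner f g = 0")
  case False
  define c where "c = cnj (cinner f g) / cmod (cinner f g)"
  have c: "cmod c = 1" using False by (simp add: c_def norm_divide)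
  have "cinner (cscale c f) g = complex_of_real (cmod (cinner f g))"
    using False by (simp add: c_def cinner_cscale_left mult.commute complex_norm_square[symmetric] power2_eq_square)
  then have "cmod (cinner f g) = inner (cscale c f) g"
    by (simp add: inner_ell2_def)
  also have "\<dots> \<le> norm (cscale c f) * norm g"
    by (rule norm_cauchy_schwarz)
  finally show ?thesis using c by simp
qed simp

lemma inner_zero_imp_cinner_zero:
  assumes "inner f g = 0" "inner f (cscale \<i> g) = 0"
  shows "cinner f g = 0"
  using assms by (simp add: inner_ell2_def cinner_cscale_right complex_eq_iff)

section \<open>Completeness and weak convergence of square-summable functions\<close>

lemma bounded_sums_ell2:
  fixes f :: "'a \<Rightarrow> complex"
  assumes "\<And>F. finite F \<Longrightarrow> (\<Sum>x\<in>F. (cmod (f x))\<^sup>2) \<le> B\<^sup>2" and "0 \<le> B"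
  obtains g where "\<And>x. apply_ell2 g x = f x" "norm g \<le> B"
proof -
  have s: "(\<lambda>x. (cmod (f x))\<^sup>2) summable_on UNIV"
    using assms(1) by (intro nonneg_bdd_above_summable_on bdd_aboveI2[where M = "B\<^sup>2"]) auto
  then have g: "apply_ell2 (Abs_ell2 f) x = f x" for x
    by (simp add: Abs_ell2_inverse)
  have "(norm (Abs_ell2 f))\<^sup>2 \<le> B\<^sup>2"
    unfolding norm_ell2_sq g using s assms(1) by (intro infsum_le_finite_sums) auto
  then have "norm (Abs_ell2 f) \<le> B"
    using assms(2) by (rule power2_le_imp_le)
  with g show ?thesis using that by blast
qed

instance ell2 :: (type) complete_space
proof
  fix X :: "nat \<Rightarrow> 'a ell2"
  assume X: "Cauchy X"
  have "Cauchy (\<lambda>n. apply_ell2 (X n) x)" for x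
  proof (rule CauchyI)
    fix e :: real assume "e > 0"
    then obtain M where M: "\<And>m n. m \<ge> M \<Longrightarrow> n \<ge> M \<Longrightarrow> norm (X m - X n) < e"
      using X by (meson CauchyD)
    have "norm (apply_ell2 (X m) x - apply_ell2 (X n) x) < e" if "m \<ge> M" "n \<ge> M" for m n
      using cmod_apply_le_norm[of "X m - X n" x] M[OF that] by simp
    then show "\<exists>M. \<forall>m\<ge>M. \<forall>n\<ge>M. norm (apply_ell2 (X m) x - apply_ell2 (X n) x) < e"
      by blast
  qed
  then have "\<exists>l. (\<lambda>n. apply_ell2 (X n) x) \<longlonglongrightarrow> l" for x
    by (simp add: Cauchy_convergent_iff convergent_def)
  then obtain f where f: "\<And>x. (\<lambda>n. apply_ell2 (X n) x) \<longlonglongrightarrow> f x" by metis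
  \<comment> \<open>The pointwise limit \<open>f\<close> is not yet known to be square summable. The
    differences \<open>X n - f\<close> are, by the uniform bound on their finite partial sums, so
    the limit vector is recovered as \<open>X M - h\<close>.\<close>
  have tail: "\<exists>h. (\<forall>x. apply_ell2 h x = apply_ell2 (X n) x - f x) \<and> norm h \<le> e"
    if "e > 0" "\<And>m. m \<ge> M \<Longrightarrow> norm (X n - X m) < e" for e n M
  proof -
    have "(\<Sum>x\<in>F. (cmod (apply_ell2 (X n) x - f x))\<^sup>2) \<le> e\<^sup>2" if "finite F" for F
    proof (rule LIMSEQ_le_const2)
      show "(\<lambda>m. \<Sum>x\<in>F. (cmod (apply_ell2 (X n) x - apply_ell2 (X m) x))\<^sup>2) \<longlonglongrightarrow>
          (\<Sum>x\<in>F. (cmod (apply_ell2 (X n) x - f x))\<^sup>2)"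
        by (intro tendsto_intros f)
      have "(\<Sum>x\<in>F. (cmod (apply_ell2 (X n) x - apply_ell2 (X m) x))\<^sup>2) \<le> e\<^sup>2" if "m \<ge> M" for m
        using finite_sum_le_norm_ell2[OF \<open>finite F\<close>, of "X n - X m"]
          power_mono[of "norm (X n - X m)" e 2] \<open>\<And>m. m \<ge> M \<Longrightarrow> _\<close>[OF that] by simp
      then show "\<exists>N. \<forall>m\<ge>N. (\<Sum>x\<in>F. (cmod (apply_ell2 (X n) x - apply_ell2 (X m) x))\<^sup>2) \<le> e\<^sup>2"
        by blast
    qed
    then obtain h where "\<And>x. apply_ell2 h x = apply_ell2 (X n) x - f x" "norm h \<le> e"
      using bounded_sums_ell2[of "\<lambda>x. apply_ell2 (X n) x - f x" e] \<open>e > 0\<close> by auto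
    then show ?thesis by blast
  qed
  obtain M where "\<And>m. m \<ge> M \<Longrightarrow> norm (X M - X m) < 1"
    using X by (meson CauchyD le_refl zero_less_one)
  then obtain h where h: "\<And>x. apply_ell2 h x = apply_ell2 (X M) x - f x"
    using tail[of 1 M M] by auto
  define l where "l = X M - h"
  have l: "apply_ell2 l x = f x" for x
    by (simp add: l_def h)
  have "X \<longlonglongrightarrow> l"
  proof (rule LIMSEQ_I)
    fix e :: real assume "e > 0"
    then obtain M where M: "\<And>m n. m \<ge> M \<Longrightarrow> n \<ge> M \<Longrightarrow> norm (X m - X n) < e / 2"
      using X by (meson CauchyD half_gt_zero)
    have "norm (X n - l) < e" if "n \<ge> M" for n
    proof -
      obtain h where h: "\<And>x. apply_ell2 h x = apply_ell2 (X n) x - f x" "norm h \<le> e / 2"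
        using tail[of "e/2" M n] M[OF \<open>n \<ge> M\<close>] \<open>e > 0\<close> by force
      have "X n - l = h" by (rule ell2_eqI) (simp add: l h)
      then show ?thesis using h \<open>e > 0\<close> by simp
    qed
    then show "\<exists>no. \<forall>n\<ge>no. norm (X n - l) < e" by blast
  qed
  then show "convergent X" by (auto simp: convergent_def)
qed

lemma apply_ell2_tendsto:
  assumes "(f \<longlongrightarrow> l) F" shows "((\<lambda>n. apply_ell2 (f n) x) \<longlongrightarrow> apply_ell2 l x) F"
proof (rule metric_tendsto_imp_tendsto[OF assms], rule always_eventually, rule allI)
  show "dist (apply_ell2 (f n) x) (apply_ell2 l x) \<le> dist (f n) l" for n
    using cmod_apply_le_norm[of "f n - l" x] by (simp add: dist_norm)
qed

lemma cinner_tendsto_left: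
  assumes "(f \<longlongrightarrow> l) F" shows "((\<lambda>n. cinner (f n) g) \<longlongrightarrow> cinner l g) F"
proof -
  have "((\<lambda>n. norm g * norm (f n - l)) \<longlongrightarrow> norm g * norm (l - l)) F"
    by (intro tendsto_intros assms)
  then have lim: "((\<lambda>n. norm g * norm (f n - l)) \<longlongrightarrow> 0) F" by simp
  have "norm (cinner (f n) g - cinner l g) \<le> norm g * norm (f n - l)" for n
    using cinner_Cauchy_Schwarz[of "f n - l" g] by (simp add: cinner_diff_left mult.commute)
  then have "((\<lambda>n. cinner (f n) g - cinner l g) \<longlongrightarrow> 0) F"
    by (intro Lim_null_comparison[OF always_eventually lim]) auto
  then show ?thesis by (simp add: LIM_zero_iff)
qed

lemma cinner_tendsto_right:
  assumes "(f \<longlongrightarrow> l) F" shows "((\<lambda>n. cinner g (f n)) \<longlongrightarrow> cinner g l) F"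
  using tendsto_cnj[OF cinner_tendsto_left[OF assms, of g]] by (simp add: cinner_commute[symmetric])

lemma finite_sums_delta_tendsto:
  "((\<lambda>S. \<Sum>x\<in>S. cscale (apply_ell2 g x) (delta x)) \<longlongrightarrow> g) (finite_subsets_at_top UNIV)"
proof (rule tendstoI)
  fix d :: real assume d: "d > 0"
  define G where "G S = (\<Sum>x\<in>S. cscale (apply_ell2 g x) (delta x))" for S
  have "((\<lambda>x. (cmod (apply_ell2 g x))\<^sup>2) has_sum (norm g)\<^sup>2) UNIV"
    unfolding norm_ell2_sq by (intro has_sum_infsum ell2_summable)
  then have "\<forall>\<^sub>F S in finite_subsets_at_top UNIV. dist (\<Sum>x\<in>S. (cmod (apply_ell2 g x))\<^sup>2) ((norm g)\<^sup>2) < d\<^sup>2"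
    unfolding has_sum_def using d by (intro tendstoD) auto
  moreover have "\<forall>\<^sub>F S in finite_subsets_at_top (UNIV :: 'a set). finite S"
    by (rule eventually_finite_subsets_at_top_weakI)
  ultimately show "\<forall>\<^sub>F S in finite_subsets_at_top UNIV. dist (\<Sum>x\<in>S. cscale (apply_ell2 g x) (delta x)) g < d"
  proof eventually_elim
    fix S :: "'a set"
    assume S: "dist (\<Sum>x\<in>S. (cmod (apply_ell2 g x))\<^sup>2) ((norm g)\<^sup>2) < d\<^sup>2" "finite S"
    have aG: "apply_ell2 (G S) x = (if x \<in> S then apply_ell2 g x else 0)" for x
      using S(2) by (simp add: G_def if_distrib cong: if_cong)
    have inn: "cinner (G S) h = (\<Sum>x\<in>S. apply_ell2 g x * cnj (apply_ell2 h x))" for h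
      by (simp add: G_def cinner_sum_left cinner_cscale_left)
    have GS: "cinner (G S) (G S) = (\<Sum>x\<in>S. (cmod (apply_ell2 g x))\<^sup>2)"
      "cinner (G S) g = (\<Sum>x\<in>S. (cmod (apply_ell2 g x))\<^sup>2)"
      unfolding inn of_real_sum complex_norm_square by (simp_all add: aG)
    then have "cinner g (G S) = (\<Sum>x\<in>S. (cmod (apply_ell2 g x))\<^sup>2)"
      by (subst cinner_commute) simp
    then have "cinner (g - G S) (g - G S) = complex_of_real ((norm g)\<^sup>2 - (\<Sum>x\<in>S. (cmod (apply_ell2 g x))\<^sup>2))"
      using GS unfolding cinner_diff_left cinner_diff_right cinner_self[of g] by simp
    then have "(norm (g - G S))\<^sup>2 = (norm g)\<^sup>2 - (\<Sum>x\<in>S. (cmod (apply_ell2 g x))\<^sup>2)"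
      unfolding cinner_self of_real_eq_iff .
    then have "(norm (g - G S))\<^sup>2 < d\<^sup>2"
      using S(1) by (simp add: dist_real_def)
    then have "norm (g - G S) < d"
      using d by (simp add: power2_less_imp_less)
    then show "dist (\<Sum>x\<in>S. cscale (apply_ell2 g x) (delta x)) g < d"
      by (simp add: dist_norm norm_minus_commute G_def)
  qed
qed

text \<open>On a finitely supported test vector pointwise convergence suffices, and the uniform
  bound controls the error of replacing \<open>g\<close> by such a vector. The filter is arbitrary
  because later limits run over the finite subsets of an infinite set.\<close>

lemma weak_tendsto:
  assumes bdd: "\<And>t. norm (f t) \<le> B"
    and lim: "\<And>x. ((\<lambda>t. apply_ell2 (f t) x) \<longlongrightarrow> apply_ell2 l x) F"
  shows "((\<lambda>t. cinner (f t) g) \<longlongrightarrow> cinner l g) F"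
proof (rule tendstoI)
  fix e :: real assume e: "e > 0"
  define C where "C = B + norm l + 1"
  have C: "norm (f t - l) \<le> C" "C > 0" for t
    using norm_triangle_ineq4[of "f t" l] bdd[of t] norm_ge_zero[of "f t"] norm_ge_zero[of l]
    unfolding C_def by linarith+
  define d where "d = e / (2 * C)"
  have d: "d > 0" using e C by (simp add: d_def)
  define G where "G S = (\<Sum>x\<in>S. cscale (apply_ell2 g x) (delta x))" for S
  have inn: "cinner (G S) h = (\<Sum>x\<in>S. apply_ell2 g x * cnj (apply_ell2 h x))" for S h
    by (simp add: G_def cinner_sum_left cinner_cscale_left)
  obtain S where S: "finite S" "dist (G S) g < d"
    using tendstoD[OF finite_sums_delta_tendsto[of g] d]
    unfolding eventually_finite_subsets_at_top G_def by blast
  then have small: "norm (g - G S) < d"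
    by (simp add: dist_norm norm_minus_commute)
  have "((\<lambda>t. \<Sum>x\<in>S. (apply_ell2 (f t) x - apply_ell2 l x) * cnj (apply_ell2 g x)) \<longlongrightarrow>
      (\<Sum>x\<in>S. (apply_ell2 l x - apply_ell2 l x) * cnj (apply_ell2 g x))) F"
    by (intro tendsto_intros lim)
  then have "\<forall>\<^sub>F t in F. dist (\<Sum>x\<in>S. (apply_ell2 (f t) x - apply_ell2 l x) * cnj (apply_ell2 g x)) 0 < e / 2"
    using e by (intro tendstoD) auto
  then show "\<forall>\<^sub>F t in F. dist (cinner (f t) g) (cinner l g) < e"
  proof (rule eventually_mono)
    fix t assume t: "dist (\<Sum>x\<in>S. (apply_ell2 (f t) x - apply_ell2 l x) * cnj (apply_ell2 g x)) 0 < e / 2"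
    have "cinner (f t - l) (G S) = cnj (cinner (G S) (f t - l))" by (rule cinner_commute)
    then have "cmod (cinner (f t - l) (G S)) < e / 2"
      using t by (simp add: inn mult.commute)
    moreover have "cmod (cinner (f t - l) (g - G S)) < e / 2"
    proof -
      have "cmod (cinner (f t - l) (g - G S)) \<le> norm (f t - l) * norm (g - G S)"
        by (rule cinner_Cauchy_Schwarz)
      also have "\<dots> \<le> C * norm (g - G S)"
        using C by (intro mult_right_mono) auto
      also have "\<dots> < C * d" using small C by simp
      finally show ?thesis using C by (simp add: d_def)
    qed
    moreover have "cinner (f t) g - cinner l g = cinner (f t - l) (G S) + cinner (f t - l) (g - G S)"
      by (simp add: cinner_diff_left cinner_diff_right)
    ultimately show "dist (cinner (f t) g) (cinner l g) < e"
      unfolding dist_norm by (smt (verit) norm_triangle_ineq field_sum_of_halves)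
  qed
qed

text \<open>Each further equal coefficient adds the same amount to the squared norm. Applied along
  infinite orbits of the symmetries of a vector, this is what determines supports.\<close>

lemma ell2_inj_seq_eq_0:
  assumes "inj s" and "\<And>t :: nat. apply_ell2 f (s t) = c"
  shows "c = 0"
proof (rule ccontr)
  assume "c \<noteq> 0"
  have "real N * (cmod c)\<^sup>2 \<le> (norm f)\<^sup>2" for N
    using finite_sum_le_norm_ell2[of "s ` {..<N}" f] assms
    by (simp add: sum.reindex inj_on_subset[OF assms(1)])
  moreover obtain N where "(norm f)\<^sup>2 / (cmod c)\<^sup>2 < real N" using reals_Archimedean2 by blast
  then have "(norm f)\<^sup>2 < real N * (cmod c)\<^sup>2"
    using \<open>c \<noteq> 0\<close> by (simp add: divide_less_eq)
  ultimately show False using linorder_not_less by blast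
qed

text \<open>Only finitely many coefficients exceed a given bound, and \<open>s t\<close> eventually
  avoids each of them.\<close>

lemma ell2_tendsto_0:
  assumes "\<And>a. \<forall>\<^sub>F t in F. s t \<noteq> a"
  shows "((\<lambda>t. apply_ell2 f (s t)) \<longlongrightarrow> 0) F"
proof (rule tendstoI)
  fix e :: real assume e: "e > 0"
  define A where "A = {a. cmod (apply_ell2 f a) \<ge> e}"
  have "finite A"
  proof (rule ccontr)
    assume inf: "infinite A"
    obtain N where N: "(norm f)\<^sup>2 / e\<^sup>2 < real N" using reals_Archimedean2 by blast
    obtain S where S: "S \<subseteq> A" "finite S" "card S = N"
      using infinite_arbitrarily_large[OF inf] by metis
    have "real N * e\<^sup>2 = (\<Sum>x\<in>S. e\<^sup>2)" using S by simp
    also have "\<dots> \<le> (\<Sum>x\<in>S. (cmod (apply_ell2 f x))\<^sup>2)"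
      using S e by (intro sum_mono power_mono) (auto simp: A_def)
    also have "\<dots> \<le> (norm f)\<^sup>2" using S by (intro finite_sum_le_norm_ell2)
    finally show False using N e by (simp add: divide_less_eq)
  qed
  then have "\<forall>\<^sub>F t in F. \<forall>a\<in>A. s t \<noteq> a"
    using assms by (simp add: eventually_ball_finite)
  then show "\<forall>\<^sub>F t in F. dist (apply_ell2 f (s t)) 0 < e"
    by eventually_elim (force simp: A_def)
qed

section \<open>Orthogonal projections\<close>

lemma orthogonal_decomposition:
  fixes V :: "'a :: {real_inner, complete_space} set"
  assumes V: "subspace V" "closed V"
  shows "\<exists>y\<in>V. \<forall>z\<in>V. inner (x - y) z = 0"
proof -
  have ne: "V \<noteq> {}" using subspace_0[OF V(1)] by auto
  define d where "d = infdist x V"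
  have d0: "0 \<le> d" by (simp add: d_def infdist_nonneg)
  have d_le: "d \<le> norm (x - y)" if "y \<in> V" for y
    using infdist_le[OF that, of x] by (simp add: d_def dist_norm)
  have "\<exists>y\<in>V. norm (x - y) < d + 1 / (real n + 1)" for n :: nat
  proof (rule ccontr)
    assume "\<not> ?thesis"
    then have "d + 1 / (real n + 1) \<le> d"
      unfolding d_def infdist_notempty[OF ne] using ne
      by (intro cINF_greatest) (auto simp: dist_norm not_less)
    moreover have "0 < 1 / (real n + 1)" by simp
    ultimately show False by linarith
  qed
  then obtain y where y: "\<And>n. y n \<in> V" "\<And>n :: nat. norm (x - y n) < d + 1 / (real n + 1)"
    by metis
  \<comment> \<open>Parallelogram identity: the midpoint of \<open>y m\<close> and
    \<open>y n\<close> lies in \<open>V\<close>, hence at distance at least \<open>d\<close> from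
    \<open>x\<close>.\<close>
  have par: "(norm (y m - y n))\<^sup>2 \<le> (2 * (norm (x - y m))\<^sup>2 - 2 * d\<^sup>2) + (2 * (norm (x - y n))\<^sup>2 - 2 * d\<^sup>2)" for m n
  proof -
    have "(1 / 2) *\<^sub>R (y m + y n) \<in> V"
      using V(1) y(1) by (intro subspace_scale subspace_add)
    then have "d\<^sup>2 \<le> (norm (x - (1 / 2) *\<^sub>R (y m + y n)))\<^sup>2"
      using d_le d0 by (intro power_mono) auto
    moreover have "(norm (y m - y n))\<^sup>2 + 4 * (norm (x - (1 / 2) *\<^sub>R (y m + y n)))\<^sup>2
        = 2 * (norm (x - y m))\<^sup>2 + 2 * (norm (x - y n))\<^sup>2"
      unfolding power2_norm_eq_inner
      by (simp add: inner_diff_left inner_diff_right inner_add_left inner_add_right inner_commute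
          algebra_simps)
    ultimately show ?thesis by linarith
  qed
  have "Cauchy y"
  proof (rule CauchyI)
    fix e :: real assume e: "e > 0"
    have "(\<lambda>n. 2 * (d + 1 / (real n + 1))\<^sup>2 - 2 * d\<^sup>2) \<longlonglongrightarrow> 2 * (d + 0)\<^sup>2 - 2 * d\<^sup>2"
      using LIMSEQ_inverse_real_of_nat
      by (intro tendsto_intros) (simp add: inverse_eq_divide add.commute)
    then have "\<forall>\<^sub>F n in sequentially. 2 * (d + 1 / (real n + 1))\<^sup>2 - 2 * d\<^sup>2 < e\<^sup>2 / 2"
      using e by (intro order_tendstoD) auto
    then obtain N where N: "\<And>n. n \<ge> N \<Longrightarrow> 2 * (d + 1 / (real n + 1))\<^sup>2 - 2 * d\<^sup>2 < e\<^sup>2 / 2"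
      unfolding eventually_sequentially by blast
    have "2 * (norm (x - y n))\<^sup>2 - 2 * d\<^sup>2 < e\<^sup>2 / 2" if "n \<ge> N" for n
      using N[OF that] power_mono[of "norm (x - y n)" "d + 1 / (real n + 1)" 2] y(2)[of n] by simp
    then have "(norm (y m - y n))\<^sup>2 < e\<^sup>2" if "m \<ge> N" "n \<ge> N" for m n
      using par[of m n] that by (smt (verit) field_sum_of_halves)
    then have "norm (y m - y n) < e" if "m \<ge> N" "n \<ge> N" for m n
      using that e by (meson power2_less_imp_less less_imp_le)
    then show "\<exists>M. \<forall>m\<ge>M. \<forall>n\<ge>M. norm (y m - y n) < e" by blast
  qed
  then obtain l where l: "y \<longlonglongrightarrow> l"
    using Cauchy_convergent_iff convergent_def by blast
  have lV: "l \<in> V"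
    using closed_sequentially[OF V(2) _ l] y(1) by blast
  have "norm (x - l) \<le> d"
  proof (rule LIMSEQ_le)
    show "(\<lambda>n. norm (x - y n)) \<longlonglongrightarrow> norm (x - l)" by (intro tendsto_intros l)
    have "(\<lambda>n. d + 1 / (real n + 1)) \<longlonglongrightarrow> d + 0"
      using LIMSEQ_inverse_real_of_nat
      by (intro tendsto_intros) (simp add: inverse_eq_divide add.commute)
    then show "(\<lambda>n. d + 1 / (real n + 1)) \<longlonglongrightarrow> d" by simp
    show "\<exists>N. \<forall>n\<ge>N. norm (x - y n) \<le> d + 1 / (real n + 1)"
      using y(2) less_imp_le by blast
  qed
  have "inner (x - l) z = 0" if z: "z \<in> V" for z
  proof (cases "z = 0")
    case False
    \<comment> \<open>The multiple of \<open>z\<close> that best approximates the residual; a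
      nonzero inner product would bring the distance below \<open>d\<close>.\<close>
    define t where "t = inner (x - l) z / (norm z)\<^sup>2"
    have "l + t *\<^sub>R z \<in> V" using V(1) lV z by (intro subspace_add subspace_scale)
    then have "norm (x - l) \<le> norm (x - (l + t *\<^sub>R z))"
      using d_le \<open>norm (x - l) \<le> d\<close> order_trans by blast
    then have "(norm (x - l))\<^sup>2 \<le> (norm (x - (l + t *\<^sub>R z)))\<^sup>2"
      by (intro power_mono) auto
    also have "\<dots> = (norm (x - l))\<^sup>2 - 2 * t * inner (x - l) z + t\<^sup>2 * (norm z)\<^sup>2"
      unfolding power2_norm_eq_inner
      by (simp add: inner_diff_left inner_diff_right inner_add_left inner_add_right inner_commute
          power2_eq_square algebra_simps)
    finally have "2 * t * inner (x - l) z \<le> t\<^sup>2 * (norm z)\<^sup>2" by simp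
    moreover have "t * (norm z)\<^sup>2 = inner (x - l) z" using False by (simp add: t_def)
    then have "t\<^sup>2 * (norm z)\<^sup>2 = t * inner (x - l) z" by (simp add: power2_eq_square)
    ultimately have "t * inner (x - l) z \<le> 0" by simp
    then have "(inner (x - l) z)\<^sup>2 / (norm z)\<^sup>2 \<le> 0" by (simp add: t_def power2_eq_square)
    then have "(inner (x - l) z)\<^sup>2 \<le> 0" using False by (simp add: divide_le_0_iff)
    then show ?thesis by simp
  qed simp
  with lV show ?thesis by blast
qed

text \<open>The real inner product is used although the spaces in question are complex. This admits
  conjugate linear maps such as \<open>involution\<close>, and compatibility with complex scalars
  follows from \<open>ortho_proj_commute\<close> applied to \<open>cscale\<close>.\<close>

definition ortho_proj :: "'a :: {real_inner, complete_space} set \<Rightarrow> 'a \<Rightarrow> 'a"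
  where "ortho_proj V x = (SOME y. y \<in> V \<and> (\<forall>z\<in>V. inner (x - y) z = 0))"

context
  fixes V :: "'a :: {real_inner, complete_space} set"
  assumes V: "subspace V" "closed V"
begin

lemma ortho_proj_mem: "ortho_proj V x \<in> V"
  and ortho_proj_orthogonal: "z \<in> V \<Longrightarrow> inner (x - ortho_proj V x) z = 0"
  using someI_ex[of "\<lambda>y. y \<in> V \<and> (\<forall>z\<in>V. inner (x - y) z = 0)"] orthogonal_decomposition[OF V, of x]
  unfolding ortho_proj_def by blast+

lemma ortho_proj_unique:
  assumes "y \<in> V" and "\<And>z. z \<in> V \<Longrightarrow> inner (x - y) z = 0"
  shows "ortho_proj V x = y"
proof -
  define w where "w = ortho_proj V x - y"
  have "w \<in> V" using assms(1) ortho_proj_mem V(1) by (simp add: w_def subspace_diff)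
  then have "inner w w = 0"
    using assms(2)[of w] ortho_proj_orthogonal[of w x] by (simp add: w_def inner_diff_left)
  then show ?thesis by (simp add: w_def)
qed

lemma ortho_proj_id: "x \<in> V \<Longrightarrow> ortho_proj V x = x"
  by (rule ortho_proj_unique) auto

lemma ortho_proj_linear: "linear (ortho_proj V)"
proof (rule linearI)
  show "ortho_proj V (x + y) = ortho_proj V x + ortho_proj V y" for x y
    using V(1) ortho_proj_mem ortho_proj_orthogonal[of _ x] ortho_proj_orthogonal[of _ y]
    by (intro ortho_proj_unique) (auto simp: subspace_add inner_diff_left inner_add_left)
  show "ortho_proj V (c *\<^sub>R x) = c *\<^sub>R ortho_proj V x" for c x
    using V(1) ortho_proj_mem ortho_proj_orthogonal[of _ x]
    by (intro ortho_proj_unique) (auto simp: subspace_scale inner_diff_left)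
qed

lemma norm_ortho_proj_le: "norm (ortho_proj V x) \<le> norm x"
proof -
  have "(norm x)\<^sup>2 = (norm (ortho_proj V x))\<^sup>2 + (norm (x - ortho_proj V x))\<^sup>2"
    using ortho_proj_orthogonal[OF ortho_proj_mem, of x x] unfolding power2_norm_eq_inner
    by (simp add: inner_diff_left inner_diff_right inner_commute)
  then show ?thesis using power2_le_imp_le[of "norm (ortho_proj V x)" "norm x"] by simp
qed

lemma ortho_proj_bounded_linear: "bounded_linear (ortho_proj V)"
  using ortho_proj_linear norm_ortho_proj_le
  by (intro bounded_linear.intro bounded_linear_axioms.intro exI[of _ 1]) auto

text \<open>The residual of \<open>S x\<close> pairs with \<open>z\<close> as the residual of
  \<open>x\<close> pairs with \<open>S' z\<close>, and \<open>S' z\<close> is again in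
  \<open>V\<close>.\<close>

lemma ortho_proj_commute:
  assumes "\<And>x y. S (x - y) = S x - S y" and "S ` V \<subseteq> V" and "S' ` V \<subseteq> V"
    and "\<And>a b. inner (S a) b = inner a (S' b)"
  shows "ortho_proj V (S x) = S (ortho_proj V x)"
proof (rule ortho_proj_unique)
  show "S (ortho_proj V x) \<in> V" using assms(2) ortho_proj_mem by blast
  show "inner (S x - S (ortho_proj V x)) z = 0" if "z \<in> V" for z
    using ortho_proj_orthogonal[of "S' z" x] assms(3) that
    by (auto simp: assms(1)[symmetric] assms(4))
qed

end

lemma subspace_closure:
  fixes V :: "'a :: real_normed_vector set"
  assumes "subspace V" shows "subspace (closure V)"
proof (rule subspaceI)
  show "0 \<in> closure V" using assms closure_subset subspace_0 by blast
  show "x + y \<in> closure V" if "x \<in> closure V" "y \<in> closure V" for x y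
  proof -
    obtain a b where "\<And>n. a n \<in> V" "a \<longlonglongrightarrow> x" "\<And>n. b n \<in> V" "b \<longlonglongrightarrow> y"
      using \<open>x \<in> _\<close> \<open>y \<in> _\<close> unfolding closure_sequential by blast
    then show ?thesis
      unfolding closure_sequential
      by (intro exI[of _ "\<lambda>n. a n + b n"]) (auto intro: tendsto_add subspace_add assms)
  qed
  show "c *\<^sub>R x \<in> closure V" if "x \<in> closure V" for c x
  proof -
    obtain a where "\<And>n. a n \<in> V" "a \<longlonglongrightarrow> x"
      using \<open>x \<in> _\<close> unfolding closure_sequential by blast
    then show ?thesis
      unfolding closure_sequential
      by (intro exI[of _ "\<lambda>n. c *\<^sub>R a n"]) (auto intro: tendsto_scaleR subspace_scale assms)
  qed
qed

lemma bounded_linear_closure_image: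
  assumes "bounded_linear f" and "f ` V \<subseteq> V" shows "f ` closure V \<subseteq> closure V"
  using assms closure_subset
  by (intro image_closure_subset linear_continuous_on) auto

section \<open>Adjoints\<close>

lemma complex_linearD: "complex_linear T \<Longrightarrow> T (cscale c \<xi>) = cscale c (T \<xi>)"
  by (simp add: complex_linear_def)

text \<open>The representing vector is forced at each point mass. Its square summability comes from
  testing \<open>T\<close> on its own finite truncations, whose norm is thereby bounded by
  \<open>norm T * norm \<eta>\<close>.\<close>

lemma complex_linear_riesz:
  fixes T :: "'a ell2 \<Rightarrow>\<^sub>L 'b ell2"
  assumes T: "\<And>c \<xi>. T (cscale c \<xi>) = cscale c (T \<xi>)"
  shows "\<exists>\<zeta>. \<forall>\<xi>. cinner (T \<xi>) \<eta> = cinner \<xi> \<zeta>"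
proof -
  define f where "f a = cnj (cinner (T (delta a)) \<eta>)" for a
  have "(\<Sum>x\<in>F. (cmod (f x))\<^sup>2) \<le> (norm T * norm \<eta>)\<^sup>2" if F: "finite F" for F
  proof -
    define v where "v = (\<Sum>x\<in>F. cscale (f x) (delta x))"
    have v: "apply_ell2 v x = (if x \<in> F then f x else 0)" for x
      using F by (simp add: v_def if_distrib cong: if_cong)
    have "cinner v v = (\<Sum>x\<in>F. f x * cnj (f x))"
      unfolding v_def[THEN arg_cong, of "\<lambda>w. cinner w v"] cinner_sum_left
      by (simp add: cinner_cscale_left v)
    then have nv: "complex_of_real ((norm v)\<^sup>2) = complex_of_real (\<Sum>x\<in>F. (cmod (f x))\<^sup>2)"
      unfolding cinner_self of_real_sum complex_norm_square .
    have "cinner (T v) \<eta> = (\<Sum>x\<in>F. f x * cnj (f x))"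
      by (simp add: v_def blinfun.sum_right T cinner_sum_left cinner_cscale_left f_def)
    also have "\<dots> = complex_of_real ((norm v)\<^sup>2)"
      unfolding nv of_real_sum complex_norm_square ..
    finally have "(norm v)\<^sup>2 = cmod (cinner (T v) \<eta>)"
      by (simp del: of_real_power)
    also have "\<dots> \<le> norm T * norm v * norm \<eta>"
      by (rule order_trans[OF cinner_Cauchy_Schwarz]) (simp add: mult_right_mono norm_blinfun)
    finally have "norm v * norm v \<le> norm v * (norm T * norm \<eta>)"
      by (simp add: power2_eq_square mult_ac)
    then have "norm v \<le> norm T * norm \<eta>"
      by (cases "norm v = 0") (auto simp: mult_le_cancel_left)
    then have "(norm v)\<^sup>2 \<le> (norm T * norm \<eta>)\<^sup>2" by (intro power_mono) auto
    then show ?thesis using nv unfolding of_real_eq_iff by simp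
  qed
  then obtain \<zeta> where \<zeta>: "\<And>a. apply_ell2 \<zeta> a = f a"
    using bounded_sums_ell2[of f "norm T * norm \<eta>"] by (metis mult_nonneg_nonneg norm_ge_zero)
  have "cinner (T \<xi>) \<eta> = cinner \<xi> \<zeta>" for \<xi>
  proof (rule tendsto_unique[where F = "finite_subsets_at_top UNIV"])
    define G where "G S = (\<Sum>x\<in>S. cscale (apply_ell2 \<xi> x) (delta x))" for S
    have G: "(G \<longlongrightarrow> \<xi>) (finite_subsets_at_top UNIV)"
      unfolding G_def by (rule finite_sums_delta_tendsto)
    show "((\<lambda>S. cinner (T (G S)) \<eta>) \<longlongrightarrow> cinner (T \<xi>) \<eta>) (finite_subsets_at_top UNIV)"
      by (intro cinner_tendsto_left blinfun.tendsto tendsto_const G)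
    have "cinner (T (G S)) \<eta> = cinner (G S) \<zeta>" for S
      by (simp add: G_def blinfun.sum_right T cinner_sum_left cinner_cscale_left \<zeta> f_def)
    then show "((\<lambda>S. cinner (T (G S)) \<eta>) \<longlongrightarrow> cinner \<xi> \<zeta>) (finite_subsets_at_top UNIV)"
      using cinner_tendsto_left[OF G, of \<zeta>] by simp
  qed simp
  then show ?thesis by blast
qed

lemma cinner_ext: "(\<And>\<xi>. cinner \<xi> a = cinner \<xi> b) \<Longrightarrow> a = b"
  by (rule ell2_eqI) (metis cinner_delta_left complex_cnj_cnj)

text \<open>The definite description in \<open>adj\<close> is meaningful only if an adjoint for the
  complex inner product exists; complex linearity provides it through
  \<open>complex_linear_riesz\<close>.\<close>

lemma cinner_adj:
  assumes T: "complex_linear T"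
  shows "cinner (T \<xi>) \<eta> = cinner \<xi> (adj T \<eta>)"
proof -
  obtain S where S: "\<And>\<xi> \<eta>. cinner (T \<xi>) \<eta> = cinner \<xi> (S \<eta>)"
    using complex_linear_riesz[of T] T by (auto simp: complex_linear_def) metis
  have bl: "bounded_linear S"
  proof (rule bounded_linear_intro[where K = "norm T"])
    show "S (x + y) = S x + S y" for x y
      by (rule cinner_ext) (simp add: S[symmetric] cinner_add_right)
    show "S (r *\<^sub>R x) = r *\<^sub>R S x" for r x
    proof -
      have "r *\<^sub>R y = cscale (complex_of_real r) y" for y :: "'a ell2" by (rule ell2_eqI) simp
      then show ?thesis by (intro cinner_ext) (simp add: S[symmetric] cinner_cscale_right)
    qed
    show "norm (S x) \<le> norm x * norm T" for x
    proof -
      have "complex_of_real ((norm (S x))\<^sup>2) = cinner (T (S x)) x"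
        unfolding S by (simp add: cinner_self)
      then have "(norm (S x))\<^sup>2 = cmod (cinner (T (S x)) x)"
        by (metis norm_of_real abs_of_nonneg zero_le_power2)
      also have "\<dots> \<le> norm T * norm (S x) * norm x"
        by (rule order_trans[OF cinner_Cauchy_Schwarz]) (simp add: mult_right_mono norm_blinfun)
      finally have "norm (S x) * norm (S x) \<le> norm (S x) * (norm x * norm T)"
        by (simp add: power2_eq_square mult_ac)
      then show ?thesis
        by (cases "norm (S x) = 0") (auto simp: mult_le_cancel_left)
    qed
  qed
  have "adj T = Blinfun S"
    unfolding adj_def
  proof (rule the_equality)
    show "\<forall>\<xi> \<eta>. cinner (T \<xi>) \<eta> = cinner \<xi> (Blinfun S \<eta>)"
      by (simp add: bounded_linear_Blinfun_apply[OF bl] S)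
    show "R = Blinfun S" if "\<forall>\<xi> \<eta>. cinner (T \<xi>) \<eta> = cinner \<xi> (R \<eta>)" for R :: "'a ell2 \<Rightarrow>\<^sub>L 'a ell2"
      using that by (intro blinfun_eqI cinner_ext) (simp add: bounded_linear_Blinfun_apply[OF bl] S[symmetric])
  qed
  then show ?thesis by (simp add: bounded_linear_Blinfun_apply[OF bl] S)
qed

lemma cinner_adj': "complex_linear T \<Longrightarrow> cinner (adj T \<xi>) \<eta> = cinner \<xi> (T \<eta>)"
  by (metis cinner_adj cinner_commute)

lemma inner_adj: "complex_linear T \<Longrightarrow> inner (T \<xi>) \<eta> = inner \<xi> (adj T \<eta>)"
  by (simp add: inner_ell2_def cinner_adj)

lemma complex_linear_adj: "complex_linear T \<Longrightarrow> complex_linear (adj T)"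
  unfolding complex_linear_def[of "adj T"]
  by (intro allI cinner_ext) (simp add: cinner_adj[symmetric] cinner_cscale_right)

lemma scaleR_ell2: "r *\<^sub>R y = cscale (complex_of_real r) y"
  by (rule ell2_eqI) simp

section \<open>The bicommutant theorem\<close>

text \<open>The space over \<open>'a \<times> 'i\<close> serves as the Hilbert sum of copies of the
  space over \<open>'a\<close>; this is the inclusion of the copy with index
  \<open>i\<close>.\<close>

definition ell2_embed :: "'i \<Rightarrow> 'a ell2 \<Rightarrow> ('a \<times> 'i) ell2"
  where "ell2_embed i \<xi> = Abs_ell2 (\<lambda>p. if snd p = i then apply_ell2 \<xi> (fst p) else 0)"

definition ell2_comp :: "'i \<Rightarrow> ('a \<times> 'i) ell2 \<Rightarrow> 'a ell2"
  where "ell2_comp i \<Xi> = Abs_ell2 (\<lambda>a. apply_ell2 \<Xi> (a, i))"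

lemma apply_ell2_embed [simp]:
  "apply_ell2 (ell2_embed i \<xi>) p = (if snd p = i then apply_ell2 \<xi> (fst p) else 0)"
proof -
  have "(\<lambda>p. (cmod (if snd p = i then apply_ell2 \<xi> (fst p) else 0))\<^sup>2) summable_on range (\<lambda>a. (a, i))"
    using ell2_summable[of \<xi> UNIV] by (subst summable_on_reindex) (auto simp: inj_on_def o_def)
  then have "(\<lambda>p. (cmod (if snd p = i then apply_ell2 \<xi> (fst p) else 0))\<^sup>2) summable_on UNIV"
    by (rule summable_on_cong_neutral[THEN iffD1, rotated 3]) auto
  then show ?thesis by (simp add: ell2_embed_def Abs_ell2_inverse)
qed

lemma apply_ell2_comp [simp]: "apply_ell2 (ell2_comp i \<Xi>) a = apply_ell2 \<Xi> (a, i)"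
proof -
  have "(\<lambda>p. (cmod (apply_ell2 \<Xi> p))\<^sup>2) summable_on range (\<lambda>a. (a, i))"
    by (rule ell2_summable)
  then have "(\<lambda>a. (cmod (apply_ell2 \<Xi> (a, i)))\<^sup>2) summable_on UNIV"
    by (subst (asm) summable_on_reindex) (auto simp: inj_on_def o_def)
  then show ?thesis by (simp add: ell2_comp_def Abs_ell2_inverse)
qed

lemma cinner_ell2_embed: "cinner (ell2_embed i \<xi>) \<Xi> = cinner \<xi> (ell2_comp i \<Xi>)"
proof -
  have "cinner (ell2_embed i \<xi>) \<Xi> =
      (\<Sum>\<^sub>\<infinity>p\<in>range (\<lambda>a. (a, i)). apply_ell2 (ell2_embed i \<xi>) p * cnj (apply_ell2 \<Xi> p))"
    unfolding cinner.rep_eq by (rule infsum_cong_neutral) auto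
  also have "\<dots> = cinner \<xi> (ell2_comp i \<Xi>)"
    unfolding cinner.rep_eq by (subst infsum_reindex) (auto simp: inj_on_def o_def)
  finally show ?thesis .
qed

lemma ell2_comp_embed: "ell2_comp i (ell2_embed j \<xi>) = (if i = j then \<xi> else 0)"
  by (rule ell2_eqI) auto

lemma bounded_linear_ell2_embed: "bounded_linear (ell2_embed i)"
proof (rule bounded_linear_intro[where K = 1])
  show "norm (ell2_embed i \<xi>) \<le> norm \<xi> * 1" for \<xi>
    by (simp add: norm_ell2_def inner_ell2_def cinner_ell2_embed ell2_comp_embed)
qed (auto intro!: ell2_eqI)

lemma norm_ell2_comp_le: "norm (ell2_comp i \<Xi>) \<le> norm \<Xi>"
proof -
  have "(norm (ell2_comp i \<Xi>))\<^sup>2 = inner (ell2_embed i (ell2_comp i \<Xi>)) \<Xi>"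
    unfolding power2_norm_eq_inner by (simp add: inner_ell2_def cinner_ell2_embed)
  also have "\<dots> \<le> norm (ell2_embed i (ell2_comp i \<Xi>)) * norm \<Xi>"
    by (rule norm_cauchy_schwarz)
  also have "norm (ell2_embed i (ell2_comp i \<Xi>)) = norm (ell2_comp i \<Xi>)"
    by (simp add: norm_ell2_def inner_ell2_def cinner_ell2_embed ell2_comp_embed)
  finally show ?thesis
    by (cases "norm (ell2_comp i \<Xi>) = 0") (auto simp: power2_eq_square mult_le_cancel_left)
qed

lemma bounded_linear_ell2_comp: "bounded_linear (ell2_comp i)"
  by (rule bounded_linear_intro[where K = 1]) (auto intro!: ell2_eqI simp: norm_ell2_comp_le)

lemma ell2_embed_cscale: "ell2_embed i (cscale c \<xi>) = cscale c (ell2_embed i \<xi>)"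
  and ell2_comp_cscale: "ell2_comp i (cscale c \<Xi>) = cscale c (ell2_comp i \<Xi>)"
  by (auto intro!: ell2_eqI)

text \<open>Von Neumann's amplification: the finitely many test vectors index the direct summands.\<close>

lemma bicommutant_approximation:
  fixes P :: "('a ell2 \<Rightarrow>\<^sub>L 'a ell2) set"
  assumes P: "von_neumann_algebra P" and x: "complex_linear x"
    and comm: "\<And>t \<xi>. complex_linear t \<Longrightarrow> (\<And>T \<xi>. T \<in> P \<Longrightarrow> t (T \<xi>) = T (t \<xi>)) \<Longrightarrow> t (x \<xi>) = x (t \<xi>)"
    and I: "finite I" and e: "e > 0"
  shows "\<exists>T\<in>P. \<forall>\<xi>\<in>I. norm (T \<xi> - x \<xi>) < e"
proof -
  have lin: "complex_linear T" if "T \<in> P" for T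
    using P that by (simp add: von_neumann_algebra_def)
  \<comment> \<open>Indices and test vectors coincide: the copy with index \<open>i\<close> carries
    the value at the vector \<open>i\<close>.\<close>
  define gen where "gen T = (\<Sum>i\<in>I. ell2_embed i (T i))" for T :: "'a ell2 \<Rightarrow> 'a ell2"
  have comp_gen: "ell2_comp i (gen T) = T i" if "i \<in> I" for i T
    using I that unfolding gen_def
    by (intro ell2_eqI) (simp add: if_distrib cong: if_cong)
  define V0 where "V0 = (\<lambda>T. gen (blinfun_apply T)) ` P"
  define V where "V = closure V0"
  have add: "gen S + gen T = gen (\<lambda>\<xi>. S \<xi> + T \<xi>)" for S T
    unfolding gen_def by (simp add: sum.distrib[symmetric] bounded_linear_ell2_embed linear_simps)
  have scale: "cscale c (gen T) = gen (\<lambda>\<xi>. cscale c (T \<xi>))" for c T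
    by (auto intro!: ell2_eqI simp: gen_def sum_distrib_left intro!: sum.cong)
  have V0c: "cscale c v \<in> V0" if v: "v \<in> V0" for c v
  proof -
    obtain T where T: "T \<in> P" "v = gen T" using v by (auto simp: V0_def)
    then have "cscale_op c T \<in> P" using P by (simp add: von_neumann_algebra_def)
    then show ?thesis unfolding V0_def T(2) scale
      by (rule image_eqI[rotated]) (simp add: gen_def cscale_op.rep_eq)
  qed
  have gid0: "gen (\<lambda>\<xi>. \<xi>) \<in> V0"
  proof -
    have "id_blinfun \<in> P" using P by (simp add: von_neumann_algebra_def)
    then have "gen id_blinfun \<in> V0" unfolding V0_def by blast
    then show ?thesis by (simp add: gen_def)
  qed
  have V0: "subspace V0"
  proof (rule subspaceI)
    have 0: "0 = cscale 0 y" for y :: "('a \<times> 'a ell2) ell2" by (rule ell2_eqI) simp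
    show "0 \<in> V0" using V0c[OF gid0] 0 by metis
    show "v + w \<in> V0" if vw: "v \<in> V0" "w \<in> V0" for v w
    proof -
      obtain S T where ST: "S \<in> P" "v = gen S" "T \<in> P" "w = gen T" using vw by (auto simp: V0_def)
      then have "S + T \<in> P" using P by (simp add: von_neumann_algebra_def)
      then show ?thesis unfolding V0_def ST(2,4) add
        by (rule image_eqI[rotated]) (simp add: gen_def blinfun.add_left)
    qed
    show "r *\<^sub>R v \<in> V0" if "v \<in> V0" for r v
      using V0c[OF that] by (simp add: scaleR_ell2)
  qed
  then have V: "subspace V" "closed V" by (auto simp: V_def subspace_closure)
  have Vc: "cscale c ` V \<subseteq> V" for c
    unfolding V_def using V0c by (intro bounded_linear_closure_image bounded_linear_cscale) auto
  define E where "E = ortho_proj V"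
  have E_lin: "bounded_linear E" unfolding E_def by (rule ortho_proj_bounded_linear[OF V])
  have cs_diff: "cscale c (a - b) = cscale c a - cscale c b" for c and a b :: "'b ell2"
    by (auto intro!: ell2_eqI simp: right_diff_distrib)
  have E_c: "E (cscale c \<Xi>) = cscale c (E \<Xi>)" for c \<Xi>
    unfolding E_def using Vc
    by (intro ortho_proj_commute[OF V, where S' = "cscale (cnj c)"])
      (auto simp: cs_diff inner_ell2_def cinner_cscale_left cinner_cscale_right)
  define amp where "amp T \<Xi> = (\<Sum>i\<in>I. ell2_embed i (T (ell2_comp i \<Xi>)))"
    for T :: "'a ell2 \<Rightarrow>\<^sub>L 'a ell2" and \<Xi> :: "('a \<times> 'a ell2) ell2"
  have amp_lin: "bounded_linear (amp T)" for T
    unfolding amp_def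
    by (intro bounded_linear_sum bounded_linear_compose[OF bounded_linear_ell2_embed]
        bounded_linear_compose[OF blinfun.bounded_linear_right] bounded_linear_ell2_comp)
  have amp_gen: "amp S (gen T) = gen (\<lambda>\<xi>. S (T \<xi>))" for S T
    unfolding amp_def using comp_gen by (simp add: gen_def)
  have ampV: "amp S ` V \<subseteq> V" if S: "S \<in> P" for S
    unfolding V_def
  proof (intro bounded_linear_closure_image amp_lin)
    show "amp S ` V0 \<subseteq> V0"
    proof (clarsimp simp: V0_def amp_gen)
      fix T assume "T \<in> P"
      then have "S o\<^sub>L T \<in> P" using P S by (simp add: von_neumann_algebra_def)
      then show "gen (\<lambda>\<xi>. S (T \<xi>)) \<in> (\<lambda>T. gen (blinfun_apply T)) ` P"
        by (rule image_eqI[rotated]) (simp add: gen_def)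
    qed
  qed
  have E_amp: "E (amp T \<Xi>) = amp T (E \<Xi>)" if T: "T \<in> P" for T \<Xi>
    unfolding E_def
  proof (rule ortho_proj_commute[OF V, where S' = "amp (adj T)"])
    show "amp T ` V \<subseteq> V" using ampV[OF T] .
    show "amp (adj T) ` V \<subseteq> V" using ampV P T by (simp add: von_neumann_algebra_def)
    show "amp T (x - y) = amp T x - amp T y" for x y using amp_lin by (simp add: linear_simps)
    show "inner (amp T a) b = inner a (amp (adj T) b)" for a b
    proof -
      have "cinner (amp T a) b = (\<Sum>i\<in>I. cinner (T (ell2_comp i a)) (ell2_comp i b))"
        by (simp add: amp_def cinner_sum_left cinner_ell2_embed)
      also have "\<dots> = (\<Sum>i\<in>I. cnj (cinner (adj T (ell2_comp i b)) (ell2_comp i a)))"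
        using lin[OF T] by (simp add: cinner_adj cinner_commute[symmetric])
      also have "\<dots> = cnj (cinner (amp (adj T) b) a)"
        by (simp add: amp_def cinner_sum_left cinner_ell2_embed)
      finally show ?thesis by (simp add: inner_ell2_def cinner_commute[symmetric])
    qed
  qed
  have amp_embed: "amp T (ell2_embed j \<zeta>) = ell2_embed j (T \<zeta>)" if "j \<in> I" for T j \<zeta>
    using I that by (simp add: amp_def ell2_comp_embed if_distrib[of "blinfun_apply T"]
        if_distrib[of "ell2_embed _"] bounded_linear_ell2_embed linear_simps sum.delta cong: if_cong)
  have comp_amp: "ell2_comp i (amp T \<Xi>) = T (ell2_comp i \<Xi>)" if "i \<in> I" for T i \<Xi>
    using comp_gen[OF that, of "\<lambda>i. T (ell2_comp i \<Xi>)"] by (simp add: amp_def gen_def)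
  \<comment> \<open>The matrix entries of the projection commute with \<open>P\<close>, since
    \<open>E\<close> commutes with the diagonal action \<open>amp T\<close>; by \<open>comm\<close>
    they then commute with \<open>x\<close> as well.\<close>
  have q: "ell2_comp i (E (ell2_embed j (x \<zeta>))) = x (ell2_comp i (E (ell2_embed j \<zeta>)))"
    if ij: "i \<in> I" "j \<in> I" for i j \<zeta>
  proof -
    have bl: "bounded_linear (\<lambda>\<zeta>. ell2_comp i (E (ell2_embed j \<zeta>)))"
      by (intro bounded_linear_compose[OF bounded_linear_ell2_comp] bounded_linear_compose[OF E_lin]
          bounded_linear_ell2_embed)
    define t where "t = Blinfun (\<lambda>\<zeta>. ell2_comp i (E (ell2_embed j \<zeta>)))"
    have t: "t \<zeta> = ell2_comp i (E (ell2_embed j \<zeta>))" for \<zeta>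
      by (simp add: t_def bounded_linear_Blinfun_apply[OF bl])
    have "complex_linear t"
      by (simp add: complex_linear_def t ell2_embed_cscale E_c ell2_comp_cscale)
    moreover have "t (T \<zeta>) = T (t \<zeta>)" if "T \<in> P" for T \<zeta>
      using ij that by (simp add: t amp_embed[symmetric] E_amp comp_amp)
    ultimately have "t (x \<zeta>) = x (t \<zeta>)" by (rule comm)
    then show ?thesis by (simp add: t)
  qed
  have gid: "gen (\<lambda>\<xi>. \<xi>) \<in> V"
  proof -
    show ?thesis using gid0 closure_subset by (auto simp: V_def)
  qed
  have comp_sum: "ell2_comp i (E (gen f)) = (\<Sum>j\<in>I. ell2_comp i (E (ell2_embed j (f j))))" for i f
    by (simp add: gen_def linear_sum[OF bounded_linear.linear[OF E_lin]]
        linear_sum[OF bounded_linear.linear[OF bounded_linear_ell2_comp]])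
  \<comment> \<open>\<open>E\<close> fixes the vector of the identity. Moving \<open>x\<close> past
    the entries of \<open>E\<close> shows that \<open>E\<close> also reproduces the components of
    the vector of \<open>x\<close>, so these are approximated from \<open>V0\<close>.\<close>
  have comp_x: "ell2_comp i (E (gen x)) = x i" if i: "i \<in> I" for i
  proof -
    have "ell2_comp i (E (gen x)) = x (ell2_comp i (E (gen (\<lambda>\<xi>. \<xi>))))"
      using i q by (simp add: comp_sum blinfun.sum_right)
    also have "\<dots> = x i"
      using gid comp_gen[OF i] by (simp add: E_def ortho_proj_id[OF V])
    finally show ?thesis .
  qed
  have "E (gen x) \<in> closure V0"
    using ortho_proj_mem[OF V] by (simp add: E_def V_def)
  then obtain T where T: "T \<in> P" "dist (gen T) (E (gen x)) < e"
    using e unfolding closure_approachable V0_def by blast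
  have "norm (T \<xi> - x \<xi>) < e" if \<xi>: "\<xi> \<in> I" for \<xi>
  proof -
    have "T \<xi> - x \<xi> = ell2_comp \<xi> (gen T - E (gen x))"
      using comp_gen[OF \<xi>, of T] comp_x[OF \<xi>] linear_simps(2)[OF bounded_linear_ell2_comp] by metis
    then show ?thesis using norm_ell2_comp_le[of \<xi> "gen T - E (gen x)"] T(2)
      by (simp add: dist_norm)
  qed
  with T(1) show ?thesis by blast
qed

text \<open>A basic strong neighbourhood of \<open>x\<close> restricts the values at finitely many
  vectors only, and approximation on those places an element of \<open>P\<close> in it.\<close>

theorem bicommutant:
  fixes P :: "('a ell2 \<Rightarrow>\<^sub>L 'a ell2) set"
  assumes P: "von_neumann_algebra P" and x: "complex_linear x"
    and comm: "\<And>t \<xi>. complex_linear t \<Longrightarrow> (\<And>T \<xi>. T \<in> P \<Longrightarrow> t (T \<xi>) = T (t \<xi>)) \<Longrightarrow> t (x \<xi>) = x (t \<xi>)"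
  shows "x \<in> P"
proof (rule ccontr)
  assume "x \<notin> P"
  have "openin strong_operator_topology (- P)"
    using P by (simp add: von_neumann_algebra_def closedin_def strong_operator_topology_topspace Compl_eq_Diff_UNIV)
  then obtain U where U: "open U" "- P = blinfun_apply -` U"
    unfolding strong_operator_topology_def openin_pullback_topology by auto
  then have "blinfun_apply x \<in> U" using \<open>x \<notin> P\<close> by blast
  moreover have "openin (product_topology (\<lambda>i. euclidean) UNIV) U"
    using U(1) by (simp add: open_fun_def)
  ultimately obtain W where W: "finite {i. W i \<noteq> UNIV}" "\<And>i. open (W i)" "blinfun_apply x \<in> Pi\<^sub>E UNIV W"
    "Pi\<^sub>E UNIV W \<subseteq> U"
    unfolding openin_product_topology_alt by (metis (no_types, lifting) Collect_cong UNIV_I open_openin topspace_euclidean)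
  define I where "I = {i. W i \<noteq> UNIV}"
  have "\<exists>e>0. ball (x i) e \<subseteq> W i" for i
    using W(2,3) open_contains_ball by (metis PiE_mem UNIV_I)
  then obtain r where r: "\<And>i. r i > 0" "\<And>i. ball (x i) (r i) \<subseteq> W i" by metis
  \<comment> \<open>The extra element 1 keeps the minimum meaningful when \<open>I\<close> is
    empty.\<close>
  define e where "e = Min (insert 1 (r ` I))"
  have e: "e > 0" "\<And>i. i \<in> I \<Longrightarrow> e \<le> r i"
    using W(1) r(1) by (auto simp: e_def I_def)
  obtain T where T: "T \<in> P" "\<And>\<xi>. \<xi> \<in> I \<Longrightarrow> norm (T \<xi> - x \<xi>) < e"
    using bicommutant_approximation[OF P x comm, of I e] W(1) e(1) unfolding I_def by blast
  have "T i \<in> W i" for i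
  proof (cases "i \<in> I")
    case True
    then have "T i \<in> ball (x i) (r i)"
      using T(2)[of i] e(2)[of i] by (simp add: dist_norm norm_minus_commute)
    then show ?thesis using r(2) by blast
  qed (auto simp: I_def)
  then have "blinfun_apply T \<in> U" using W(4) by blast
  then show False using U(2) T(1) by blast
qed

section \<open>Convolution operators\<close>

lemma complex_linear_eqI:
  assumes S: "complex_linear S" and T: "complex_linear T" and eq: "\<And>g. S (delta g) = T (delta g)"
  shows "S \<xi> = T \<xi>"
proof (rule tendsto_unique[where F = "finite_subsets_at_top UNIV"])
  define G where "G S = (\<Sum>x\<in>S. cscale (apply_ell2 \<xi> x) (delta x))" for S
  have G: "(G \<longlongrightarrow> \<xi>) (finite_subsets_at_top UNIV)"
    unfolding G_def by (rule finite_sums_delta_tendsto)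
  show "((\<lambda>F. S (G F)) \<longlongrightarrow> S \<xi>) (finite_subsets_at_top UNIV)"
    by (intro blinfun.tendsto tendsto_const G)
  have "S (G F) = T (G F)" for F
    by (simp add: G_def blinfun.sum_right complex_linearD[OF S] complex_linearD[OF T] eq)
  then show "((\<lambda>F. S (G F)) \<longlongrightarrow> T \<xi>) (finite_subsets_at_top UNIV)"
    using blinfun.tendsto[OF tendsto_const G, of T] by simp
qed simp

lemma complex_linear_compose:
  "complex_linear S \<Longrightarrow> complex_linear T \<Longrightarrow> complex_linear (S o\<^sub>L T)"
  by (simp add: complex_linear_def)

text \<open>On coefficient vectors, this map and the next two are right multiplication by
  \<open>u_h\<close>, conjugation by \<open>u_g\<close> and the adjoint.\<close>

definition right_translate :: "('g, 'b) monoid_scheme \<Rightarrow> 'g \<Rightarrow> 'g ell2 \<Rightarrow> 'g ell2"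
  where "right_translate G h f = Abs_ell2 (\<lambda>y. apply_ell2 f (y \<otimes>\<^bsub>G\<^esub> inv\<^bsub>G\<^esub> h))"

definition conjugate :: "('g, 'b) monoid_scheme \<Rightarrow> 'g \<Rightarrow> 'g ell2 \<Rightarrow> 'g ell2"
  where "conjugate G g f = Abs_ell2 (\<lambda>y. apply_ell2 f (inv\<^bsub>G\<^esub> g \<otimes>\<^bsub>G\<^esub> y \<otimes>\<^bsub>G\<^esub> g))"

definition involution :: "('g, 'b) monoid_scheme \<Rightarrow> 'g ell2 \<Rightarrow> 'g ell2"
  where "involution G f = Abs_ell2 (\<lambda>y. cnj (apply_ell2 f (inv\<^bsub>G\<^esub> y)))"

text \<open>The intended description of \<open>L(H)\<close>: operators commuting with right
  translations whose vector at the identity vanishes off \<open>H\<close>. Unlike the hull that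
  defines \<open>group_vn\<close>, this is a condition on coefficients; the two agree for subgroups
  by \<open>group_vn_eq_convolvers\<close>.\<close>

definition convolvers :: "('g, 'b) monoid_scheme \<Rightarrow> 'g set \<Rightarrow> ('g ell2 \<Rightarrow>\<^sub>L 'g ell2) set"
  where "convolvers G H = {T. complex_linear T \<and>
    (\<forall>h y. apply_ell2 (T (delta h)) y = apply_ell2 (T (delta \<one>\<^bsub>G\<^esub>)) (y \<otimes>\<^bsub>G\<^esub> inv\<^bsub>G\<^esub> h)) \<and>
    (\<forall>y. y \<notin> H \<longrightarrow> apply_ell2 (T (delta \<one>\<^bsub>G\<^esub>)) y = 0)}"

locale full_group = group G for G :: "('g, 'b) monoid_scheme" (structure) +
  assumes carrier_UNIV [simp]: "carrier G = UNIV"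
begin

lemma cancel [simp]:
  "g \<otimes> (inv g \<otimes> x) = x" "inv g \<otimes> (g \<otimes> x) = x" "x \<otimes> inv g \<otimes> g = x" "x \<otimes> g \<otimes> inv g = x"
  by (simp_all add: m_assoc[symmetric]) (simp_all add: m_assoc)

lemma bij_right: "bij (\<lambda>y. y \<otimes> h)"
  by (rule o_bij[where g = "\<lambda>y. y \<otimes> inv h"]) (auto simp: fun_eq_iff m_assoc)

lemma bij_inv: "bij (\<lambda>y. inv y)"
  by (rule o_bij[where g = "\<lambda>y. inv y"]) (auto simp: fun_eq_iff)

lemma bij_conj: "bij (\<lambda>y. inv g \<otimes> y \<otimes> g)"
  by (rule o_bij[where g = "\<lambda>y. g \<otimes> y \<otimes> inv g"]) (auto simp: fun_eq_iff m_assoc inv_solve_left')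

lemma inv_eq_iff: "inv x = y \<longleftrightarrow> x = inv y"
  by (metis UNIV_I carrier_UNIV inv_inv)

lemma summable_bij:
  "bij \<phi> \<Longrightarrow> (\<lambda>y. (cmod (apply_ell2 f (\<phi> y)))\<^sup>2) summable_on UNIV"
  using summable_on_reindex_bij_betw[of \<phi> UNIV UNIV "\<lambda>y. (cmod (apply_ell2 f y))\<^sup>2"] ell2_summable by blast

lemma apply_right_translate [simp]:
  "apply_ell2 (right_translate G h f) y = apply_ell2 f (y \<otimes> inv h)"
  unfolding right_translate_def
  by (subst Abs_ell2_inverse) (use summable_bij[OF bij_right] in auto)

lemma apply_conjugate [simp]:
  "apply_ell2 (conjugate G g f) y = apply_ell2 f (inv g \<otimes> y \<otimes> g)"
  unfolding conjugate_def
  by (subst Abs_ell2_inverse) (use summable_bij[OF bij_conj] in auto)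

lemma apply_involution [simp]:
  "apply_ell2 (involution G f) y = cnj (apply_ell2 f (inv y))"
  unfolding involution_def
  by (subst Abs_ell2_inverse) (use summable_bij[OF bij_inv] in auto)

lemma norm_right_translate: "norm (right_translate G h f) = norm f"
proof -
  have "(norm (right_translate G h f))\<^sup>2 = (norm f)\<^sup>2"
    unfolding norm_ell2_sq apply_right_translate by (rule infsum_reindex_bij_betw[OF bij_right])
  then show ?thesis by simp
qed

lemma norm_involution: "norm (involution G f) = norm f"
proof -
  have "(norm (involution G f))\<^sup>2 = (norm f)\<^sup>2"
    unfolding norm_ell2_sq apply_involution complex_mod_cnj by (rule infsum_reindex_bij_betw[OF bij_inv])
  then show ?thesis by simp
qed

lemma cinner_conjugate: "cinner (conjugate G g a) b = cinner a (conjugate G (inv g) b)"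
proof -
  have "cinner (conjugate G g a) b =
      (\<Sum>\<^sub>\<infinity>y. (\<lambda>z. apply_ell2 a z * cnj (apply_ell2 b (g \<otimes> z \<otimes> inv g))) (inv g \<otimes> y \<otimes> g))"
    unfolding cinner.rep_eq by (intro infsum_cong) (simp add: m_assoc inv_solve_left')
  also have "\<dots> = cinner a (conjugate G (inv g) b)"
    unfolding cinner.rep_eq by (subst infsum_reindex_bij_betw[OF bij_conj]) simp
  finally show ?thesis .
qed

lemma cinner_involution: "cinner (involution G a) b = cinner (involution G b) a"
  unfolding cinner.rep_eq
  by (subst infsum_reindex_bij_betw[OF bij_inv, symmetric]) (simp add: mult.commute)

lemma conjugate_linear: "bounded_linear (conjugate G g)"
proof (rule bounded_linear_intro[where K = 1])
  show "norm (conjugate G g f) \<le> norm f * 1" for f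
  proof -
    have "(norm (conjugate G g f))\<^sup>2 = (norm f)\<^sup>2"
      unfolding norm_ell2_sq apply_conjugate by (rule infsum_reindex_bij_betw[OF bij_conj])
    then show ?thesis by simp
  qed
qed (auto intro!: ell2_eqI)

lemma involution_linear: "bounded_linear (involution G)"
  by (rule bounded_linear_intro[where K = 1]) (auto intro!: ell2_eqI simp: norm_involution)

lemma right_translate_linear: "bounded_linear (right_translate G h)"
  by (rule bounded_linear_intro[where K = 1]) (auto intro!: ell2_eqI simp: norm_right_translate)

lemma convolversD:
  assumes "T \<in> convolvers G H"
  shows "complex_linear T"
    and "T (delta h) = right_translate G h (T (delta \<one>))"
    and "y \<notin> H \<Longrightarrow> apply_ell2 (T (delta \<one>)) y = 0"
  using assms by (auto simp: convolvers_def intro!: ell2_eqI)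

lemma convolvers_mono: "H \<subseteq> H' \<Longrightarrow> convolvers G H \<subseteq> convolvers G H'"
  by (auto simp: convolvers_def)

lemma adj_convolver_delta:
  assumes T: "T \<in> convolvers G H"
  shows "adj T (delta y) = right_translate G y (involution G (T (delta \<one>)))"
proof (rule ell2_eqI)
  fix a
  have "apply_ell2 (adj T (delta y)) a = cinner (adj T (delta y)) (delta a)" by simp
  also have "\<dots> = cnj (apply_ell2 (T (delta a)) y)"
    using convolversD(1)[OF T] by (simp add: cinner_adj' del: cinner_delta_right)
  also have "\<dots> = apply_ell2 (right_translate G y (involution G (T (delta \<one>)))) a"
    by (subst convolversD(2)[OF T]) (simp add: inv_mult_group)
  finally show "apply_ell2 (adj T (delta y)) a =
      apply_ell2 (right_translate G y (involution G (T (delta \<one>)))) a" .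
qed

text \<open>As an inner product, the value depends continuously on the vector
  \<open>T (delta \<one>)\<close> alone, so limits can be taken without convergence of the
  operators.\<close>

lemma convolver_apply_cinner:
  assumes T: "T \<in> convolvers G H"
  shows "apply_ell2 (T \<eta>) y = cinner \<eta> (right_translate G y (involution G (T (delta \<one>))))"
  using cinner_adj[OF convolversD(1)[OF T], of \<eta> "delta y"] adj_convolver_delta[OF T] by simp

lemma convolver_apply:
  assumes T: "T \<in> convolvers G H"
  shows "apply_ell2 (T \<eta>) y = (\<Sum>\<^sub>\<infinity>a. apply_ell2 \<eta> a * apply_ell2 (T (delta \<one>)) (y \<otimes> inv a))"
  by (subst convolver_apply_cinner[OF T]) (simp add: cinner.rep_eq inv_mult_group del: cinner_delta_right)

lemma convolver_eqI:
  assumes S: "S \<in> convolvers G H" and T: "T \<in> convolvers G H'" and "S (delta \<one>) = T (delta \<one>)"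
  shows "S = T"
proof (rule blinfun_eqI, rule complex_linear_eqI[OF convolversD(1)[OF S] convolversD(1)[OF T]])
  show "S (delta h) = T (delta h)" for h
    by (subst convolversD(2)[OF S], subst convolversD(2)[OF T], simp add: assms(3))
qed

lemma closedin_strong_eq:
  assumes "continuous_map strong_operator_topology euclidean f"
    "continuous_map strong_operator_topology euclidean g"
  shows "closedin strong_operator_topology {T :: 'a ell2 \<Rightarrow>\<^sub>L 'a ell2. (f T :: 'c :: metric_space) = g T}"
proof -
  have "closedin strong_operator_topology {T \<in> topspace strong_operator_topology. f T = g T}"
    using assms by (intro closedin_continuous_maps_eq[where Y = euclidean]) auto
  then show ?thesis by (simp add: strong_operator_topology_topspace)
qed

lemma continuous_map_strong_apply:
  "continuous_map strong_operator_topology euclidean (\<lambda>T :: 'a ell2 \<Rightarrow>\<^sub>L 'a ell2. apply_ell2 (T \<xi>) y)"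
proof -
  have "continuous_on UNIV (\<lambda>f :: 'a ell2. apply_ell2 f y)"
    unfolding continuous_on_def by (auto intro!: apply_ell2_tendsto tendsto_ident_at)
  then have "continuous_map euclidean euclidean (\<lambda>f :: 'a ell2. apply_ell2 f y)" by simp
  from continuous_map_compose[OF strong_operator_topology_continuous_evaluation this]
  show ?thesis by (simp add: o_def)
qed

lemma closedin_convolvers: "closedin strong_operator_topology (convolvers G H)"
proof -
  have cs: "continuous_map strong_operator_topology euclidean (\<lambda>T :: 'g ell2 \<Rightarrow>\<^sub>L 'g ell2. cscale c (T \<xi>))" for c \<xi>
  proof -
    have "continuous_map euclidean euclidean (cscale c :: 'g ell2 \<Rightarrow> 'g ell2)"
      by (simp add: linear_continuous_on bounded_linear_cscale)
    from continuous_map_compose[OF strong_operator_topology_continuous_evaluation this]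
    show ?thesis by (simp add: o_def)
  qed
  define A where "A p = {T :: 'g ell2 \<Rightarrow>\<^sub>L 'g ell2. T (cscale (fst p) (snd p)) = cscale (fst p) (T (snd p))}" for p
  define B where "B p = {T :: 'g ell2 \<Rightarrow>\<^sub>L 'g ell2. apply_ell2 (T (delta (fst p))) (snd p) =
      apply_ell2 (T (delta \<one>)) (snd p \<otimes> inv (fst p))}" for p
  \<comment> \<open>An equation for every \<open>y\<close>, trivially true on \<open>H\<close>, so
    that each condition compares two continuous maps.\<close>
  define C where "C y = {T :: 'g ell2 \<Rightarrow>\<^sub>L 'g ell2. apply_ell2 (T (delta \<one>)) y = (if y \<in> H then apply_ell2 (T (delta \<one>)) y else 0)}" for y
  have "convolvers G H = (\<Inter>p. A p) \<inter> (\<Inter>p. B p) \<inter> (\<Inter>y. C y)"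
    by (auto simp: convolvers_def A_def B_def C_def complex_linear_def)
  moreover have "closedin strong_operator_topology (A p)" for p
    unfolding A_def by (intro closedin_strong_eq strong_operator_topology_continuous_evaluation cs)
  moreover have "closedin strong_operator_topology (B p)" for p
    unfolding B_def by (intro closedin_strong_eq continuous_map_strong_apply)
  moreover have "closedin strong_operator_topology (C y)" for y
    unfolding C_def by (intro closedin_strong_eq continuous_map_strong_apply)
      (cases "y \<in> H"; simp add: continuous_map_strong_apply)
  ultimately show ?thesis by (auto intro!: closedin_Int closedin_INT)
qed

lemma von_neumann_algebra_convolvers:
  assumes H: "subgroup H G"
  shows "von_neumann_algebra (convolvers G H)"
  unfolding von_neumann_algebra_def
proof (intro conjI ballI allI)
  show "complex_linear T" if "T \<in> convolvers G H" for T using convolversD(1)[OF that] .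
  show "id_blinfun \<in> convolvers G H"
    using subgroup.one_closed[OF H]
    by (auto simp: convolvers_def complex_linear_def inv_equality inv_solve_right')
  show "S + T \<in> convolvers G H" if "S \<in> convolvers G H" "T \<in> convolvers G H" for S T
  proof -
    have "cscale c (a + b) = cscale c a + cscale c b" for c and a b :: "'g ell2"
      by (auto intro!: ell2_eqI simp: distrib_left)
    then show ?thesis using that by (simp add: convolvers_def complex_linear_def blinfun.add_left)
  qed
  show "cscale_op c T \<in> convolvers G H" if "T \<in> convolvers G H" for c T
  proof -
    have "cscale c (cscale d a) = cscale d (cscale c a)" for d and a :: "'g ell2"
      by (auto intro!: ell2_eqI)
    then show ?thesis using that by (simp add: convolvers_def complex_linear_def cscale_op.rep_eq)
  qed
  show "S o\<^sub>L T \<in> convolvers G H" if S: "S \<in> convolvers G H" and T: "T \<in> convolvers G H" for S T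
  proof -
    have "apply_ell2 (S (T (delta h))) y = apply_ell2 (S (T (delta \<one>))) (y \<otimes> inv h)" for h y
    proof -
      have "apply_ell2 (S (T (delta h))) y =
          (\<Sum>\<^sub>\<infinity>a. (\<lambda>b. apply_ell2 (T (delta \<one>)) b * apply_ell2 (S (delta \<one>)) (y \<otimes> inv h \<otimes> inv b)) (a \<otimes> inv h))"
        unfolding convolversD(2)[OF T, of h]
        by (subst convolver_apply[OF S], intro infsum_cong) (simp add: m_assoc inv_mult_group)
      also have "\<dots> = apply_ell2 (S (T (delta \<one>))) (y \<otimes> inv h)"
        unfolding convolver_apply[OF S, of "T (delta \<one>)"] by (rule infsum_reindex_bij_betw[OF bij_right])
      finally show ?thesis .
    qed
    moreover have "apply_ell2 (S (T (delta \<one>))) y = 0" if "y \<notin> H" for y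
    proof (subst convolver_apply[OF S], rule infsum_0)
      fix a
      have "a \<notin> H \<or> y \<otimes> inv a \<notin> H"
        using that subgroup.m_closed[OF H, of "y \<otimes> inv a" a] by (auto simp: m_assoc)
      then show "apply_ell2 (T (delta \<one>)) a * apply_ell2 (S (delta \<one>)) (y \<otimes> inv a) = 0"
        using convolversD(3)[OF S] convolversD(3)[OF T] by auto
    qed
    ultimately show ?thesis
      using convolversD(1)[OF S] convolversD(1)[OF T]
      by (simp add: convolvers_def complex_linear_compose)
  qed
  show "adj T \<in> convolvers G H" if T: "T \<in> convolvers G H" for T
  proof -
    have "inv y \<notin> H" if "y \<notin> H" for y
      using that subgroup.m_inv_closed[OF H, of "inv y"] by auto
    then show ?thesis
      using convolversD(1,3)[OF T]
      by (simp add: convolvers_def complex_linear_adj adj_convolver_delta[OF T])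
  qed
qed (rule closedin_convolvers)

lemma left_reg_convolver: "g \<in> H \<Longrightarrow> left_reg G g \<in> convolvers G H"
proof -
  assume g: "g \<in> H"
  have "complex_linear (left_reg G g)"
    unfolding complex_linear_def
    by (auto intro!: ell2_eqI simp: apply_left_reg[OF is_group carrier_UNIV])
  moreover have "y = g \<otimes> h \<longleftrightarrow> y \<otimes> inv h = g" for h y
    by (auto simp: m_assoc)
  ultimately show ?thesis
    using g by (auto simp: convolvers_def left_reg_delta[OF is_group carrier_UNIV])
qed

section \<open>Membership via the Hilbert space closure\<close>

text \<open>For \<open>t\<close> in the commutant of \<open>P\<close> it is enough to compare
  \<open>t x\<close> and \<open>x t\<close> on point masses. When \<open>x (delta \<one>)\<close> is
  approximated by vectors \<open>T n (delta \<one>)\<close>, one side converges because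
  \<open>t\<close> is bounded, the other coefficientwise because it is a pairing with a translate of
  the adjoint vector. The norms of the \<open>T n\<close> may grow.\<close>

lemma mem_von_neumann_algebraI:
  assumes P: "von_neumann_algebra P" "P \<subseteq> convolvers G UNIV"
    and x: "x \<in> convolvers G UNIV" and cl: "blinfun_apply x (delta \<one>) \<in> closure ((\<lambda>T. blinfun_apply T (delta \<one>)) ` P)"
  shows "x \<in> P"
proof (rule bicommutant[OF P(1) convolversD(1)[OF x]])
  fix t :: "'g ell2 \<Rightarrow>\<^sub>L 'g ell2" and \<xi>
  assume t: "complex_linear t" and comm: "\<And>T \<xi>. T \<in> P \<Longrightarrow> t (T \<xi>) = T (t \<xi>)"
  obtain f where f: "\<And>n. f n \<in> (\<lambda>T. blinfun_apply T (delta \<one>)) ` P" "f \<longlonglongrightarrow> x (delta \<one>)"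
    using cl unfolding closure_sequential by blast
  have "\<forall>n. \<exists>T. T \<in> P \<and> f n = T (delta \<one>)" using f(1) by blast
  then obtain T where T: "\<And>n. T n \<in> P" "\<And>n. f n = T n (delta \<one>)" by metis
  have Tc: "T n \<in> convolvers G UNIV" for n using T(1) P(2) by blast
  have lim: "(\<lambda>n. T n (delta \<one>)) \<longlonglongrightarrow> x (delta \<one>)" using f(2) by (simp add: T(2)[symmetric])
  have eq: "t (x (delta g)) = x (t (delta g))" for g
  proof (rule ell2_eqI)
    fix y
    have "(\<lambda>n. apply_ell2 (t (T n (delta g))) y) \<longlonglongrightarrow> apply_ell2 (t (x (delta g))) y"
      unfolding convolversD(2)[OF x, of g] convolversD(2)[OF Tc, of _ g]
      by (intro apply_ell2_tendsto blinfun.tendsto tendsto_const bounded_linear.tendsto[OF right_translate_linear] lim)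
    moreover have "(\<lambda>n. apply_ell2 (T n (t (delta g))) y) \<longlonglongrightarrow> apply_ell2 (x (t (delta g))) y"
      unfolding convolver_apply_cinner[OF x] convolver_apply_cinner[OF Tc]
      by (intro cinner_tendsto_right bounded_linear.tendsto[OF right_translate_linear]
          bounded_linear.tendsto[OF involution_linear] lim)
    ultimately show "apply_ell2 (t (x (delta g))) y = apply_ell2 (x (t (delta g))) y"
      using comm[OF T(1)] LIMSEQ_unique by force
  qed
  have "(t o\<^sub>L x) \<xi> = (x o\<^sub>L t) \<xi>"
    by (rule complex_linear_eqI) (simp_all add: eq complex_linear_compose t convolversD(1)[OF x])
  then show "t (x \<xi>) = x (t \<xi>)" by simp
qed

lemma ell2_support_closure:
  assumes V: "subspace V" "closed V" "\<And>c f. f \<in> V \<Longrightarrow> cscale c f \<in> V"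
    and d: "\<And>h. h \<in> H \<Longrightarrow> delta h \<in> V" and f: "\<And>y. y \<notin> H \<Longrightarrow> apply_ell2 f y = 0"
  shows "f \<in> V"
proof -
  have "(\<Sum>x\<in>S. cscale (apply_ell2 f x) (delta x)) \<in> V" for S
  proof (rule subspace_sum[OF V(1)])
    have "cscale 0 v = 0" for v :: "'a ell2" by (rule ell2_eqI) simp
    then show "cscale (apply_ell2 f x) (delta x) \<in> V" for x
      using V(3) d f[of x] subspace_0[OF V(1)] by (cases "x \<in> H") auto
  qed
  then show ?thesis
    by (intro Lim_in_closed_set[OF V(2) _ _ finite_sums_delta_tendsto]) auto
qed

lemma closure_delta_one_space:
  assumes P: "von_neumann_algebra P"
  defines "V \<equiv> closure ((\<lambda>T. blinfun_apply T (delta \<one>)) ` P)"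
  shows "subspace V" "closed V" "f \<in> V \<Longrightarrow> cscale c f \<in> V"
proof -
  define V0 where "V0 = (\<lambda>T. blinfun_apply T (delta \<one>)) ` P"
  have V0c: "cscale c f \<in> V0" if f: "f \<in> V0" for f c
  proof -
    obtain T where T: "T \<in> P" "f = T (delta \<one>)" using f by (auto simp: V0_def)
    then have "cscale_op c T \<in> P" using P by (simp add: von_neumann_algebra_def)
    then show ?thesis unfolding V0_def T(2) by (rule image_eqI[rotated]) (simp add: cscale_op.rep_eq)
  qed
  have "subspace V0"
  proof (rule subspaceI)
    have "id_blinfun \<in> P" using P by (simp add: von_neumann_algebra_def)
    then have "delta \<one> \<in> V0" unfolding V0_def by (rule image_eqI[rotated]) simp
    moreover have "cscale 0 (delta \<one>) = 0" by (rule ell2_eqI) simp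
    ultimately show "0 \<in> V0" using V0c by metis
    show "a + b \<in> V0" if ab: "a \<in> V0" "b \<in> V0" for a b
    proof -
      obtain S T where ST: "S \<in> P" "a = S (delta \<one>)" "T \<in> P" "b = T (delta \<one>)" using ab by (auto simp: V0_def)
      then have "S + T \<in> P" using P by (simp add: von_neumann_algebra_def)
      then show ?thesis unfolding V0_def ST(2,4) by (rule image_eqI[rotated]) (simp add: blinfun.add_left)
    qed
    show "r *\<^sub>R v \<in> V0" if "v \<in> V0" for r v using V0c[OF that] by (simp add: scaleR_ell2)
  qed
  then show "subspace V" "closed V" by (auto simp: V_def V0_def subspace_closure)
  have "cscale c ` V \<subseteq> V"
    unfolding V_def V0_def[symmetric] using V0c
    by (intro bounded_linear_closure_image bounded_linear_cscale) auto
  then show "f \<in> V \<Longrightarrow> cscale c f \<in> V" by blast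
qed

theorem group_vn_eq_convolvers:
  assumes H: "subgroup H G"
  shows "group_vn G H = convolvers G H"
proof
  have vn: "von_neumann_algebra (convolvers G H)" by (rule von_neumann_algebra_convolvers[OF H])
  have lr: "left_reg G ` H \<subseteq> convolvers G H" using left_reg_convolver by blast
  show "group_vn G H \<subseteq> convolvers G H"
    unfolding group_vn_def using hull_minimal[where S = von_neumann_algebra, OF lr] vn by blast
  show "convolvers G H \<subseteq> group_vn G H"
    unfolding group_vn_def hull_def
  proof (rule Inter_greatest, clarify)
    fix P x assume P: "von_neumann_algebra P" "left_reg G ` H \<subseteq> P" and x: "x \<in> convolvers G H"
    \<comment> \<open>An algebra containing the unitaries may also contain operators outside
      \<open>L(G)\<close>; the membership criterion is applied to its part inside.\<close>
    define Q where "Q = P \<inter> convolvers G UNIV"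
    have "von_neumann_algebra (convolvers G UNIV)"
      using von_neumann_algebra_convolvers[OF subgroup_self] by simp
    then have Q: "von_neumann_algebra Q"
      using P(1) by (auto simp: Q_def von_neumann_algebra_def)
    have "x \<in> Q"
    proof (rule mem_von_neumann_algebraI[OF Q])
      show "Q \<subseteq> convolvers G UNIV" by (simp add: Q_def)
      show "x \<in> convolvers G UNIV" using x convolvers_mono[of H UNIV] by blast
      show "blinfun_apply x (delta \<one>) \<in> closure ((\<lambda>T. blinfun_apply T (delta \<one>)) ` Q)"
      proof (rule ell2_support_closure[of _ H])
        show "delta h \<in> closure ((\<lambda>T. blinfun_apply T (delta \<one>)) ` Q)" if h: "h \<in> H" for h
        proof -
          have "left_reg G h \<in> Q"
            using h P(2) left_reg_convolver[of h UNIV] by (auto simp: Q_def)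
          then have "left_reg G h (delta \<one>) \<in> (\<lambda>T. blinfun_apply T (delta \<one>)) ` Q" by blast
          then have "delta h \<in> (\<lambda>T. blinfun_apply T (delta \<one>)) ` Q"
            by (simp add: left_reg_delta[OF is_group carrier_UNIV])
          then show ?thesis by (rule subsetD[OF closure_subset])
        qed
        show "apply_ell2 (x (delta \<one>)) y = 0" if "y \<notin> H" for y using convolversD(3)[OF x that] .
      qed (use closure_delta_one_space[OF Q] in auto)
    qed
    then show "x \<in> P" by (simp add: Q_def)
  qed
qed

text \<open>The trace reads off Fourier coefficients, which turns the defining condition of
  \<open>symmetric_part\<close> into one on coefficient vectors.\<close>

lemma trace_compose_left_reg:
  assumes T: "T \<in> convolvers G H"
  shows "trace G (T o\<^sub>L left_reg G g) = apply_ell2 (T (delta \<one>)) (inv g)"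
  by (simp add: trace_def left_reg_delta[OF is_group carrier_UNIV] convolversD(2)[OF T, of g])

lemma conj_convolver:
  assumes T: "T \<in> convolvers G UNIV"
  shows "left_reg G g o\<^sub>L T o\<^sub>L adj (left_reg G g) \<in> convolvers G UNIV"
    and "(left_reg G g o\<^sub>L T o\<^sub>L adj (left_reg G g)) (delta \<one>) = conjugate G g (T (delta \<one>))"
proof -
  have *: "left_reg G k \<in> convolvers G UNIV" for k by (rule left_reg_convolver) simp
  have "S o\<^sub>L R \<in> convolvers G UNIV" if "S \<in> convolvers G UNIV" "R \<in> convolvers G UNIV" for S R
    using von_neumann_algebra_convolvers[OF subgroup_self] that by (simp add: von_neumann_algebra_def)
  then show "left_reg G g o\<^sub>L T o\<^sub>L adj (left_reg G g) \<in> convolvers G UNIV"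
    unfolding adj_left_reg[OF is_group carrier_UNIV] using T * by blast
  show "(left_reg G g o\<^sub>L T o\<^sub>L adj (left_reg G g)) (delta \<one>) = conjugate G g (T (delta \<one>))"
    unfolding adj_left_reg[OF is_group carrier_UNIV]
    by (rule ell2_eqI)
      (simp add: left_reg_delta[OF is_group carrier_UNIV] apply_left_reg[OF is_group carrier_UNIV]
        convolversD(2)[OF T, of "inv g"])
qed

lemma conj_invariantI:
  assumes P: "P = {T \<in> convolvers G UNIV. T (delta \<one>) \<in> W}"
    and W: "\<And>g f. f \<in> W \<Longrightarrow> conjugate G g f \<in> W"
  shows "conj_invariant G P"
proof -
  let ?c = "\<lambda>g T. left_reg G g o\<^sub>L T o\<^sub>L adj (left_reg G g)"
  have sub: "?c g T \<in> P" if "T \<in> P" for g T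
    using that conj_convolver[of T g] W unfolding P by simp
  have "T \<in> ?c g ` P" if T: "T \<in> P" for g T
  proof (rule image_eqI[OF _ sub[OF T, of "inv g"]])
    have Tc: "T \<in> convolvers G UNIV" using T P by blast
    have c: "?c (inv g) T \<in> convolvers G UNIV" by (rule conj_convolver(1)[OF Tc])
    show "T = ?c g (?c (inv g) T)"
      by (rule convolver_eqI[OF Tc conj_convolver(1)[OF c]])
        (unfold conj_convolver(2)[OF c] conj_convolver(2)[OF Tc], rule ell2_eqI, simp add: m_assoc inv_solve_left')
  qed
  then show ?thesis unfolding conj_invariant_def using sub by blast
qed

end

section \<open>The Hilbert space of an invariant subalgebra\<close>

text \<open>The algebra itself no longer occurs. What survives of it is the module property
  \<open>E(f u_h) = f E(u_h)\<close> of the projection, extended to all vectors \<open>f\<close> of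
  \<open>K\<close>; this is the last assumption, written as a convolution.\<close>

locale invariant_space = full_group G for G :: "('g, 'b) monoid_scheme" (structure) +
  fixes K :: "'g ell2 set"
  assumes subspace_K: "subspace K" and closed_K: "closed K"
    and cscale_K: "\<And>c f. f \<in> K \<Longrightarrow> cscale c f \<in> K"
    and delta_one_K: "delta \<one> \<in> K"
    and involution_K: "\<And>f. f \<in> K \<Longrightarrow> involution G f \<in> K"
    and conjugate_K: "\<And>g f. f \<in> K \<Longrightarrow> conjugate G g f \<in> K"
    and proj_right_translate: "\<And>f h y. f \<in> K \<Longrightarrow>
      apply_ell2 (ortho_proj K (right_translate G h f)) y =
      (\<Sum>\<^sub>\<infinity>a. apply_ell2 f (y \<otimes> inv a) * apply_ell2 (ortho_proj K (delta h)) a)"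

text \<open>Elements of \<open>P\<close> and their adjoints preserve the closure, so the projection
  commutes with them. For \<open>f = T (delta \<one>)\<close> the right translate by
  \<open>h\<close> is \<open>T (delta h)\<close>, which gives the module property, and both sides of
  it are continuous in \<open>f\<close>.\<close>

lemma (in full_group) invariant_space_closure:
  assumes P: "von_neumann_algebra P" "P \<subseteq> convolvers G UNIV" "conj_invariant G P"
  shows "invariant_space G (closure ((\<lambda>T. blinfun_apply T (delta \<one>)) ` P))"
proof -
  define V0 where "V0 = (\<lambda>T. blinfun_apply T (delta \<one>)) ` P"
  define V where "V = closure V0"
  note V = closure_delta_one_space[OF P(1), folded V0_def, folded V_def]
  have V0V: "V0 \<subseteq> V" unfolding V_def by (rule closure_subset)
  have "invariant_space G V"
  proof unfold_locales
    show "subspace V" "closed V" by (fact V)+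
    show "cscale c f \<in> V" if "f \<in> V" for c f using V(3) that .
    have "id_blinfun \<in> P" using P(1) by (simp add: von_neumann_algebra_def)
    then have "delta \<one> \<in> V0" unfolding V0_def by (rule image_eqI[rotated]) simp
    then show "delta \<one> \<in> V" using V0V by blast
    have "involution G f \<in> V0" if f: "f \<in> V0" for f
    proof -
      obtain T where T: "T \<in> P" "f = T (delta \<one>)" using f by (auto simp: V0_def)
      have Tc: "T \<in> convolvers G UNIV" using T P by blast
      have "adj T (delta \<one>) \<in> V0" using T P(1) by (auto simp: V0_def von_neumann_algebra_def)
      moreover have "adj T (delta \<one>) = involution G f"
        unfolding adj_convolver_delta[OF Tc] T(2) by (rule ell2_eqI) simp
      ultimately show ?thesis by simp
    qed
    then have "involution G ` V \<subseteq> V"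
      unfolding V_def by (intro bounded_linear_closure_image involution_linear) auto
    then show "involution G f \<in> V" if "f \<in> V" for f using that by blast
    have "conjugate G g f \<in> V0" if f: "f \<in> V0" for f g
    proof -
      obtain T where T: "T \<in> P" "f = T (delta \<one>)" using f by (auto simp: V0_def)
      have Tc: "T \<in> convolvers G UNIV" using T P by blast
      have "left_reg G g o\<^sub>L T o\<^sub>L adj (left_reg G g) \<in> P"
        using P(3) T(1) unfolding conj_invariant_def by auto
      then show ?thesis
        unfolding V0_def T(2) conj_convolver(2)[OF Tc, symmetric] by (rule imageI)
    qed
    then have "conjugate G g ` V \<subseteq> V" for g
      unfolding V_def by (intro bounded_linear_closure_image conjugate_linear) auto
    then show "conjugate G g f \<in> V" if "f \<in> V" for f g using that by blast
    fix f h y assume f: "f \<in> V"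
    define E where "E = ortho_proj V"
    have E_lin: "bounded_linear E" unfolding E_def by (rule ortho_proj_bounded_linear[OF V(1,2)])
    have mult: "T ` V \<subseteq> V" if T: "T \<in> P" for T
      unfolding V_def
    proof (intro bounded_linear_closure_image blinfun.bounded_linear_right, clarsimp simp: V0_def)
      fix S assume "S \<in> P"
      then have "T o\<^sub>L S \<in> P" using P(1) T by (simp add: von_neumann_algebra_def)
      then show "T (S (delta \<one>)) \<in> (\<lambda>T. blinfun_apply T (delta \<one>)) ` P" by (rule image_eqI[rotated]) simp
    qed
    have E_T: "E (T \<xi>) = T (E \<xi>)" if T: "T \<in> P" for T \<xi>
      unfolding E_def
    proof (rule ortho_proj_commute[OF V(1,2), where S' = "adj T"])
      have Tc: "T \<in> convolvers G UNIV" using T P by blast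
      show "inner (T a) b = inner a (adj T b)" for a b by (rule inner_adj[OF convolversD(1)[OF Tc]])
      show "adj T ` V \<subseteq> V" using mult P(1) T by (simp add: von_neumann_algebra_def)
    qed (use mult[OF T] in \<open>auto simp: blinfun.diff_right\<close>)
    obtain k where k: "\<And>n. k n \<in> V0" "k \<longlonglongrightarrow> f"
      using f unfolding V_def closure_sequential by blast
    have "apply_ell2 (E (right_translate G h (k n))) y
        = cinner (E (delta h)) (right_translate G y (involution G (k n)))" for n
    proof -
      obtain T where T: "T \<in> P" "k n = T (delta \<one>)" using k(1)[of n] by (auto simp: V0_def)
      have Tc: "T \<in> convolvers G UNIV" using T P by blast
      have "right_translate G h (k n) = T (delta h)"
        unfolding T(2) convolversD(2)[OF Tc, of h] ..
      then show ?thesis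
        by (simp add: E_T[OF T(1)] convolver_apply_cinner[OF Tc] T(2))
    qed
    moreover have "(\<lambda>n. apply_ell2 (E (right_translate G h (k n))) y) \<longlonglongrightarrow> apply_ell2 (E (right_translate G h f)) y"
      by (intro apply_ell2_tendsto bounded_linear.tendsto[OF E_lin] bounded_linear.tendsto[OF right_translate_linear] k)
    moreover have "(\<lambda>n. cinner (E (delta h)) (right_translate G y (involution G (k n)))) \<longlonglongrightarrow>
        cinner (E (delta h)) (right_translate G y (involution G f))"
      by (intro cinner_tendsto_right bounded_linear.tendsto[OF right_translate_linear]
          bounded_linear.tendsto[OF involution_linear] k)
    ultimately have "apply_ell2 (E (right_translate G h f)) y =
        cinner (E (delta h)) (right_translate G y (involution G f))"
      by (simp add: LIMSEQ_unique)
    then show "apply_ell2 (ortho_proj V (right_translate G h f)) y =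
        (\<Sum>\<^sub>\<infinity>a. apply_ell2 f (y \<otimes> inv a) * apply_ell2 (ortho_proj V (delta h)) a)"
      by (simp add: cinner.rep_eq E_def inv_mult_group mult.commute)
  qed
  then show ?thesis by (simp add: V_def V0_def)
qed

context invariant_space
begin

definition proj :: "'g ell2 \<Rightarrow> 'g ell2" where "proj = ortho_proj K"

text \<open>The matrix of \<open>proj\<close> on point masses, or the Fourier coefficients of the
  conditional expectation of \<open>u_g\<close>. It is a Gram matrix by \<open>coeff_cinner\<close>,
  hence hermitian, so support statements pass between rows and columns.\<close>

definition coeff :: "'g \<Rightarrow> 'g \<Rightarrow> complex" where "coeff g x = apply_ell2 (proj (delta g)) x"

lemma proj_mem: "proj f \<in> K"
  unfolding proj_def by (rule ortho_proj_mem[OF subspace_K closed_K])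

lemma proj_id: "f \<in> K \<Longrightarrow> proj f = f"
  unfolding proj_def by (rule ortho_proj_id[OF subspace_K closed_K])

lemma proj_linear: "bounded_linear proj"
  unfolding proj_def by (rule ortho_proj_bounded_linear[OF subspace_K closed_K])

lemma cinner_proj_orthogonal:
  assumes "z \<in> K" shows "cinner (f - proj f) z = 0"
  unfolding proj_def using ortho_proj_orthogonal[OF subspace_K closed_K] cscale_K[OF assms] assms
  by (intro inner_zero_imp_cinner_zero) auto

lemma cinner_proj: "cinner (proj f) g = cinner f (proj g)"
proof -
  have "cinner f (proj g) = cinner (proj f) (proj g)"
    using cinner_proj_orthogonal[OF proj_mem, of f g] by (simp add: cinner_diff_left)
  moreover have "cinner (g - proj g) (proj f) = 0" by (rule cinner_proj_orthogonal[OF proj_mem])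
  then have "cinner (proj f) g = cinner (proj f) (proj g)"
    by (metis cinner_commute cinner_diff_left eq_iff_diff_eq_0)
  ultimately show ?thesis by simp
qed

lemma apply_proj: "apply_ell2 (proj f) g = cinner f (proj (delta g))"
  by (simp add: cinner_proj[symmetric])

lemma apply_mem: "f \<in> K \<Longrightarrow> apply_ell2 f g = cinner f (proj (delta g))"
  by (metis apply_proj proj_id)

lemma memI: "(\<And>g. apply_ell2 f g = cinner f (proj (delta g))) \<Longrightarrow> f \<in> K"
  using proj_mem[of f] ell2_eqI[of "proj f" f] by (simp add: apply_proj)

lemma coeff_cinner: "coeff g x = cinner (proj (delta g)) (proj (delta x))"
  unfolding coeff_def by (rule apply_mem[OF proj_mem])

lemma coeff_commute: "coeff g x = cnj (coeff x g)"
  unfolding coeff_cinner by (rule cinner_commute)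

lemma coeff_self: "coeff g g = complex_of_real ((norm (proj (delta g)))\<^sup>2)"
  unfolding coeff_cinner by (rule cinner_self)

lemma coeff_self_0D: "coeff g g = 0 \<Longrightarrow> proj (delta g) = 0"
  by (simp add: coeff_self)

lemma proj_commute:
  assumes "bounded_linear S" and "\<And>f. f \<in> K \<Longrightarrow> S f \<in> K" and "\<And>f. f \<in> K \<Longrightarrow> S' f \<in> K"
    and "\<And>a b. inner (S a) b = inner a (S' b)"
  shows "proj (S f) = S (proj f)"
  unfolding proj_def
  using assms(2,3,4) linear_simps(2)[OF assms(1)]
  by (intro ortho_proj_commute[OF subspace_K closed_K, where S' = S']) auto

lemma proj_conjugate: "proj (conjugate G g f) = conjugate G g (proj f)"
  by (rule proj_commute[where S' = "conjugate G (inv g)"])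
    (auto simp: conjugate_linear conjugate_K inner_ell2_def cinner_conjugate)

lemma proj_involution: "proj (involution G f) = involution G (proj f)"
proof (rule proj_commute[where S' = "involution G"])
  show "inner (involution G a) b = inner a (involution G b)" for a b
    by (metis inner_ell2_def cinner_involution inner_commute)
qed (auto simp: involution_linear involution_K)

lemma conjugate_delta: "conjugate G g (delta h) = delta (g \<otimes> h \<otimes> inv g)"
proof (rule ell2_eqI)
  fix x
  have "inv g \<otimes> x \<otimes> g = h \<longleftrightarrow> x = g \<otimes> h \<otimes> inv g"
    by (metis UNIV_I carrier_UNIV cancel m_assoc)
  then show "apply_ell2 (conjugate G g (delta h)) x = apply_ell2 (delta (g \<otimes> h \<otimes> inv g)) x" by simp
qed

lemma coeff_conj: "coeff (g \<otimes> h \<otimes> inv g) y = coeff h (inv g \<otimes> y \<otimes> g)"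
  by (simp add: coeff_def conjugate_delta[symmetric] proj_conjugate)

lemma coeff_conj': "coeff (g \<otimes> h \<otimes> inv g) (g \<otimes> y \<otimes> inv g) = coeff h y"
  unfolding coeff_conj by (simp add: m_assoc)

lemma involution_delta: "involution G (delta h) = delta (inv h)"
  by (rule ell2_eqI) (auto simp: inv_eq_iff)

lemma coeff_inv: "coeff (inv g) (inv x) = cnj (coeff g x)"
  by (simp add: coeff_def involution_delta[symmetric] proj_involution)

lemma coeff_one: "coeff \<one> x = (if x = \<one> then 1 else 0)"
  by (simp add: coeff_def proj_id[OF delta_one_K])

lemma right_convolution_proj:
  "f \<in> K \<Longrightarrow> apply_ell2 (proj (right_translate G h f)) y = (\<Sum>\<^sub>\<infinity>a. apply_ell2 f (y \<otimes> inv a) * coeff h a)"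
  by (simp add: proj_right_translate proj_def coeff_def)

text \<open>The translated vector is \<open>u_g f = (g f g^-1) u_g\<close>; taking adjoints turns
  this left multiplication into the right multiplication of
  \<open>right_convolution_proj\<close>.\<close>

lemma left_convolution_proj:
  assumes f: "f \<in> K"
  shows "apply_ell2 (proj (right_translate G g (conjugate G g f))) y =
    (\<Sum>\<^sub>\<infinity>a. coeff g (y \<otimes> inv a) * apply_ell2 f a)"
proof -
  have eq: "right_translate G g (conjugate G g f) = involution G (right_translate G (inv g) (involution G f))"
    by (rule ell2_eqI) (simp add: inv_mult_group m_assoc)
  have "apply_ell2 (proj (right_translate G g (conjugate G g f))) y =
      cnj (apply_ell2 (proj (right_translate G (inv g) (involution G f))) (inv y))"
    unfolding eq by (simp add: proj_involution)
  also have "\<dots> = (\<Sum>\<^sub>\<infinity>a. cnj (apply_ell2 (involution G f) (inv y \<otimes> inv a) * coeff (inv g) a))"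
    unfolding right_convolution_proj[OF involution_K[OF f]] by (rule infsum_cnj[symmetric])
  also have "\<dots> = (\<Sum>\<^sub>\<infinity>a. (\<lambda>b. coeff g (y \<otimes> inv b) * apply_ell2 f b) (a \<otimes> y))"
  proof (rule infsum_cong)
    fix a
    have "coeff (inv g) a = cnj (coeff g (inv a))" using coeff_inv[of g "inv a"] by simp
    then show "cnj (apply_ell2 (involution G f) (inv y \<otimes> inv a) * coeff (inv g) a) =
        coeff g (y \<otimes> inv (a \<otimes> y)) * apply_ell2 f (a \<otimes> y)"
      by (simp add: inv_mult_group mult.commute)
  qed
  also have "\<dots> = (\<Sum>\<^sub>\<infinity>a. coeff g (y \<otimes> inv a) * apply_ell2 f a)"
    by (rule infsum_reindex_bij_betw[OF bij_right])
  finally show ?thesis .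
qed

lemma left_convolution_mem:
  assumes "f \<in> K"
  obtains f' where "f' \<in> K" "\<And>y. apply_ell2 f' y = (\<Sum>\<^sub>\<infinity>a. coeff g (y \<otimes> inv a) * apply_ell2 f a)"
  using left_convolution_proj[OF assms] proj_mem by metis

text \<open>In terms of the conditional expectation: \<open>E(u\<^sub>g) f = (u\<^sub>g f u\<^sub>g\<^sup>*) E(u\<^sub>g)\<close>.\<close>

lemma coeff_central:
  assumes f: "f \<in> K"
  shows "(\<Sum>\<^sub>\<infinity>a. coeff g (y \<otimes> inv a) * apply_ell2 f a) =
    (\<Sum>\<^sub>\<infinity>a. apply_ell2 f (inv g \<otimes> (y \<otimes> inv a) \<otimes> g) * coeff g a)"
  unfolding left_convolution_proj[OF f, symmetric] right_convolution_proj[OF conjugate_K[OF f]] by simp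

end

section \<open>Integer matrices of determinant one\<close>

abbreviation act :: "'n::finite sl \<Rightarrow> int^'n \<Rightarrow> int^'n" where "act A v \<equiv> sl_mat A *v v"

definition dot :: "int^'n \<Rightarrow> int^'n::finite \<Rightarrow> int" where "dot a b = (\<Sum>i\<in>UNIV. a $ i * b $ i)"

lemma dot_simps [simp]:
  "dot (a + b) c = dot a c + dot b c" "dot a (b + c) = dot a b + dot a c"
  "dot (a - b) c = dot a c - dot b c" "dot a (b - c) = dot a b - dot a c"
  "dot (k *s a) c = k * dot a c" "dot a (k *s c) = k * dot a c"
  "dot (- a) c = - dot a c" "dot a (- c) = - dot a c" "dot 0 c = 0" "dot a 0 = 0"
  by (simp_all add: dot_def algebra_simps sum.distrib sum_subtractf sum_distrib_left sum_negf)

lemma dot_commute: "dot a b = dot b a"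
  by (simp add: dot_def mult.commute)

lemma dot_axis [simp]: "dot (axis i k) v = k * v $ i" "dot v (axis i k) = v $ i * k"
proof -
  show "dot (axis i k) v = k * v $ i"
    unfolding dot_def axis_def by (subst sum.cong[OF refl, where h = "\<lambda>j. if j = i then k * v $ i else 0"]) auto
  then show "dot v (axis i k) = v $ i * k" by (simp add: dot_commute mult.commute)
qed

lemma axis_component: "axis i k $ j = (if j = i then k else 0)"
  by (simp add: axis_def)

lemma dot_self_eq_0: "dot a a = 0 \<longleftrightarrow> a = 0"
  unfolding dot_def by (subst sum_nonneg_eq_0_iff) (auto simp: vec_eq_iff)

lemma act_linear [simp]:
  "act A (v + w) = act A v + act A w" "act A (v - w) = act A v - act A w"
  "act A (- v) = - act A v" "act A 0 = 0" "act A (k *s v) = k *s act A v"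
  by (simp_all add: matrix_vector_mult_def vec_eq_iff algebra_simps sum.distrib sum_subtractf sum_negf sum_distrib_left)

lemma act_sl_one [simp]: "act sl_one v = v"
  by (simp add: sl_one.rep_eq)

lemma act_sl_mult [simp]: "act (sl_mult A B) v = act A (act B v)"
  by (simp add: sl_mult.rep_eq matrix_vector_mul_assoc)

lemma act_axis: "act A (axis j 1) $ i = sl_mat A $ i $ j"
proof -
  have "act A (axis j 1) $ i = dot (sl_mat A $ i) (axis j 1)"
    by (simp add: matrix_vector_mult_def dot_def)
  then show ?thesis by simp
qed

lemma sl_eqI: "(\<And>v. act A v = act B v) \<Longrightarrow> A = B"
  unfolding sl_mat_inject[symmetric] vec_eq_iff by (metis act_axis)

lemma sl_mult_assoc: "sl_mult (sl_mult A B) C = sl_mult A (sl_mult B C)"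
  by (rule sl_eqI) simp

lemma sl_mult_one [simp]: "sl_mult sl_one A = A" "sl_mult A sl_one = A"
  by (rule sl_eqI; simp)+

definition sl_inv :: "'n::finite sl \<Rightarrow> 'n sl" where "sl_inv A = (SOME B. sl_mult B A = sl_one)"

lemma sl_mult_inv [simp]: "sl_mult (sl_inv A) A = sl_one" "sl_mult A (sl_inv A) = sl_one"
proof -
  have left: "sl_mult (sl_inv B) B = sl_one" for B :: "'a sl"
    unfolding sl_inv_def by (rule someI_ex) (metis sl_left_inverse)
  show "sl_mult (sl_inv A) A = sl_one" by (rule left)
  have "sl_inv (sl_inv A) = A"
    by (metis left sl_mult_assoc sl_mult_one)
  then show "sl_mult A (sl_inv A) = sl_one"
    using left[of "sl_inv A"] by simp
qed

lemma act_inv [simp]: "act (sl_inv A) (act A v) = v" "act A (act (sl_inv A) v) = v"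
  by (metis act_sl_mult act_sl_one sl_mult_inv)+

lemma act_eq_iff [simp]: "act A v = act A w \<longleftrightarrow> v = w"
  by (metis act_inv(1))

lemma sl_inv_eq: "(\<And>v. act A (act B v) = v) \<Longrightarrow> sl_inv A = B"
  by (rule sl_eqI) (metis act_inv(1))

lemma sl_inv_simps [simp]: "sl_inv sl_one = sl_one" "sl_inv (sl_inv A) = A"
  by (rule sl_inv_eq; simp)+

lemma sl_inv_mult [simp]: "sl_inv (sl_mult A B) = sl_mult (sl_inv B) (sl_inv A)"
  by (rule sl_inv_eq) simp

lemma sl_mult_cancel [simp]:
  "sl_mult A (sl_mult (sl_inv A) B) = B" "sl_mult (sl_inv A) (sl_mult A B) = B"
  by (rule sl_eqI; simp)+

lemma affine_mult [simp]: "(v, A) \<otimes>\<^bsub>affine_sl\<^esub> (w, B) = (v + act A w, sl_mult A B)"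
  by (simp add: affine_sl_def)

lemma affine_one [simp]: "\<one>\<^bsub>affine_sl\<^esub> = (0, sl_one)"
  by (simp add: affine_sl_def)

interpretation affine: full_group affine_sl
  by (intro full_group.intro full_group_axioms.intro group_affine_sl) (simp add: affine_sl_def)

lemma affine_inv [simp]: "inv\<^bsub>affine_sl\<^esub> (v, A) = (- act (sl_inv A) v, sl_inv A)"
  by (rule affine.inv_equality) auto

abbreviation affine_times (infixl "\<star>" 70) where "x \<star> y \<equiv> x \<otimes>\<^bsub>affine_sl\<^esub> y"

abbreviation affine_inverse ("inva _" [81] 80) where "inva x \<equiv> inv\<^bsub>affine_sl\<^esub> x"

lemma sl_mat_Abs: "det M = 1 \<Longrightarrow> sl_mat (Abs_sl M) = M"
  by (simp add: Abs_sl_inverse)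

text \<open>The matrix \<open>1 + a b\<^sup>T\<close> is invertible over the integers, so its square has determinant one.\<close>

lemma transvection:
  fixes a b :: "int^'n::finite"
  assumes ab: "dot b a = 0"
  obtains T where "\<And>y. act T y = y + (2 * dot b y) *s a" "\<And>y. act (sl_inv T) y = y - (2 * dot b y) *s a"
proof -
  define M where "M s = (\<chi> i j. (if i = j then 1 else 0) + s * (a $ i * b $ j))" for s :: int
  have M: "M s *v y = y + (s * dot b y) *s a" for s y
  proof -
    have "(M s *v y) $ i = (\<Sum>j\<in>UNIV. (if j = i then y $ j else 0) + s * a $ i * (b $ j * y $ j))" for i
      unfolding M_def matrix_vector_mult_def by (simp add: algebra_simps) (intro sum.cong; auto simp: algebra_simps)
    also have "\<dots> i = y $ i + s * a $ i * dot b y" for i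
      by (simp add: sum.distrib dot_def sum_distrib_left)
    finally show ?thesis by (simp add: vec_eq_iff algebra_simps)
  qed
  have comp: "M s *v (M t *v y) = y + ((s + t) * dot b y) *s a" for s t y
    by (simp add: M ab vec_eq_iff algebra_simps)
  have "M 1 ** M (-1) = mat 1"
  proof -
    have "(M 1 ** M (-1)) *v y = mat 1 *v y" for y
      using comp[of 1 "-1" y] by (simp add: matrix_vector_mul_assoc)
    then show ?thesis
    proof -
      assume *: "\<And>y. (M 1 ** M (-1)) *v y = mat 1 *v y"
      have "X $ i $ j = (X *v axis j 1) $ i" for X :: "int^'n^'n" and i j
        by (simp add: matrix_vector_mult_def axis_def if_distrib cong: if_cong)
      then show ?thesis unfolding vec_eq_iff using * by metis
    qed
  qed
  then have "det (M 1) * det (M (-1)) = 1"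
    by (metis det_mul det_I)
  then have "det (M 1) = 1 \<or> det (M 1) = -1"
    by (auto simp: zmult_eq_1_iff)
  then have det: "det (M 1 ** M 1) = 1"
    by (auto simp: det_mul)
  define T where "T = Abs_sl (M 1 ** M 1)"
  have T: "act T y = y + (2 * dot b y) *s a" for y
    unfolding T_def sl_mat_Abs[OF det] using comp[of 1 1 y] by (simp add: matrix_vector_mul_assoc)
  have "act (sl_inv T) y = y - (2 * dot b y) *s a" for y
  proof -
    have "act T (y - (2 * dot b y) *s a) = y" by (simp add: T ab vec_eq_iff)
    then show ?thesis by (metis act_inv(1))
  qed
  with T show ?thesis using that by blast
qed

lemma elementary:
  assumes ij: "(i :: 'n::finite) \<noteq> j"
  obtains T where "\<And>y. act T y = y + axis i (t * y $ j)"
proof -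
  define M :: "int^'n^'n" where "M = (\<chi> k. if k = i then row i (mat 1) + t *s row j (mat 1) else row k (mat 1))"
  have det: "det M = 1" unfolding M_def det_row_operation[OF ij] by simp
  have "(M *v y) $ k = (y + axis i (t * y $ j)) $ k" for y k
  proof -
    have r: "row l (mat 1 :: int^'n^'n) = axis l 1" for l
      by (auto simp: row_def mat_def axis_def vec_eq_iff)
    have "(M *v y) $ k = dot (M $ k) y" by (simp add: matrix_vector_mult_def dot_def)
    also have "\<dots> = (if k = i then y $ i + t * y $ j else y $ k)"
      by (simp add: M_def r)
    finally show ?thesis by (simp add: axis_def)
  qed
  then have "act (Abs_sl M) y = y + axis i (t * y $ j)" for y
    unfolding sl_mat_Abs[OF det] by (simp add: vec_eq_iff)
  then show ?thesis using that by blast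
qed

section \<open>Generic integer vectors and matrices\<close>

lemma finite_quadratic_roots:
  fixes \<alpha> \<beta> \<gamma> :: int
  assumes "\<alpha> \<noteq> 0 \<or> \<beta> \<noteq> 0 \<or> \<gamma> \<noteq> 0"
  shows "finite {s. \<alpha> * s\<^sup>2 + \<beta> * s + \<gamma> = 0}"
proof -
  have "finite {s. poly [:\<gamma>, \<beta>, \<alpha>:] s = 0}"
    using assms by (intro poly_roots_finite) auto
  then show ?thesis by (simp add: algebra_simps power2_eq_square)
qed

lemma ex_int_avoiding:
  fixes P :: "'i \<Rightarrow> int \<Rightarrow> bool"
  assumes "finite I" "\<forall>i\<in>I. finite {s. P i s}" "finite {s. R s}"
  shows "\<exists>s. \<not> R s \<and> (\<forall>i\<in>I. \<not> P i s)"
proof -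
  have "finite ({s. R s} \<union> (\<Union>i\<in>I. {s. P i s}))" using assms by blast
  then have "\<exists>s. s \<notin> {s. R s} \<union> (\<Union>i\<in>I. {s. P i s})"
    using ex_new_if_finite[OF infinite_UNIV_int] by blast
  then show ?thesis by simp
qed

text \<open>A multiple of the new vector \<open>y\<close> is added to a vector that works for
  \<open>F\<close>. Each condition excludes at most one multiple, the one for \<open>y\<close>
  because \<open>dot y y\<close> is nonzero; the quadratics occurring here have leading coefficient
  0.\<close>

lemma generic_vector:
  assumes "finite F" "0 \<notin> F"
  shows "\<exists>c. \<forall>y\<in>F. dot c y \<noteq> 0"
  using assms
proof (induction F)
  case (insert y F)
  then obtain c where c: "\<And>z. z \<in> F \<Longrightarrow> dot c z \<noteq> 0" by auto
  have f1: "\<forall>z\<in>F. finite {s. 0 * s\<^sup>2 + dot y z * s + dot c z = 0}"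
    using c by (intro ballI finite_quadratic_roots) simp
  have f2: "finite {s. 0 * s\<^sup>2 + dot y y * s + dot c y = 0}"
    using insert.prems by (intro finite_quadratic_roots) (auto simp: dot_self_eq_0)
  obtain s where "0 * s\<^sup>2 + dot y y * s + dot c y \<noteq> 0" "\<forall>z\<in>F. 0 * s\<^sup>2 + dot y z * s + dot c z \<noteq> 0"
    using ex_int_avoiding[OF insert.hyps(1) f1 f2] by blast
  then have "\<forall>z\<in>insert y F. dot (c + s *s y) z \<noteq> 0"
    by (auto simp: algebra_simps)
  then show ?case by blast
qed auto

text \<open>If every \<open>b\<close> orthogonal to \<open>a\<close> were orthogonal to
  \<open>act A a\<close>, pairs of distinct unit vectors would kill the off-diagonal entries, and
  the pair \<open>e_i + e_j\<close>, \<open>e_i - e_j\<close> would equate the diagonal ones. A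
  scalar invertible over the integers is 1 or -1.\<close>

lemma non_scalar:
  fixes A :: "'n::finite sl"
  assumes "A \<noteq> sl_one" "\<not> (\<forall>v. act A v = - v)"
  shows "\<exists>a b. dot b a = 0 \<and> dot b (act A a) \<noteq> 0"
proof (rule ccontr)
  assume "\<not> ?thesis"
  then have *: "dot b (act A a) = 0" if "dot b a = 0" for a b using that by blast
  have off: "act A (axis j 1) $ i = 0" if "i \<noteq> j" for i j
    using *[of "axis i 1" "axis j 1"] that by (simp add: axis_component)
  have diag: "act A (axis i 1) $ i = act A (axis j 1) $ j" for i j
  proof (cases "i = j")
    case False
    then show ?thesis
      using *[of "axis i 1 - axis j 1" "axis i 1 + axis j 1"] off[of i j] off[of j i]
      by (simp add: axis_component)
  qed simp
  fix k :: 'n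
  define l where "l = act A (axis k 1) $ k"
  have A: "act A v = l *s v" for v
  proof -
    have "act A v $ i = l * v $ i" for i
    proof -
      have "act A v $ i = (\<Sum>j\<in>UNIV. sl_mat A $ i $ j * v $ j)" by (simp add: matrix_vector_mult_def)
      also have "\<dots> = (\<Sum>j\<in>UNIV. if j = i then l * v $ i else 0)"
        using off diag[of _ k] by (intro sum.cong) (auto simp: act_axis[symmetric] l_def)
      finally show ?thesis by simp
    qed
    then show ?thesis by (simp add: vec_eq_iff)
  qed
  have "act A (act (sl_inv A) (axis k 1)) $ k = 1" by simp
  then have "l * act (sl_inv A) (axis k 1) $ k = 1" unfolding A by simp
  then have "l = 1 \<or> l = -1" by (metis zmult_eq_1_iff)
  then show False
  proof
    assume "l = 1"
    then have "A = sl_one" using A by (intro sl_eqI) simp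
    then show False using assms(1) by simp
  next
    assume "l = -1"
    then have "\<forall>v. act A v = - v" using A by (simp add: vec_eq_iff)
    then show False using assms(2) by simp
  qed
qed

text \<open>The conjugator is a transvection with parameter \<open>t\<close> along a vector
  orthogonal to \<open>b\<close>. A suitable coordinate of the first expression is linear in
  \<open>t\<close> and one of the second is quadratic, with leading coefficients made nonzero by the
  choice of \<open>b\<close>; so only finitely many \<open>t\<close> are bad. At
  \<open>u = w\<close> the first expression is 0 for every \<open>k\<close>, whence the
  exception.\<close>

lemma generic_conjugator:
  fixes A :: "'n::finite sl"
  assumes A: "A \<noteq> sl_one" "\<not> (\<forall>v. act A v = - v)" and w: "w \<noteq> 0" and F: "finite F"
  shows "\<exists>k. (\<forall>u\<in>F. u \<noteq> w \<longrightarrow> act (sl_inv k) (w - u) \<notin> F) \<and>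
    (\<forall>u\<in>F. act k (act A (act (sl_inv k) w - u)) \<notin> F)"
proof -
  obtain a0 b0 where ab0: "dot b0 a0 = 0" "dot b0 (act A a0) \<noteq> 0" using non_scalar[OF A] by blast
  have b0: "b0 \<noteq> 0" using ab0(2) by auto
  define N where "N = insert w ((\<lambda>u. w - u) ` (F - {w}))"
  have N: "finite N" "0 \<notin> N" using F w by (auto simp: N_def)
  obtain c where c: "\<And>y. y \<in> N \<Longrightarrow> dot c y \<noteq> 0" using generic_vector[OF N] by blast
  \<comment> \<open>This vector is orthogonal to \<open>b\<close>, and at \<open>b = b0\<close> it
    is a nonzero multiple of \<open>a0\<close>; hence the quadratic \<open>q\<close> does not vanish
    identically along \<open>s *s b0 + c\<close>.\<close>
  define a where "a b = dot b b0 *s a0 - dot b a0 *s b0" for b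
  define q where "q b = dot b (act A (a b))" for b
  have q: "q (s *s b0 + c) = q b0 * s\<^sup>2 + (dot b0 b0 * dot c (act A a0) + dot c b0 * dot b0 (act A a0)
      - dot c a0 * dot b0 (act A b0)) * s + q c" for s
    by (simp add: q_def a_def ab0 algebra_simps power2_eq_square)
  have q0: "q b0 \<noteq> 0" using ab0 b0 by (simp add: q_def a_def dot_self_eq_0)
  have f1: "\<forall>y\<in>N. finite {s. 0 * s\<^sup>2 + dot b0 y * s + dot c y = 0}"
    using c by (intro ballI finite_quadratic_roots) simp
  have f2: "finite {s. q (s *s b0 + c) = 0}"
    unfolding q using q0 by (intro finite_quadratic_roots) simp
  obtain s where s: "q (s *s b0 + c) \<noteq> 0" "\<And>y. y \<in> N \<Longrightarrow> 0 * s\<^sup>2 + dot b0 y * s + dot c y \<noteq> 0"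
    using ex_int_avoiding[OF N(1) f1 f2] by blast
  define b where "b = s *s b0 + c"
  have bN: "dot b y \<noteq> 0" if "y \<in> N" for y using s(2)[OF that] by (simp add: b_def algebra_simps)
  have qb: "dot b (act A (a b)) \<noteq> 0" using s(1) by (simp add: q_def b_def)
  have ba: "dot b (a b) = 0" by (simp add: a_def algebra_simps)
  have "a b \<noteq> 0" using qb by auto
  then obtain m where m: "a b $ m \<noteq> 0" by (auto simp: vec_eq_iff)
  have bw: "dot b w \<noteq> 0" using bN by (simp add: N_def)
  \<comment> \<open>\<open>R1\<close> and \<open>R2\<close> say that coordinate \<open>m\<close> of
    the respective moved vector agrees with that of \<open>snd p\<close>, expanded in powers of
    \<open>t\<close>.\<close>
  define R1 where "R1 p t \<longleftrightarrow> 0 * t\<^sup>2 + (- 2 * dot b (w - fst p) * a b $ m) * t + ((w - fst p) $ m - snd p $ m) = 0"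
    for t and p :: "(int^'n) \<times> (int^'n)"
  define R2 where "R2 p t \<longleftrightarrow> (- 4 * dot b w * dot b (act A (a b)) * a b $ m) * t\<^sup>2
      + (2 * dot b (act A (w - fst p)) * a b $ m - 2 * dot b w * act A (a b) $ m) * t
      + (act A (w - fst p) $ m - snd p $ m) = 0" for t and p :: "(int^'n) \<times> (int^'n)"
  have f1: "\<forall>p\<in>(F - {w}) \<times> F. finite {t. R1 p t}"
  proof
    fix p assume "p \<in> (F - {w}) \<times> F"
    then have "dot b (w - fst p) \<noteq> 0" by (intro bN) (auto simp: N_def)
    then show "finite {t. R1 p t}"
      unfolding R1_def using m by (intro finite_quadratic_roots) auto
  qed
  have "finite {t. R2 p t}" if "p \<in> F \<times> F" for p
    unfolding R2_def using bw qb m by (intro finite_quadratic_roots) auto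
  then have f2: "finite {t. \<exists>p\<in>F \<times> F. R2 p t}" using F by simp
  have f3: "finite ((F - {w}) \<times> F)" using F by simp
  obtain t where t: "\<And>p. p \<in> F \<times> F \<Longrightarrow> \<not> R2 p t" "\<And>p. p \<in> (F - {w}) \<times> F \<Longrightarrow> \<not> R1 p t"
    using ex_int_avoiding[OF f3 f1 f2] by blast
  have "dot b (t *s a b) = 0" using ba by simp
  then obtain k where k: "\<And>y. act k y = y + (2 * dot b y) *s (t *s a b)"
      "\<And>y. act (sl_inv k) y = y - (2 * dot b y) *s (t *s a b)"
    using transvection[of b "t *s a b"] by blast
  have "act (sl_inv k) (w - u) \<notin> F" if u: "u \<in> F" "u \<noteq> w" for u
  proof
    assume f: "act (sl_inv k) (w - u) \<in> F"
    then have "\<not> R1 (u, act (sl_inv k) (w - u)) t" using t(2) u by auto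
    then show False unfolding R1_def k by (simp add: algebra_simps)
  qed
  moreover have "act k (act A (act (sl_inv k) w - u)) \<notin> F" if u: "u \<in> F" for u
  proof
    assume f: "act k (act A (act (sl_inv k) w - u)) \<in> F"
    then have "\<not> R2 (u, act k (act A (act (sl_inv k) w - u))) t" using t(1) u by auto
    then show False unfolding R2_def k using ba by (simp add: algebra_simps power2_eq_square)
  qed
  ultimately show ?thesis by blast
qed

lemma act_neq_witness:
  assumes "A \<noteq> B" shows "\<exists>i r. r \<noteq> 0 \<and> (\<forall>z. (act B z - act A z) $ i = dot r z)"
proof -
  have "sl_mat A \<noteq> sl_mat B" using assms by (simp add: sl_mat_inject)
  then obtain i where i: "sl_mat B $ i \<noteq> sl_mat A $ i"
    unfolding vec_eq_iff[of "sl_mat A"] by metis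
  have "(act B z - act A z) $ i = dot (sl_mat B $ i - sl_mat A $ i) z" for z
    by (simp add: matrix_vector_mult_def dot_def left_diff_distrib sum_subtractf)
  moreover have "sl_mat B $ i - sl_mat A $ i \<noteq> 0" using i by simp
  ultimately show ?thesis by blast
qed

text \<open>Relative to the coset of \<open>A\<close>, conjugation by the translation
  \<open>z\<close> moves the coset of \<open>B\<close> by \<open>act B z - act A z\<close>. For a
  multiple of one generic vector, some coordinate of each such difference grows linearly, so all
  finitely many collisions can be avoided at once.\<close>

lemma generic_translation:
  fixes A :: "'n::finite sl"
  assumes A: "A \<noteq> sl_one" and F: "finite F"
  shows "\<exists>z. act A z \<noteq> z \<and> (\<forall>(y, B)\<in>F. B \<noteq> A \<longrightarrow> (y + act B z - act A z, B) \<notin> F)"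
proof -
  \<comment> \<open>The identity is included among the matrices to be separated from
    \<open>A\<close>; this yields \<open>act A z \<noteq> z\<close>.\<close>
  define S where "S = insert sl_one (snd ` F) - {A}"
  have S: "finite S" "A \<notin> S" "sl_one \<in> S" using F A by (auto simp: S_def)
  have "\<forall>B\<in>S. \<exists>i r. r \<noteq> 0 \<and> (\<forall>z. (act B z - act A z) $ i = dot r z)"
    using act_neq_witness S(2) by metis
  then obtain i r where ir: "\<And>B. B \<in> S \<Longrightarrow> r B \<noteq> 0" "\<And>B z. B \<in> S \<Longrightarrow> (act B z - act A z) $ i B = dot (r B) z"
    by metis
  obtain c where c: "\<And>B. B \<in> S \<Longrightarrow> dot c (r B) \<noteq> 0"
    using generic_vector[of "r ` S"] S(1) ir(1) by force
  define R where "R p s \<longleftrightarrow> 0 * s\<^sup>2 + dot (r (snd (fst p))) c * s + (fst (fst p) - fst (snd p)) $ i (snd (fst p)) = 0"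
    for s and p :: "'n affine \<times> 'n affine"
  define J where "J = {p \<in> F \<times> F. snd (fst p) \<noteq> A}"
  have f1: "\<forall>p\<in>J. finite {s. R p s}"
  proof
    fix p assume "p \<in> J"
    then have "dot (r (snd (fst p))) c \<noteq> 0"
      using c[of "snd (fst p)"] by (force simp: J_def S_def dot_commute)
    then show "finite {s. R p s}"
      unfolding R_def by (intro finite_quadratic_roots) auto
  qed
  have f2: "finite J" using F by (simp add: J_def)
  have f3: "finite {s :: int. s = 0}" by simp
  obtain s where s: "s \<noteq> 0" "\<And>p. p \<in> J \<Longrightarrow> \<not> R p s"
    using ex_int_avoiding[OF f2 f1 f3] by blast
  have "act A (s *s c) \<noteq> s *s c"
  proof
    assume "act A (s *s c) = s *s c"
    then have "dot (r sl_one) (s *s c) = 0" using ir(2)[OF S(3), of "s *s c"] by simp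
    then show False using c[OF S(3)] s(1) by (simp add: dot_commute)
  qed
  moreover have "(y + act B (s *s c) - act A (s *s c), B) \<notin> F" if yB: "(y, B) \<in> F" "B \<noteq> A" for y B
  proof
    let ?y = "y + act B (s *s c) - act A (s *s c)"
    assume "(?y, B) \<in> F"
    then have "\<not> R ((y, B), (?y, B)) s" using yB s(2) by (auto simp: J_def)
    moreover have "B \<in> S" using yB by (force simp: S_def)
    ultimately show False
      using ir(2)[of B "s *s c"] by (simp add: R_def algebra_simps)
  qed
  ultimately show ?thesis by blast
qed

text \<open>The vectors on which \<open>A\<close> and \<open>B\<close> agree, or agree up to sign,
  form two proper subgroups, and two proper subgroups never cover a group: if \<open>u\<close> and
  \<open>v\<close> each escape only one of them, \<open>u + v\<close> escapes both.\<close>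

lemma separating_vector:
  assumes "A \<noteq> B" "\<not> (\<forall>v. act B v = - act A v)"
  obtains w where "act A w \<noteq> act B w" "act A w \<noteq> - act B w"
proof -
  obtain v where v: "act A v \<noteq> act B v" using assms(1) sl_eqI by blast
  obtain u where u: "act B u \<noteq> - act A u" using assms(2) by blast
  show ?thesis
  proof (cases "act B v = - act A v")
    case True
    show ?thesis
    proof (cases "act A u = act B u")
      case eq: True
      have "act A (u + v) \<noteq> act B (u + v)" using eq v by simp
      moreover have "act A (u + v) \<noteq> - act B (u + v)"
      proof
        assume "act A (u + v) = - act B (u + v)"
        then have "act A u = - act B u" using True by (simp add: eq_neg_iff_add_eq_0 algebra_simps)
        then show False using u by (metis minus_minus)
      qed
      ultimately show ?thesis by (rule that)
    qed (use that u in \<open>metis minus_minus\<close>)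
  qed (use that v in \<open>metis minus_minus\<close>)
qed

section \<open>Orbits on integer vectors\<close>

lemma axis_orbit:
  fixes i j :: "'n::finite"
  shows "\<exists>A :: 'n sl. axis j 1 = act A (axis i 1)"
proof (cases "i = j")
  case True then show ?thesis by (metis act_sl_one)
next
  case False
  obtain S where S: "\<And>y. act S y = y + axis j (1 * y $ i)" using elementary[of j i 1] False by metis
  obtain T where T: "\<And>y. act T y = y + axis i (-1 * y $ j)" using elementary[of i j "-1"] False by metis
  have "act (sl_mult T S) (axis i 1) = axis j 1"
    using False by (auto simp: S T vec_eq_iff axis_def)
  then show ?thesis by metis
qed

lemma minus_axis_orbit:
  fixes i j :: "'n::finite"
  assumes "i \<noteq> j"
  shows "\<exists>A :: 'n sl. - axis i 1 = act A (axis i 1)"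
proof -
  obtain S where S: "\<And>y. act S y = y + axis j (1 * y $ i)" using elementary[of j i 1] assms by metis
  obtain T where T: "\<And>y. act T y = y + axis i (-1 * y $ j)" using elementary[of i j "-1"] assms by metis
  \<comment> \<open>The basis vector travels through \<open>e_i\<close>, \<open>e_i + e_j\<close>,
    \<open>e_j\<close>, \<open>e_j - e_i\<close>, \<open>- e_i\<close>.\<close>
  have "act (sl_mult S (sl_mult T (sl_mult T S))) (axis i 1) = - axis i 1"
    using assms by (auto simp: S T vec_eq_iff axis_def)
  then show ?thesis by metis
qed

lemma shear_axis_orbit:
  fixes i j :: "'n::finite"
  assumes "i \<noteq> j"
  shows "\<exists>A :: 'n sl. axis i 1 + axis j m = act A (axis i 1)"
proof -
  obtain S where S: "\<And>y. act S y = y + axis j (m * y $ i)" using elementary[of j i m] assms by metis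
  have "act S (axis i 1) = axis i 1 + axis j m" using assms by (auto simp: S vec_eq_iff axis_def)
  then show ?thesis by metis
qed

text \<open>The Euclidean algorithm on the coordinates.\<close>

lemma vector_orbit:
  fixes v :: "int^'n::finite"
  shows "\<exists>k A. v = k *s act A (axis e 1)"
proof (induction "\<Sum>i\<in>UNIV. nat \<bar>v $ i\<bar>" arbitrary: v rule: less_induct)
  case less
  show ?case
  proof (cases "\<exists>i j. i \<noteq> j \<and> v $ i \<noteq> 0 \<and> v $ j \<noteq> 0")
    case True
    then obtain i j where ij: "i \<noteq> j" "v $ i \<noteq> 0" "v $ j \<noteq> 0" "\<bar>v $ j\<bar> \<le> \<bar>v $ i\<bar>"
      by (metis linorder_le_cases)
    \<comment> \<open>With this sign, adding \<open>t * v $ j\<close> lowers the absolute value of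
      \<open>v $ i\<close>.\<close>
    define t where "t = - (sgn (v $ i) * sgn (v $ j))"
    obtain T where T: "\<And>y. act T y = y + axis i (t * y $ j)" using elementary[of i j t] ij(1) by metis
    have smaller: "\<bar>v $ i + t * v $ j\<bar> < \<bar>v $ i\<bar>"
      using ij(2,3,4) unfolding t_def by (auto simp: sgn_if abs_if split: if_splits)
    have "(\<Sum>k\<in>UNIV. nat \<bar>act T v $ k\<bar>) < (\<Sum>k\<in>UNIV. nat \<bar>v $ k\<bar>)"
      using smaller by (intro sum_strict_mono_ex1) (auto simp: T axis_def)
    from less[OF this] obtain k A where "act T v = k *s act A (axis e 1)" by blast
    then have "v = k *s act (sl_mult (sl_inv T) A) (axis e 1)"
      by (metis act_inv(1) act_linear(5) act_sl_mult)
    then show ?thesis by blast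
  next
    case False
    obtain j where j: "\<And>i. i \<noteq> j \<Longrightarrow> v $ i = 0" using False by metis
    have "v = v $ j *s axis j 1" using j by (auto simp: vec_eq_iff axis_def)
    then show ?thesis using axis_orbit[of j e] by metis
  qed
qed

lemma dvd_act_iff: "(\<forall>i. d dvd act A v $ i) \<longleftrightarrow> (\<forall>i. d dvd v $ i)"
proof -
  have *: "\<forall>i. d dvd act A v $ i" if "\<forall>i. d dvd v $ i" for A v
    using that by (auto simp: matrix_vector_mult_def intro!: dvd_sum dvd_mult)
  show ?thesis using *[of v A] *[of "act A v" "sl_inv A"] by auto
qed

section \<open>The translation part of an invariant space\<close>

lemma infsum_eq_single:
  fixes F :: "'a \<Rightarrow> 'b :: {comm_monoid_add, t2_space}"
  assumes "\<And>x. x \<noteq> a \<Longrightarrow> F x = 0" shows "infsum F UNIV = F a"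
proof -
  have "infsum F UNIV = infsum F {a}" using assms by (intro infsum_cong_neutral) auto
  then show ?thesis by simp
qed

lemma infsum_inj_support:
  fixes F :: "'a \<Rightarrow> 'b :: {comm_monoid_add, t2_space}"
  assumes "inj \<phi>" and "\<And>x. x \<notin> range \<phi> \<Longrightarrow> F x = 0"
  shows "infsum F UNIV = infsum (\<lambda>l. F (\<phi> l)) UNIV"
proof -
  have "infsum F UNIV = infsum F (range \<phi>)" using assms(2) by (intro infsum_cong_neutral) auto
  also have "\<dots> = infsum (F \<circ> \<phi>) UNIV" by (rule infsum_reindex[OF assms(1)])
  finally show ?thesis by (simp add: o_def)
qed

lemma ell2_restrict:
  obtains r where "\<And>x. apply_ell2 r x = (if P x then apply_ell2 f x else 0)"
proof -
  have "(\<lambda>x. (cmod (if P x then apply_ell2 f x else 0))\<^sup>2) summable_on UNIV"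
    by (rule summable_on_comparison_test[OF ell2_summable[of f]]) auto
  then have "apply_ell2 (Abs_ell2 (\<lambda>x. if P x then apply_ell2 f x else 0)) x = (if P x then apply_ell2 f x else 0)" for x
    by (subst Abs_ell2_inverse) auto
  then show ?thesis using that by blast
qed

text \<open>The distinct coordinates \<open>p\<close> and \<open>q\<close> express that the
  dimension is at least 2; the auxiliary lines of the product arguments lie in their plane.\<close>

locale affine_space = invariant_space "affine_sl :: 'n::finite affine monoid" K
  for K :: "'n::finite affine ell2 set" +
  fixes p q :: "'n::finite"
  assumes pq: "p \<noteq> q"
begin

abbreviation "id1 \<equiv> (sl_one :: 'n::finite sl)"

lemma smult_cancel:
  fixes u :: "int^'n" assumes "u \<noteq> 0" shows "k *s u = l *s u \<longleftrightarrow> k = l"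
proof -
  obtain i where "u $ i \<noteq> 0" using assms by (auto simp: vec_eq_iff)
  then show ?thesis by (auto simp: vec_eq_iff dest: spec[of _ i])
qed

lemma smult_uminus [simp]: "(- k) *s u = - (k *s u)" for u :: "int^'n"
  by (simp add: vec_eq_iff)

section \<open>Supports of the projected translations\<close>

lemma coeff_shift: "coeff (v + z - act A z, A) (y + z - act B z, B) = coeff (v, A) (y, B)"
  using coeff_conj'[of "(z, sl_one)" "(v, A)" "(y, B)"] by (simp add: algebra_simps)

lemma coeff_act:
  "coeff (act C v, sl_mult (sl_mult C A) (sl_inv C)) (act C y, sl_mult (sl_mult C B) (sl_inv C)) = coeff (v, A) (y, B)"
  using coeff_conj'[of "(0, C)" "(v, A)" "(y, B)"] by simp

lemma coeff_act_one: "coeff (act C v, sl_one) (act C y, sl_one) = coeff (v, sl_one) (y, sl_one)"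
  using coeff_act[of C v sl_one y sl_one] by simp

text \<open>Conjugation by translations fixes \<open>(v, sl_one)\<close> but moves
  \<open>(y, B)\<close> along the multiples of \<open>z - act B z\<close>, an infinite
  orbit.\<close>

lemma coeff_translation_support:
  assumes B: "B \<noteq> sl_one"
  shows "coeff (v, sl_one) (y, B) = 0"
proof -
  obtain z where z: "act B z \<noteq> z" using B by (metis act_sl_one sl_eqI)
  show ?thesis
  proof (rule ell2_inj_seq_eq_0)
    show "inj (\<lambda>t :: nat. (y + int t *s (z - act B z), B))"
    proof (rule injI)
      fix s t :: nat assume "(y + int s *s (z - act B z), B) = (y + int t *s (z - act B z), B)"
      then have "int s *s (z - act B z) = int t *s (z - act B z)" by simp
      moreover have "z - act B z \<noteq> 0" using z by auto
      ultimately have "int s = int t" using smult_cancel by blast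
      then show "s = t" by simp
    qed
    show "apply_ell2 (proj (delta (v, sl_one))) (y + int t *s (z - act B z), B) = coeff (v, sl_one) (y, B)" for t
      using coeff_shift[of v "int t *s z" sl_one y B]
      by (simp add: coeff_def algebra_simps vector_ssub_ldistrib)
  qed
qed

text \<open>These are the primitive vectors. The coefficients on the lines they span are one and the
  same function, by \<open>coeff_orb\<close>.\<close>

definition orb :: "(int^'n) set" where "orb = range (\<lambda>A. act A (axis p 1))"

lemma orb_axis: "axis j 1 \<in> orb" and orb_uminus: "- axis p 1 \<in> orb" and orb_shear: "axis p 1 + axis q m \<in> orb"
  using axis_orbit[of j p] minus_axis_orbit[OF pq] shear_axis_orbit[OF pq] by (auto simp: orb_def)

lemma orb_nonzero: "u \<in> orb \<Longrightarrow> u \<noteq> 0"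
proof
  assume "u \<in> orb" "u = 0"
  then obtain A where "act A (axis p 1) = act A 0" by (auto simp: orb_def)
  then show False by (metis act_eq_iff axis_component zero_index zero_neq_one)
qed

lemma inj_line: "u \<noteq> 0 \<Longrightarrow> inj (\<lambda>l. (l *s u, id1))" for u :: "int^'n"
  by (rule injI) (simp add: smult_cancel)

lemma axis_zero [simp]: "axis j (0 :: int) = 0"
  by (simp add: axis_eq_0_iff)

definition axis_coeff :: "int \<Rightarrow> int \<Rightarrow> complex"
  where "axis_coeff k l = coeff (k *s axis p 1, sl_one) (l *s axis p 1, sl_one)"

lemma coeff_orb: "u \<in> orb \<Longrightarrow> coeff (k *s u, sl_one) (l *s u, sl_one) = axis_coeff k l"
proof -
  assume "u \<in> orb"
  then obtain A where u: "u = act A (axis p 1)" by (auto simp: orb_def)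
  show ?thesis unfolding u axis_coeff_def act_linear(5)[symmetric] by (rule coeff_act_one)
qed

text \<open>Elementary matrices adding multiples of coordinate \<open>j\<close> to coordinate
  \<open>p\<close> fix \<open>k *s axis p 1\<close> and move \<open>y\<close> through infinitely
  many points.\<close>

lemma axis_line_support:
  assumes j: "j \<noteq> p" "y $ j \<noteq> 0"
  shows "coeff (k *s axis p 1, sl_one) (y, sl_one) = 0"
proof (rule ell2_inj_seq_eq_0)
  show "inj (\<lambda>t :: nat. (y + axis p (int t * y $ j), id1))"
    using j by (intro injI) (auto simp: vec_eq_iff axis_component split: if_splits)
  fix t :: nat
  obtain T where T: "\<And>y. act T y = y + axis p (int t * y $ j)" using elementary[of p j "int t"] j by metis
  have "k *s axis p 1 + axis p (int t * (k *s axis p 1) $ j) = k *s axis p 1"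
    using j by (auto simp: vec_eq_iff axis_component)
  then show "apply_ell2 (proj (delta (k *s axis p 1, sl_one))) (y + axis p (int t * y $ j), id1) =
      coeff (k *s axis p 1, sl_one) (y, sl_one)"
    using coeff_act_one[of T "k *s axis p 1" y] j unfolding T
    by (simp add: coeff_def axis_component axis_eq_0_iff)
qed

lemma line_support:
  assumes u: "u \<in> orb" and nz: "coeff (k *s u, sl_one) x \<noteq> 0"
  obtains l where "x = (l *s u, sl_one)"
proof -
  obtain A where A: "u = act A (axis p 1)" using u by (auto simp: orb_def)
  obtain y B where x: "x = (y, B)" by fastforce
  have B: "B = sl_one" using coeff_translation_support nz unfolding x by blast
  have "coeff (k *s axis p 1, sl_one) (act (sl_inv A) y, sl_one) = coeff (k *s u, sl_one) x"
    using coeff_act_one[of A "k *s axis p 1" "act (sl_inv A) y"] by (simp add: A x B)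
  then have "act (sl_inv A) y $ j = 0" if "j \<noteq> p" for j
    using axis_line_support[OF that] nz by metis
  then have "act (sl_inv A) y = act (sl_inv A) y $ p *s axis p 1"
    by (auto simp: vec_eq_iff axis_component)
  then have "y = act (sl_inv A) y $ p *s u" by (metis A act_inv(2) act_linear(5))
  then show ?thesis using that x B by blast
qed

section \<open>Vectors of \<open>K\<close> on a single line\<close>

definition on_line :: "int^'n \<Rightarrow> (int \<Rightarrow> complex) \<Rightarrow> 'n affine ell2 \<Rightarrow> bool"
  where "on_line u c f \<longleftrightarrow> (\<forall>l. apply_ell2 f (l *s u, sl_one) = c l) \<and>
    (\<forall>x. (\<forall>l. x \<noteq> (l *s u, sl_one)) \<longrightarrow> apply_ell2 f x = 0)"

definition line_space :: "(int \<Rightarrow> complex) \<Rightarrow> bool"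
  where "line_space c \<longleftrightarrow> (\<exists>f\<in>K. on_line (axis p 1) c f)"

lemma on_line_conjugate:
  assumes "on_line u c f" shows "on_line (act A u) c (conjugate affine_sl (0, A) f)"
  unfolding on_line_def
proof (intro conjI allI impI)
  show "apply_ell2 (conjugate affine_sl (0, A) f) (l *s act A u, sl_one) = c l" for l
    using assms by (simp add: on_line_def)
  fix x :: "'n affine" assume x: "\<forall>l. x \<noteq> (l *s act A u, sl_one)"
  obtain y B where yB: "x = (y, B)" by fastforce
  have "(act (sl_inv A) y, sl_mult (sl_mult (sl_inv A) B) A) \<noteq> (l *s u, sl_one)" for l
  proof
    assume "(act (sl_inv A) y, sl_mult (sl_mult (sl_inv A) B) A) = (l *s u, id1)"
    then have *: "act (sl_inv A) y = l *s u" "sl_mult (sl_mult (sl_inv A) B) A = sl_one" by auto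
    have "B = sl_mult A (sl_mult (sl_mult (sl_mult (sl_inv A) B) A) (sl_inv A))"
      by (simp add: sl_mult_assoc)
    then have "B = sl_one" unfolding * by simp
    moreover have "y = l *s act A u" by (metis *(1) act_inv(2) act_linear(5))
    ultimately show False using x yB by blast
  qed
  then have "apply_ell2 f (act (sl_inv A) y, sl_mult (sl_mult (sl_inv A) B) A) = 0"
    using assms unfolding on_line_def by blast
  then show "apply_ell2 (conjugate affine_sl (0, A) f) x = 0" by (simp add: yB)
qed

lemma line_space_orb:
  assumes u: "u \<in> orb"
  shows "line_space c \<longleftrightarrow> (\<exists>f\<in>K. on_line u c f)"
proof -
  obtain A where A: "u = act A (axis p 1)" using u by (auto simp: orb_def)
  show ?thesis
  proof
    assume "line_space c"
    then show "\<exists>f\<in>K. on_line u c f" unfolding line_space_def A using on_line_conjugate conjugate_K by blast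
  next
    assume "\<exists>f\<in>K. on_line u c f"
    then obtain f where "f \<in> K" "on_line u c f" by blast
    then show "line_space c" unfolding line_space_def
      using on_line_conjugate[of u c f "sl_inv A"] conjugate_K by (auto simp: A)
  qed
qed

lemma line_space_axis_coeff: "line_space (axis_coeff k)"
  unfolding line_space_def
proof (rule bexI[OF _ proj_mem])
  have "axis p 1 \<in> orb" by (rule orb_axis)
  then show "on_line (axis p 1) (axis_coeff k) (proj (delta (k *s axis p 1, sl_one)))"
    unfolding on_line_def axis_coeff_def coeff_def[symmetric] using line_support by metis
qed

lemma line_space_scale:
  assumes "line_space c" shows "line_space (\<lambda>l. s * c l)"
proof -
  obtain f where "f \<in> K" "on_line (axis p 1) c f" using assms by (auto simp: line_space_def)
  then have "cscale s f \<in> K" "on_line (axis p 1) (\<lambda>l. s * c l) (cscale s f)"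
    by (auto simp: cscale_K on_line_def)
  then show ?thesis by (auto simp: line_space_def)
qed

text \<open>Since \<open>f\<close> is its own projection, its value at a point is its inner product
  with the projected point mass: \<open>axis_coeff\<close> is the reproducing kernel of
  \<open>line_space\<close>.\<close>

lemma line_space_has_sum:
  assumes "line_space c" shows "((\<lambda>l. c l * cnj (axis_coeff k l)) has_sum c k) UNIV"
proof -
  obtain f where f: "f \<in> K" "on_line (axis p 1) c f" using assms by (auto simp: line_space_def)
  define \<phi> where "\<phi> l = (l *s axis p (1 :: int), id1)" for l
  have inj: "inj \<phi>" unfolding \<phi>_def by (rule inj_line[OF orb_nonzero[OF orb_axis]])
  define F where "F x = apply_ell2 f x * cnj (coeff (\<phi> k) x)" for x
  have F: "F (\<phi> l) = c l * cnj (axis_coeff k l)" for l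
    using f(2) by (simp add: F_def \<phi>_def axis_coeff_def on_line_def)
  have sum: "F summable_on UNIV"
    unfolding F_def coeff_def by (rule cinner_summable)
  have "c k = apply_ell2 f (\<phi> k)" using f(2) by (simp add: on_line_def \<phi>_def)
  also have "\<dots> = infsum F UNIV"
    unfolding F_def coeff_def cinner.rep_eq[symmetric] by (rule apply_mem[OF f(1)])
  also have "\<dots> = infsum (\<lambda>l. F (\<phi> l)) UNIV"
  proof (rule infsum_inj_support[OF inj])
    fix x assume "x \<notin> range \<phi>"
    then have "apply_ell2 f x = 0" using f(2) unfolding on_line_def \<phi>_def by blast
    then show "F x = 0" by (simp add: F_def)
  qed
  finally have "c k = (\<Sum>\<^sub>\<infinity>l. c l * cnj (axis_coeff k l))" unfolding F .
  moreover have "F summable_on range \<phi>" using sum by (rule summable_on_subset_banach) simp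
  then have "(\<lambda>l. c l * cnj (axis_coeff k l)) summable_on UNIV"
    by (simp add: summable_on_reindex[OF inj] o_def F)
  ultimately show ?thesis by (metis has_sum_infsum)
qed

text \<open>The sum over a pair of independent lines factorizes; restricting it to a third line stays in
  \<open>K\<close> because the projection onto \<open>K\<close> preserves lines.\<close>

lemma line_space_product:
  assumes orb: "u \<in> orb" "v \<in> orb" "w \<in> orb"
    and ind: "\<And>k l k' l'. k *s v + l *s w = k' *s v + l' *s w \<Longrightarrow> k = k' \<and> l = l'"
    and c: "line_space c"
    and e1: "\<And>x k l. k *s v + l *s w = x *s u \<Longrightarrow> e x = axis_coeff j k * c l"
    and e0: "\<And>x. (\<And>k l. k *s v + l *s w \<noteq> x *s u) \<Longrightarrow> e x = 0"
  shows "line_space e"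
proof -
  obtain f where f: "f \<in> K" "on_line w c f" using c line_space_orb[OF orb(3)] by blast
  \<comment> \<open>\<open>h\<close> is the product of the projected point mass at
    \<open>j *s v\<close> with \<open>f\<close>; by independence of \<open>v\<close> and
    \<open>w\<close>, each of its translation coefficients has at most one nonzero summand.\<close>
  obtain h where h: "h \<in> K" "\<And>y. apply_ell2 h y = (\<Sum>\<^sub>\<infinity>b. coeff (j *s v, sl_one) (y \<star> inva b) * apply_ell2 f b)"
    using left_convolution_mem[OF f(1)] by blast
  have h_line: "apply_ell2 h (y, sl_one) = (\<Sum>\<^sub>\<infinity>l. coeff (j *s v, sl_one) (y - l *s w, sl_one) * c l)" for y
  proof -
    have "apply_ell2 h (y, sl_one) = (\<Sum>\<^sub>\<infinity>l. (\<lambda>b. coeff (j *s v, sl_one) ((y, sl_one) \<star> inva b) * apply_ell2 f b) (l *s w, sl_one))"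
      unfolding h(2)
    proof (rule infsum_inj_support[OF inj_line[OF orb_nonzero[OF orb(3)]]])
      fix x assume "x \<notin> range (\<lambda>l. (l *s w, id1))"
      then have "apply_ell2 f x = 0" using f(2) unfolding on_line_def by blast
      then show "coeff (j *s v, sl_one) ((y, sl_one) \<star> inva x) * apply_ell2 f x = 0" by simp
    qed
    then show ?thesis using f(2) by (simp add: on_line_def)
  qed
  have hv: "apply_ell2 h (k *s v + l *s w, sl_one) = axis_coeff j k * c l" for k l
  proof -
    have "coeff (j *s v, sl_one) (k *s v + l *s w - l' *s w, sl_one) * c l' = 0" if "l' \<noteq> l" for l'
    proof (rule ccontr)
      assume "\<not> ?thesis"
      then obtain m where "k *s v + l *s w - l' *s w = m *s v"
        using line_support[OF orb(2), of j "(k *s v + l *s w - l' *s w, sl_one)"] by auto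
      then have "k *s v + l *s w = m *s v + l' *s w" by (metis diff_add_cancel)
      then show False using ind that by blast
    qed
    then have "apply_ell2 h (k *s v + l *s w, sl_one) = coeff (j *s v, sl_one) (k *s v + l *s w - l *s w, sl_one) * c l"
      unfolding h_line by (rule infsum_eq_single)
    then show ?thesis by (simp add: coeff_orb[OF orb(2)])
  qed
  have h0: "apply_ell2 h (y, sl_one) = 0" if "\<And>k l. k *s v + l *s w \<noteq> y" for y
    unfolding h_line
  proof (rule infsum_0)
    fix l
    have "(y - l *s w, sl_one) \<noteq> (m *s v, id1)" for m using that[of m l] by (auto simp: algebra_simps)
    then show "coeff (j *s v, sl_one) (y - l *s w, sl_one) * c l = 0"
      using line_support[OF orb(2)] by (metis mult_zero_left)
  qed
  obtain r where r: "\<And>x. apply_ell2 r x = (if \<exists>l. x = (l *s u, sl_one) then apply_ell2 h x else 0)"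
    using ell2_restrict[of "\<lambda>x. \<exists>l. x = (l *s u, sl_one)" h] by blast
  \<comment> \<open>Rows of \<open>coeff\<close> at points of the line vanish off the line, and the
    other rows vanish on it by hermitian symmetry; so the reproducing identity of \<open>h\<close>
    passes to \<open>r\<close>.\<close>
  have "r \<in> K"
  proof (rule memI)
    fix g
    show "apply_ell2 r g = cinner r (proj (delta g))"
    proof (cases "\<exists>l. g = (l *s u, sl_one)")
      case True
      then have supp: "coeff g x = 0" if "\<nexists>l. x = (l *s u, sl_one)" for x
        using line_support[OF orb(1)] that by blast
      have "cinner r (proj (delta g)) = cinner h (proj (delta g))"
        unfolding cinner.rep_eq r coeff_def[symmetric]
      proof (rule infsum_cong)
        fix x
        show "(if \<exists>l. x = (l *s u, sl_one) then apply_ell2 h x else 0) * cnj (coeff g x) =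
            apply_ell2 h x * cnj (coeff g x)"
          using supp[of x] by simp
      qed
      then show ?thesis using True by (simp add: r apply_mem[OF h(1)])
    next
      case False
      have "apply_ell2 r x * cnj (coeff g x) = 0" for x
      proof (cases "\<exists>l. x = (l *s u, sl_one)")
        case True
        then have "coeff x g = 0" using line_support[OF orb(1)] False by blast
        then show ?thesis using coeff_commute[of g x] by simp
      qed (simp add: r)
      then have "cinner r (proj (delta g)) = 0"
        unfolding cinner.rep_eq coeff_def[symmetric] by (intro infsum_0) auto
      then show ?thesis using False by (simp add: r)
    qed
  qed
  moreover have "on_line u e r"
    unfolding on_line_def
  proof (intro conjI allI impI)
    show "apply_ell2 r (x *s u, sl_one) = e x" for x
    proof (cases "\<exists>k l. k *s v + l *s w = x *s u")
      case True
      then obtain k l where kl: "k *s v + l *s w = x *s u" by blast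
      have "apply_ell2 r (x *s u, sl_one) = apply_ell2 h (x *s u, sl_one)" by (auto simp: r)
      then show ?thesis using hv[of k l] e1[OF kl] by (simp add: kl)
    next
      case False
      have "apply_ell2 r (x *s u, sl_one) = apply_ell2 h (x *s u, sl_one)" by (auto simp: r)
      then show ?thesis using h0[of "x *s u"] e0[of x] False by auto
    qed
    show "apply_ell2 r x = 0" if "\<forall>l. x \<noteq> (l *s u, sl_one)" for x using that by (auto simp: r)
  qed
  ultimately show ?thesis using line_space_orb[OF orb(1)] by blast
qed

lemma axis_coeff_minus: "axis_coeff (- k) (- l) = axis_coeff k l"
  using coeff_orb[OF orb_uminus, of k l] by (simp add: axis_coeff_def)

text \<open>Inversion changes both signs and conjugates the coefficient, whereas a matrix reversing
  the axis changes both signs without conjugating.\<close>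

lemma axis_coeff_real: "cnj (axis_coeff k l) = axis_coeff k l"
proof -
  have "axis_coeff (- k) (- l) = cnj (axis_coeff k l)"
    using coeff_inv[of "(k *s axis p 1, sl_one)" "(l *s axis p 1, sl_one)"] by (simp add: axis_coeff_def)
  then show ?thesis by (simp add: axis_coeff_minus)
qed

lemma axis_coeff_commute: "axis_coeff k l = axis_coeff l k"
  using coeff_commute axis_coeff_real unfolding axis_coeff_def by metis

text \<open>On the line of \<open>axis p 1 + axis q 1\<close> the two coordinates agree, so
  restricting the product to it multiplies pointwise.\<close>

lemma line_space_hadamard:
  assumes "line_space c" shows "line_space (\<lambda>x. axis_coeff j x * c x)"
proof (rule line_space_product[where u = "axis p 1 + axis q 1" and v = "axis p 1" and w = "axis q 1"])
  have co: "(k *s axis p 1 + l *s axis q (1::int)) $ p = k" "(k *s axis p 1 + l *s axis q (1::int)) $ q = l" for k l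
    using pq by (simp_all add: axis_component)
  show "k = k' \<and> l = l'" if "k *s axis p 1 + l *s axis q 1 = k' *s axis p 1 + l' *s axis q (1::int)" for k l k' l'
    using that co by metis
  show "axis_coeff j x * c x = axis_coeff j k * c l" if *: "k *s axis p 1 + l *s axis q 1 = x *s (axis p 1 + axis q 1)" for x k l
  proof -
    have "k = x" "l = x" using arg_cong[OF *, of "\<lambda>y. y $ p"] arg_cong[OF *, of "\<lambda>y. y $ q"] pq
      by (simp_all add: axis_component)
    then show ?thesis by simp
  qed
  show "axis_coeff j x * c x = 0" if "\<And>k l. k *s axis p 1 + l *s axis q 1 \<noteq> x *s (axis p 1 + axis q 1)" for x
    using that[of x x] by (simp add: vec_eq_iff algebra_simps)
qed (use assms orb_axis orb_shear[of 1] in auto)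

text \<open>The second moment of \<open>axis_coeff k - axis_coeff k k\<close> with respect to the weights \<open>(axis_coeff k)\<^sup>2\<close> vanishes.\<close>

lemma axis_coeff_values: "axis_coeff k l = 0 \<or> axis_coeff k l = axis_coeff k k"
proof -
  define r where "r l = Re (axis_coeff k l)" for l
  have r: "axis_coeff k l = complex_of_real (r l)" for l
    using axis_coeff_real[of k l] by (simp add: r_def complex_eq_iff)
  define s where "s = r k"
  \<comment> \<open>The reproducing identity at \<open>k\<close>, for the row
    \<open>axis_coeff k\<close> and its pointwise square and cube, gives the sums of second, third
    and fourth powers: \<open>s\<close>, \<open>s^2\<close> and \<open>s^3\<close> for the diagonal
    entry \<open>s\<close>. They combine to \<open>s^3 - 2 s^3 + s^3 = 0\<close>.\<close>
  have h1: "((\<lambda>l. axis_coeff k l * cnj (axis_coeff k l)) has_sum axis_coeff k k) UNIV" by (rule line_space_has_sum[OF line_space_axis_coeff])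
  have h2: "((\<lambda>l. (axis_coeff k l * axis_coeff k l) * cnj (axis_coeff k l)) has_sum axis_coeff k k * axis_coeff k k) UNIV"
    by (rule line_space_has_sum[OF line_space_hadamard[OF line_space_axis_coeff]])
  have h3: "((\<lambda>l. (axis_coeff k l * (axis_coeff k l * axis_coeff k l)) * cnj (axis_coeff k l)) has_sum axis_coeff k k * (axis_coeff k k * axis_coeff k k)) UNIV"
    by (rule line_space_has_sum[OF line_space_hadamard[OF line_space_hadamard[OF line_space_axis_coeff]]])
  have "((\<lambda>l. (axis_coeff k l * (axis_coeff k l * axis_coeff k l)) * cnj (axis_coeff k l) + (- 2 * axis_coeff k k) * ((axis_coeff k l * axis_coeff k l) * cnj (axis_coeff k l))
      + (axis_coeff k k * axis_coeff k k) * (axis_coeff k l * cnj (axis_coeff k l))) has_sum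
      axis_coeff k k * (axis_coeff k k * axis_coeff k k) + (- 2 * axis_coeff k k) * (axis_coeff k k * axis_coeff k k) + (axis_coeff k k * axis_coeff k k) * axis_coeff k k) UNIV"
    by (intro has_sum_add has_sum_cmult_right h1 h2 h3)
  moreover have "(axis_coeff k l * (axis_coeff k l * axis_coeff k l)) * cnj (axis_coeff k l) + (- 2 * axis_coeff k k) * ((axis_coeff k l * axis_coeff k l) * cnj (axis_coeff k l))
      + (axis_coeff k k * axis_coeff k k) * (axis_coeff k l * cnj (axis_coeff k l)) = complex_of_real ((r l)\<^sup>2 * (r l - s)\<^sup>2)" for l
    unfolding r s_def by (simp add: power2_eq_square algebra_simps)
  moreover have "axis_coeff k k * (axis_coeff k k * axis_coeff k k) + (- 2 * axis_coeff k k) * (axis_coeff k k * axis_coeff k k) + (axis_coeff k k * axis_coeff k k) * axis_coeff k k = complex_of_real 0"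
    by simp
  ultimately have "((\<lambda>l. complex_of_real ((r l)\<^sup>2 * (r l - s)\<^sup>2)) has_sum complex_of_real 0) UNIV" by simp
  then have sum: "((\<lambda>l. (r l)\<^sup>2 * (r l - s)\<^sup>2) has_sum 0) UNIV"
    unfolding has_sum_of_real_iff .
  have "(r l)\<^sup>2 * (r l - s)\<^sup>2 = 0"
    by (rule nonneg_infsum_le_0D[where A = UNIV]) (use sum in \<open>auto simp: infsumI has_sum_imp_summable\<close>)
  then show ?thesis by (auto simp: r s_def)
qed

section \<open>The partition into blocks\<close>

definition support :: "int set" where "support = {k. axis_coeff k k \<noteq> 0}"

definition block :: "int \<Rightarrow> int set" where "block k = {l. axis_coeff k l \<noteq> 0}"

definition indic :: "int set \<Rightarrow> int \<Rightarrow> complex" where "indic X l = (if l \<in> X then 1 else 0)"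

lemma axis_coeff_eq: "axis_coeff k l = axis_coeff k k * indic (block k) l"
  using axis_coeff_values[of k l] by (auto simp: block_def indic_def)

text \<open>All nonzero entries of a row equal its diagonal entry, and a square-summable row can
  repeat a nonzero value only finitely often.\<close>

lemma finite_block: "finite (block k)"
proof (rule ccontr)
  assume "infinite (block k)"
  then obtain s :: "nat \<Rightarrow> int" where s: "inj s" "range s \<subseteq> block k"
    using infinite_countable_subset by blast
  have "axis_coeff k k = 0"
  proof (rule ell2_inj_seq_eq_0)
    show "inj (\<lambda>t. (s t *s axis p 1, id1))"
      using inj_compose[OF inj_line[OF orb_nonzero[OF orb_axis]] s(1)] by (simp add: o_def)
    show "apply_ell2 (proj (delta (k *s axis p 1, sl_one))) (s t *s axis p 1, id1) = axis_coeff k k" for t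
    proof -
      have "axis_coeff k (s t) \<noteq> 0" using s(2) by (auto simp: block_def)
      then have "axis_coeff k (s t) = axis_coeff k k" using axis_coeff_values by blast
      then show ?thesis by (simp add: axis_coeff_def coeff_def)
    qed
  qed
  then have "axis_coeff k l = 0" for l using axis_coeff_values[of k l] by auto
  then have "block k = {}" by (simp add: block_def)
  then show False using \<open>infinite (block k)\<close> by simp
qed

lemma line_space_indic_sum:
  assumes "line_space (indic X)" shows "indic X k = of_nat (card (block k \<inter> X)) * axis_coeff k k"
proof -
  have "((\<lambda>l. indic X l * cnj (axis_coeff k l)) has_sum indic X k) UNIV" by (rule line_space_has_sum[OF assms])
  then have "indic X k = (\<Sum>\<^sub>\<infinity>l. indic X l * cnj (axis_coeff k l))" by (simp add: infsumI)
  also have "\<dots> = (\<Sum>\<^sub>\<infinity>l\<in>block k \<inter> X. axis_coeff k k)"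
    by (rule infsum_cong_neutral) (use axis_coeff_values[of k] in \<open>auto simp: indic_def axis_coeff_real block_def\<close>)
  also have "\<dots> = of_nat (card (block k \<inter> X)) * axis_coeff k k" using finite_block by simp
  finally show ?thesis .
qed

lemma line_space_indicic_block:
  assumes "k \<in> support" shows "line_space (indic (block k))"
proof -
  have "1 / axis_coeff k k * axis_coeff k l = indic (block k) l" for l
    using assms axis_coeff_values[of k l] by (auto simp: indic_def block_def support_def)
  then show ?thesis using line_space_scale[OF line_space_axis_coeff[of k], of "1 / axis_coeff k k"] by simp
qed

text \<open>Evaluated at \<open>k\<close>, the indicators of \<open>X\<close> and of
  \<open>block k\<close> both give 1, so \<open>block k \<inter> X\<close> and
  \<open>block k\<close> have the same cardinality. Blocks are thus atoms: they are the smallest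
  sets with indicator in \<open>line_space\<close>.\<close>

lemma line_space_indic_subset:
  assumes X: "line_space (indic X)" "k \<in> X"
  shows "k \<in> support" "block k \<subseteq> X"
proof -
  have 1: "1 = of_nat (card (block k \<inter> X)) * axis_coeff k k" using line_space_indic_sum[OF X(1), of k] X(2) by (simp add: indic_def)
  then show k: "k \<in> support" by (auto simp: support_def)
  then have "k \<in> block k" by (simp add: support_def block_def)
  then have "1 = of_nat (card (block k)) * axis_coeff k k" using line_space_indic_sum[OF line_space_indicic_block[OF k], of k] by (simp add: indic_def)
  then have "of_nat (card (block k \<inter> X)) * axis_coeff k k = of_nat (card (block k)) * axis_coeff k k" using 1 by simp
  then have "card (block k \<inter> X) = card (block k)" using k by (simp add: support_def)
  then have "block k \<inter> X = block k" using finite_block by (metis card_subset_eq inf_le1)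
  then show "block k \<subseteq> X" by blast
qed

lemma card_block: "k \<in> support \<Longrightarrow> of_nat (card (block k)) * axis_coeff k k = 1"
  using line_space_indic_sum[OF line_space_indicic_block, of k k] by (simp add: indic_def support_def block_def)

lemma block_self: "k \<in> support \<Longrightarrow> k \<in> block k"
  by (simp add: support_def block_def)

lemma block_cong:
  assumes "l \<in> block k" "k \<in> support" shows "l \<in> support" "block l = block k"
proof -
  show l: "l \<in> support" using line_space_indic_subset(1)[OF line_space_indicic_block[OF assms(2)] assms(1)] .
  have "k \<in> block l" using assms(1) axis_coeff_commute[of l k] by (simp add: block_def)
  then show "block l = block k"
    using line_space_indic_subset(2)[OF line_space_indicic_block[OF assms(2)] assms(1)] line_space_indic_subset(2)[OF line_space_indicic_block[OF l]] by blast
qed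

lemma support_uminus: "k \<in> support \<Longrightarrow> - k \<in> support"
  by (simp add: support_def axis_coeff_minus)

lemma axis_coeff_zero: "axis_coeff 0 l = (if l = 0 then 1 else 0)"
proof -
  have "(l *s axis p 1 = 0) = (l = 0)" by (auto simp: vec_eq_iff axis_component)
  then show ?thesis using coeff_one[of "(l *s axis p 1, sl_one)"] by (simp add: axis_coeff_def)
qed

lemma support_zero: "0 \<in> support" and block_zero: "block 0 = {0}"
  by (auto simp: support_def block_def axis_coeff_zero split: if_splits)

text \<open>Points of the lines of \<open>axis p 1\<close> and \<open>axis p 1 + axis q m\<close>
  add up to a point of the line of \<open>axis q 1\<close> exactly if their parameters are
  \<open>- b\<close> and \<open>b\<close>, and the sum then has parameter \<open>m * b\<close>.
  Restricting the product to that line therefore dilates the block by \<open>m\<close>.\<close>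

lemma support_mult:
  assumes k: "k \<in> support" and m: "m \<noteq> 0"
  shows "m * k \<in> support" "block (m * k) \<subseteq> (\<lambda>b. m * b) ` block k"
proof -
  define X where "X = (\<lambda>b. m * b) ` block k"
  have "line_space (\<lambda>x. axis_coeff k k * indic X x)"
  proof (rule line_space_product[where u = "axis q 1" and v = "axis p 1" and w = "axis p 1 + axis q m" and j = "- k"
        and c = "indic (block k)"])
    have co: "(k1 *s axis p 1 + l1 *s (axis p 1 + axis q m)) $ p = k1 + l1"
      "(k1 *s axis p 1 + l1 *s (axis p 1 + axis q m)) $ q = l1 * m" for k1 l1
      using pq by (simp_all add: axis_component)
    show "k1 = k' \<and> l1 = l'"
      if *: "k1 *s axis p 1 + l1 *s (axis p 1 + axis q m) = k' *s axis p 1 + l' *s (axis p 1 + axis q m)" for k1 l1 k' l'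
      using arg_cong[OF *, of "\<lambda>y. y $ p"] arg_cong[OF *, of "\<lambda>y. y $ q"] m unfolding co by simp
    show "axis_coeff k k * indic X x = axis_coeff (- k) k1 * indic (block k) l1"
      if *: "k1 *s axis p 1 + l1 *s (axis p 1 + axis q m) = x *s axis q 1" for x k1 l1
    proof -
      have "k1 + l1 = 0" "l1 * m = x"
        using arg_cong[OF *, of "\<lambda>y. y $ p"] arg_cong[OF *, of "\<lambda>y. y $ q"] pq unfolding co
        by (simp_all add: axis_component)
      then have "k1 = - l1" "x = m * l1" by (simp_all add: mult.commute)
      moreover have "m * l1 \<in> X \<longleftrightarrow> l1 \<in> block k" using m by (auto simp: X_def)
      ultimately show ?thesis using axis_coeff_minus[of k l1] axis_coeff_eq[of k l1] by (simp add: indic_def)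
    qed
    show "axis_coeff k k * indic X x = 0" if *: "\<And>k1 l1. k1 *s axis p 1 + l1 *s (axis p 1 + axis q m) \<noteq> x *s axis q 1" for x
    proof -
      have "x \<notin> X"
      proof
        assume "x \<in> X"
        then obtain b where "x = m * b" by (auto simp: X_def)
        then have "(- b) *s axis p 1 + b *s (axis p 1 + axis q m) = x *s axis q 1"
          by (simp add: vec_eq_iff algebra_simps axis_component)
        then show False using * by blast
      qed
      then show ?thesis by (simp add: indic_def)
    qed
  qed (use orb_axis orb_shear line_space_indicic_block[OF k] in auto)
  then have "line_space (\<lambda>x. 1 / axis_coeff k k * (axis_coeff k k * indic X x))" by (rule line_space_scale)
  then have X: "line_space (indic X)" using k by (simp add: support_def)
  have "m * k \<in> X" unfolding X_def using block_self[OF k] by blast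
  from line_space_indic_subset[OF X this] show "m * k \<in> support" "block (m * k) \<subseteq> (\<lambda>b. m * b) ` block k" by (auto simp: X_def)
qed

text \<open>The two lines are tilted so that their points with parameters \<open>k\<close> and
  \<open>l\<close> add up to \<open>(k + l) *s axis p 1\<close>; the condition
  \<open>k + l \<noteq> 0\<close> is their independence. Other pairs meet the axis only if
  proportional to \<open>(k, l)\<close>, which is the relation
  \<open>l1 * k = k1 * l\<close>.\<close>

lemma support_add:
  assumes k: "k \<in> support" and l: "l \<in> support" and kl: "k + l \<noteq> 0"
  shows "k + l \<in> support" "block (k + l) \<subseteq> {k1 + l1 | k1 l1. k1 \<in> block k \<and> l1 \<in> block l \<and> l1 * k = k1 * l}"
proof -
  define X where "X = {k1 + l1 | k1 l1. k1 \<in> block k \<and> l1 \<in> block l \<and> l1 * k = k1 * l}"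
  have uniq: "k1 = k1' \<and> l1 = l1'" if "k1 + l1 = k1' + l1'" "l1 * k - k1 * l = l1' * k - k1' * l" for k1 l1 k1' l1'
  proof -
    have h: "l1 = k1' + l1' - k1" using that(1) by simp
    have "(k1' - k1) * (k + l) = 0" using that(2) unfolding h by (simp add: algebra_simps)
    then show ?thesis using kl that(1) by simp
  qed
  have "line_space (\<lambda>x. axis_coeff k k * indic X x)"
  proof (rule line_space_product[where u = "axis p 1" and v = "axis p 1 + axis q (- l)" and w = "axis p 1 + axis q k" and j = k
        and c = "indic (block l)"])
    have co: "(k1 *s (axis p 1 + axis q (- l)) + l1 *s (axis p 1 + axis q k)) $ p = k1 + l1"
      "(k1 *s (axis p 1 + axis q (- l)) + l1 *s (axis p 1 + axis q k)) $ q = l1 * k - k1 * l" for k1 l1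
      using pq by (simp_all add: axis_component)
    show "k1 = k' \<and> l1 = l'"
      if *: "k1 *s (axis p 1 + axis q (- l)) + l1 *s (axis p 1 + axis q k) =
        k' *s (axis p 1 + axis q (- l)) + l' *s (axis p 1 + axis q k)" for k1 l1 k' l'
      using arg_cong[OF *, of "\<lambda>y. y $ p"] arg_cong[OF *, of "\<lambda>y. y $ q"] unfolding co by (rule uniq)
    show "axis_coeff k k * indic X x = axis_coeff k k1 * indic (block l) l1"
      if *: "k1 *s (axis p 1 + axis q (- l)) + l1 *s (axis p 1 + axis q k) = x *s axis p 1" for x k1 l1
    proof -
      have x: "x = k1 + l1" "l1 * k = k1 * l"
        using arg_cong[OF *, of "\<lambda>y. y $ p"] arg_cong[OF *, of "\<lambda>y. y $ q"] pq unfolding co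
        by (simp_all add: axis_component)
      have "x \<in> X \<longleftrightarrow> k1 \<in> block k \<and> l1 \<in> block l"
      proof
        assume "x \<in> X"
        then obtain k' l' where *: "x = k' + l'" "k' \<in> block k" "l' \<in> block l" "l' * k = k' * l" by (auto simp: X_def)
        then have "k1 = k' \<and> l1 = l'" using x by (intro uniq) auto
        then show "k1 \<in> block k \<and> l1 \<in> block l" using * by simp
      qed (use x in \<open>auto simp: X_def\<close>)
      then show ?thesis using axis_coeff_eq[of k k1] by (auto simp: indic_def)
    qed
    show "axis_coeff k k * indic X x = 0"
      if *: "\<And>k1 l1. k1 *s (axis p 1 + axis q (- l)) + l1 *s (axis p 1 + axis q k) \<noteq> x *s axis p 1" for x
    proof -
      have "x \<notin> X"
      proof
        assume "x \<in> X"
        then obtain k1 l1 where "x = k1 + l1" "l1 * k = k1 * l" by (auto simp: X_def)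
        then have "k1 *s (axis p 1 + axis q (- l)) + l1 *s (axis p 1 + axis q k) = x *s axis p 1"
          by (auto simp: vec_eq_iff algebra_simps axis_component)
        then show False using * by blast
      qed
      then show ?thesis by (simp add: indic_def)
    qed
  qed (use orb_axis orb_shear line_space_indicic_block[OF l] in auto)
  then have "line_space (\<lambda>x. 1 / axis_coeff k k * (axis_coeff k k * indic X x))" by (rule line_space_scale)
  then have X: "line_space (indic X)" using k by (simp add: support_def)
  have "k + l \<in> X"
    unfolding X_def using block_self[OF k] block_self[OF l]
    by (intro CollectI exI[of _ k] exI[of _ l]) (auto simp: mult.commute)
  from line_space_indic_subset[OF X this]
  show "k + l \<in> support" "block (k + l) \<subseteq> {k1 + l1 | k1 l1. k1 \<in> block k \<and> l1 \<in> block l \<and> l1 * k = k1 * l}"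
    by (auto simp: X_def)
qed

text \<open>Division with remainder by the least positive element; the sum formed is the remainder,
  whose nonvanishing is what \<open>support_add\<close> demands.\<close>

lemma support_subgroup:
  assumes "support \<noteq> {0}"
  shows "\<exists>d\<ge>1. \<forall>k. k \<in> support \<longleftrightarrow> d dvd k"
proof -
  obtain k0 where "k0 \<in> support" "k0 \<noteq> 0" using assms support_zero by blast
  then have ex: "\<exists>n. n > 0 \<and> int n \<in> support"
    using support_uminus[of k0] by (intro exI[of _ "nat \<bar>k0\<bar>"]) (auto simp: abs_if)
  define d where "d = int (LEAST n. n > 0 \<and> int n \<in> support)"
  have d: "d > 0" "d \<in> support" using LeastI_ex[OF ex] by (auto simp: d_def)
  have le: "d \<le> k" if "k \<in> support" "k > 0" for k
  proof -
    have "(LEAST n. n > 0 \<and> int n \<in> support) \<le> nat k" using that by (intro Least_le) auto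
    then show ?thesis using that by (simp add: d_def)
  qed
  have mult: "m * d \<in> support" for m using support_mult(1)[OF d(2), of m] support_zero by (cases "m = 0") auto
  have "d dvd k" if k: "k \<in> support" for k
  proof (rule ccontr)
    assume nd: "\<not> d dvd k"
    have eq: "k + (- (k div d)) * d = k mod d" by (simp add: minus_mult_div_eq_mod[symmetric] algebra_simps)
    have nz: "k mod d \<noteq> 0" using nd by (simp add: dvd_eq_mod_eq_0)
    have "k mod d \<in> support" using support_add(1)[OF k mult[of "- (k div d)"]] nz unfolding eq by blast
    moreover have "k mod d > 0" using nz d(1) by (metis pos_mod_sign order_le_less)
    ultimately show False using le[of "k mod d"] d(1) pos_mod_bound[of d k] by linarith
  qed
  moreover have "k \<in> support" if "d dvd k" for k using mult that by (auto elim!: dvdE simp: mult.commute)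
  ultimately show ?thesis using d(1) by (intro exI[of _ d]) auto
qed

text \<open>If \<open>j * d\<close> shares the block of \<open>d\<close>, dilation by
  \<open>j\<close> shows that \<open>d\<close> is \<open>j\<close> times a multiple of
  \<open>d\<close>, which forces \<open>j\<close> to be 1 or -1.\<close>

lemma block_generator:
  assumes d: "d \<ge> 1" "\<And>k. k \<in> support \<longleftrightarrow> d dvd k"
  shows "block d \<subseteq> {d, - d}"
proof
  fix k assume k: "k \<in> block d"
  have dS: "d \<in> support" using d by simp
  have kS: "k \<in> support" "block k = block d" using block_cong[OF k dS] by auto
  obtain j where j: "k = j * d" using kS(1) d(2) by (metis dvdE mult.commute)
  have "j \<noteq> 0"
  proof
    assume "j = 0"
    then have "d \<in> block 0" using kS j block_self[OF dS] by simp
    then show False using d(1) block_zero by simp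
  qed
  then have "d \<in> (\<lambda>b. j * b) ` block d" using support_mult(2)[OF dS, of j] block_self[OF dS] kS(2) j by blast
  then obtain b where b: "d = j * b" "b \<in> block d" by blast
  then obtain i where "b = d * i" using block_cong(1)[OF b(2) dS] d(2) by (metis dvdE)
  then have "j * i = 1" using b(1) d(1) by (metis mult.left_commute mult_cancel_left mult.right_neutral not_one_le_zero)
  then have "j = 1 \<or> j = -1" by (auto simp: zmult_eq_1_iff)
  then show "k \<in> {d, - d}" using j by auto
qed

lemma axis_coeff_trichotomy:
  "(\<forall>k l. k \<noteq> 0 \<longrightarrow> axis_coeff k l = 0) \<or>
   (\<exists>d\<ge>1. \<forall>k l. axis_coeff k l = (if d dvd k \<and> l = k then 1 else 0)) \<or>
   (\<exists>d\<ge>1. \<forall>k l. axis_coeff k l = (if d dvd k then ((if l = k then 1 else 0) + (if l = - k then 1 else 0)) / 2 else 0))"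
proof (cases "support = {0}")
  case True
  have "axis_coeff k l = 0" if "k \<noteq> 0" for k l
  proof -
    have "k \<notin> support" using that True by simp
    then show ?thesis using axis_coeff_values[of k l] unfolding support_def by auto
  qed
  then show ?thesis by blast
next
  case False
  from support_subgroup[OF this] obtain d where d: "d \<ge> 1" "\<And>k. k \<in> support \<longleftrightarrow> d dvd k" by blast
  have dS: "d \<in> support" using d by simp
  have off_support: "axis_coeff k l = 0" if "\<not> d dvd k" for k l
  proof -
    have "k \<notin> support" using that d(2) by simp
    then show ?thesis using axis_coeff_values[of k l] unfolding support_def by auto
  qed
  have gen: "block d \<subseteq> {d, - d}" by (rule block_generator[OF d])
  show ?thesis
  proof (cases "- d \<in> block d")
    case False
    then have Bd: "block d = {d}" using gen block_self[OF dS] False by blast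
    have on_support: "axis_coeff k l = (if l = k then 1 else 0)" if k: "d dvd k" for k l
    proof (cases "k = 0")
      case True then show ?thesis using axis_coeff_zero by simp
    next
      case nz: False
      obtain m where m: "k = m * d" using k by (metis dvdE mult.commute)
      then have "block k \<subseteq> {k}" using support_mult(2)[OF dS, of m] nz Bd by auto
      moreover have kS: "k \<in> support" using k d(2) by simp
      ultimately have "block k = {k}" using block_self[OF kS] by blast
      then show ?thesis using card_block[OF kS] axis_coeff_eq[of k l] by (simp add: indic_def)
    qed
    have "axis_coeff k l = (if d dvd k \<and> l = k then 1 else 0)" for k l
      by (cases "d dvd k") (simp_all add: on_support off_support)
    then show ?thesis using d(1) by blast
  next
    case True
    then have Bd: "block d = {d, - d}" using gen block_self[OF dS] True by blast
    have on_support: "axis_coeff k l = ((if l = k then 1 else 0) + (if l = - k then 1 else 0)) / 2" if k: "d dvd k" for k l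
    proof (cases "k = 0")
      case True then show ?thesis using axis_coeff_zero by simp
    next
      case nz: False
      have kS: "k \<in> support" using k d(2) by simp
      obtain m where m: "k = m * d" using k by (metis dvdE mult.commute)
      then have sub: "block k \<subseteq> {k, - k}" using support_mult(2)[OF dS, of m] nz Bd by auto
      \<comment> \<open>Since \<open>d = k + (1 - m) * d\<close>, a one-point \<open>block k\<close>
        would, through the proportionality in \<open>support_add\<close>, leave only one point for
        \<open>block d\<close>.\<close>
      have "- k \<in> block k"
      proof (rule ccontr)
        assume "- k \<notin> block k"
        then have Bk: "block k = {k}" using sub block_self[OF kS] by blast
        have l: "(1 - m) * d \<in> support" using d(2) by simp
        have sum: "k + (1 - m) * d = d" by (simp add: m algebra_simps)
        have "block d \<subseteq> {k1 + l1 | k1 l1. k1 \<in> block k \<and> l1 \<in> block ((1 - m) * d) \<and> l1 * k = k1 * ((1 - m) * d)}"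
          using support_add(2)[OF kS l] d(1) unfolding sum by simp
        also have "\<dots> \<subseteq> {d}" using nz sum by (auto simp: Bk mult.commute)
        finally show False using Bd d(1) by auto
      qed
      then have "block k = {k, - k}" using sub block_self[OF kS] by blast
      then have "of_nat (card {k, - k}) * axis_coeff k k = 1" "axis_coeff k l = axis_coeff k k * indic {k, - k} l"
        using card_block[OF kS] axis_coeff_eq[of k l] by simp_all
      moreover have "k \<noteq> - k" using nz by simp
      ultimately show ?thesis by (auto simp: indic_def field_simps)
    qed
    have "axis_coeff k l = (if d dvd k then ((if l = k then 1 else 0) + (if l = - k then 1 else 0)) / 2 else 0)" for k l
      by (cases "d dvd k") (simp_all add: on_support off_support)
    then show ?thesis using d(1) by blast
  qed
qed

section \<open>From lines to arbitrary integer vectors\<close>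

definition divisible :: "int \<Rightarrow> int^'n \<Rightarrow> bool" where "divisible d v \<longleftrightarrow> (\<forall>i. d dvd v $ i)"

lemma vector_line:
  obtains k u where "u \<in> orb" "v = k *s u" "\<And>d. divisible d v \<longleftrightarrow> d dvd k"
proof -
  obtain k A where kA: "v = k *s act A (axis p 1)" using vector_orbit by blast
  have "divisible d v \<longleftrightarrow> d dvd k" for d
    unfolding divisible_def kA act_linear(5)[symmetric] dvd_act_iff
    by (auto simp: axis_component dest: spec[of _ p])
  then show ?thesis using that[of "act A (axis p 1)" k] kA by (auto simp: orb_def)
qed

lemma proj_line_eqI:
  assumes u: "u \<in> orb" and "\<And>l. axis_coeff k l = apply_ell2 f (l *s u, sl_one)"
    and "\<And>x. (\<And>l. x \<noteq> (l *s u, sl_one)) \<Longrightarrow> apply_ell2 f x = 0"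
  shows "proj (delta (k *s u, sl_one)) = f"
proof (rule ell2_eqI)
  fix x
  show "apply_ell2 (proj (delta (k *s u, sl_one))) x = apply_ell2 f x"
  proof (cases "\<exists>l. x = (l *s u, sl_one)")
    case True
    then show ?thesis using assms(2) coeff_orb[OF u] by (auto simp: coeff_def)
  next
    case False
    then have "coeff (k *s u, sl_one) x = 0" using line_support[OF u] by metis
    then show ?thesis using False assms(3)[of x] by (simp add: coeff_def)
  qed
qed

theorem translation_trichotomy:
  "(\<forall>v. v \<noteq> 0 \<longrightarrow> proj (delta (v, sl_one)) = 0) \<or>
   (\<exists>d\<ge>1. \<forall>v. proj (delta (v, sl_one)) = (if divisible d v then delta (v, sl_one) else 0)) \<or>
   (\<exists>d\<ge>1. \<forall>v. proj (delta (v, sl_one)) =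
      (if divisible d v then cscale (1 / 2) (delta (v, sl_one) + delta (- v, sl_one)) else 0))"
proof -
  have line: "(l *s u, id1) = (k *s u, sl_one) \<longleftrightarrow> l = k" "(l *s u, id1) = (- (k *s u), sl_one) \<longleftrightarrow> l = - k"
    if "u \<in> orb" for l k u
  proof -
    have "l *s u = m *s u \<longleftrightarrow> l = m" for m by (rule smult_cancel[OF orb_nonzero[OF that]])
    from this[of k] this[of "- k"] show "(l *s u, id1) = (k *s u, sl_one) \<longleftrightarrow> l = k"
      "(l *s u, id1) = (- (k *s u), sl_one) \<longleftrightarrow> l = - k" by simp_all
  qed
  consider "\<forall>k l. k \<noteq> 0 \<longrightarrow> axis_coeff k l = 0"
    | d where "d \<ge> 1" "\<forall>k l. axis_coeff k l = (if d dvd k \<and> l = k then 1 else 0)"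
    | d where "d \<ge> 1" "\<forall>k l. axis_coeff k l = (if d dvd k then ((if l = k then 1 else 0) + (if l = - k then 1 else 0)) / 2 else 0)"
    using axis_coeff_trichotomy by blast
  then show ?thesis
  proof cases
    case 1
    have "proj (delta (v, sl_one)) = 0" if "v \<noteq> 0" for v
    proof -
      obtain k u where ku: "u \<in> orb" "v = k *s u" using vector_line by blast
      have "k \<noteq> 0" using that ku by auto
      then show ?thesis unfolding ku(2) using 1 by (intro proj_line_eqI[OF ku(1)]) auto
    qed
    then show ?thesis by blast
  next
    case 2
    have "proj (delta (v, sl_one)) = (if divisible d v then delta (v, sl_one) else 0)" for v
    proof -
      obtain k u where ku: "u \<in> orb" "v = k *s u" "divisible d v \<longleftrightarrow> d dvd k" using vector_line by blast
      show ?thesis unfolding ku(3) unfolding ku(2) using 2(2) line[OF ku(1)]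
        by (intro proj_line_eqI[OF ku(1)]) auto
    qed
    then show ?thesis using 2(1) by blast
  next
    case 3
    have "proj (delta (v, sl_one)) =
      (if divisible d v then cscale (1 / 2) (delta (v, sl_one) + delta (- v, sl_one)) else 0)" for v
    proof -
      obtain k u where ku: "u \<in> orb" "v = k *s u" "divisible d v \<longleftrightarrow> d dvd k" using vector_line by blast
      have neg: "x \<noteq> (- (k *s u), id1)" if "\<And>l. x \<noteq> (l *s u, sl_one)" for x
        using that[of "- k"] by simp
      show ?thesis unfolding ku(3) unfolding ku(2) using 3(2) line[OF ku(1)] neg
        by (intro proj_line_eqI[OF ku(1)]) auto
    qed
    then show ?thesis using 3(1) by blast
  qed
qed

end

section \<open>The classification of invariant spaces\<close>

lemma (in full_group) mult_inv_eq_iff: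
  "x \<otimes> inv b = s \<longleftrightarrow> b = inv s \<otimes> x" "x \<otimes> inv b = s \<longleftrightarrow> x = s \<otimes> b"
proof -
  show "x \<otimes> inv b = s \<longleftrightarrow> x = s \<otimes> b" by auto
  show "x \<otimes> inv b = s \<longleftrightarrow> b = inv s \<otimes> x"
    by (auto simp: inv_mult_group m_assoc)
qed

lemma (in full_group) conj_mult_inv_eq_iff:
  "inv g \<otimes> (x \<otimes> inv b) \<otimes> g = s \<longleftrightarrow> b = g \<otimes> inv s \<otimes> inv g \<otimes> x"
proof
  assume s: "inv g \<otimes> (x \<otimes> inv b) \<otimes> g = s"
  have "x \<otimes> inv b = g \<otimes> s \<otimes> inv g" by (simp add: s[symmetric] m_assoc)
  then have "b = inv (g \<otimes> s \<otimes> inv g) \<otimes> x" by (simp only: mult_inv_eq_iff(1))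
  then show "b = g \<otimes> inv s \<otimes> inv g \<otimes> x" by (simp add: inv_mult_group m_assoc)
qed (simp add: inv_mult_group m_assoc)

lemma ell2_compose_inj:
  assumes "inj \<phi>"
  obtains f where "\<And>x. apply_ell2 f x = apply_ell2 h (\<phi> x)" "norm f \<le> norm h"
proof -
  have "(\<Sum>x\<in>F. (cmod (apply_ell2 h (\<phi> x)))\<^sup>2) \<le> (norm h)\<^sup>2" if "finite F" for F
  proof -
    have "(\<Sum>x\<in>F. (cmod (apply_ell2 h (\<phi> x)))\<^sup>2) = (\<Sum>y\<in>\<phi> ` F. (cmod (apply_ell2 h y))\<^sup>2)"
      using inj_on_subset[OF assms] by (simp add: sum.reindex)
    then show ?thesis using finite_sum_le_norm_ell2[of "\<phi> ` F" h] that by simp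
  qed
  then show ?thesis using bounded_sums_ell2[of "\<lambda>x. apply_ell2 h (\<phi> x)" "norm h"] that by (metis norm_ge_zero)
qed

lemma ell2_cnj: obtains f where "\<And>x. apply_ell2 f x = cnj (apply_ell2 h x)"
proof -
  have "apply_ell2 (Abs_ell2 (\<lambda>x. cnj (apply_ell2 h x))) x = cnj (apply_ell2 h x)" for x
    by (subst Abs_ell2_inverse) (auto simp: ell2_summable)
  then show ?thesis using that by blast
qed

lemma has_sum_delta_pair:
  assumes "\<And>b. \<phi> b = s \<longleftrightarrow> b = s'" "\<And>b. \<phi> b = t \<longleftrightarrow> b = t'"
  shows "((\<lambda>b. apply_ell2 (delta s + delta t) (\<phi> b) * F b) has_sum (F s' + F t')) UNIV"
proof -
  have single: "((\<lambda>b. (if b = c then 1 else 0) * F b) has_sum F c) UNIV" for c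
    by (rule has_sum_finite_neutralI[where B = "{c}"]) auto
  have "((\<lambda>b. (if b = s' then 1 else 0) * F b + (if b = t' then 1 else 0) * F b) has_sum (F s' + F t')) UNIV"
    by (intro has_sum_add single)
  then show ?thesis by (simp add: assms distrib_right)
qed

text \<open>Decay along arithmetic progressions is the trace of square summability used below; it
  passes to differences of translates and excludes nonzero periodic functions.\<close>

definition vanishing :: "(int^'n::finite \<Rightarrow> complex) \<Rightarrow> bool"
  where "vanishing \<phi> \<longleftrightarrow> (\<forall>y c. c \<noteq> 0 \<longrightarrow> (\<lambda>t :: nat. \<phi> (y + int t *s c)) \<longlonglongrightarrow> 0)"

lemma vanishing_periodic:
  assumes v: "vanishing \<phi>" and c: "c \<noteq> 0" and per: "\<And>y. \<phi> (y + c) = \<phi> y"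
  shows "\<phi> y = 0"
proof -
  have "\<phi> (y + int t *s c) = \<phi> y" for t
  proof (induction t)
    case (Suc t)
    have "y + int (Suc t) *s c = (y + int t *s c) + c" by (simp add: vec_eq_iff algebra_simps)
    then show ?case using per[of "y + int t *s c"] Suc by metis
  qed simp
  moreover have "(\<lambda>t. \<phi> (y + int t *s c)) \<longlonglongrightarrow> 0" using v c by (simp add: vanishing_def)
  ultimately show ?thesis by (simp add: LIMSEQ_const_iff)
qed

text \<open>The convolution by \<open>\<delta>\<^sub>b + \<delta>\<^bsub>-b\<^esub> - \<delta>\<^sub>a - \<delta>\<^bsub>-a\<^esub>\<close> is injective since that element factors, up to a
  translation, as \<open>(\<delta>\<^bsub>a+b\<^esub> - 1) (\<delta>\<^bsub>b-a\<^esub> - 1)\<close>.\<close>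

lemma vanishing_symmetric_difference:
  fixes a b :: "int^'n::finite"
  assumes v: "vanishing \<phi>" and ab: "a \<noteq> b" "a \<noteq> - b"
    and eq: "\<And>y. \<phi> (y - b) + \<phi> (y + b) = \<phi> (y - a) + \<phi> (y + a)"
  shows "\<phi> y = 0"
proof -
  define \<psi> where "\<psi> y = \<phi> (y + b) - \<phi> (y + a)" for y
  have "vanishing \<psi>"
    unfolding vanishing_def
  proof (intro allI impI)
    fix y c :: "int^'n" assume c: "c \<noteq> 0"
    have "(\<lambda>t. \<phi> ((y + b) + int t *s c) - \<phi> ((y + a) + int t *s c)) \<longlonglongrightarrow> 0 - 0"
      using v c unfolding vanishing_def by (intro tendsto_diff) blast+
    then show "(\<lambda>t. \<psi> (y + int t *s c)) \<longlonglongrightarrow> 0" by (simp add: \<psi>_def algebra_simps)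
  qed
  moreover have "a + b \<noteq> 0" using ab(2) by (simp add: eq_neg_iff_add_eq_0)
  moreover have "\<psi> (y + (a + b)) = \<psi> y" for y
    using eq[of "y + (a + b)"] by (simp add: \<psi>_def algebra_simps)
  ultimately have "\<psi> y = 0" for y by (rule vanishing_periodic)
  then have "\<phi> (y + (b - a)) = \<phi> y" for y
    using \<open>\<And>y. \<psi> y = 0\<close>[of "y - a"] by (simp add: \<psi>_def algebra_simps)
  moreover have "b - a \<noteq> 0" using ab(1) by simp
  ultimately show ?thesis using vanishing_periodic[OF v] by blast
qed

section \<open>Elements with a nontrivial matrix part\<close>

context affine_space
begin

lemma vanishing_coeff: "vanishing (\<lambda>y. coeff g (y, B'))"
  unfolding vanishing_def
proof (intro allI impI)
  fix y c :: "int^'n" assume c: "c \<noteq> 0"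
  show "(\<lambda>t :: nat. coeff g (y + int t *s c, B')) \<longlonglongrightarrow> 0"
    unfolding coeff_def
  proof (rule ell2_tendsto_0)
    fix x :: "'n affine"
    show "\<forall>\<^sub>F t in sequentially. (y + int t *s c, B') \<noteq> x"
    proof (cases "\<exists>t0. (y + int t0 *s c, B') = x")
      case True
      then obtain t0 where t0: "(y + int t0 *s c, B') = x" by blast
      have "(y + int t *s c, B') \<noteq> x" if "t > t0" for t
      proof
        assume "(y + int t *s c, B') = x"
        then have "int t *s c = int t0 *s c" using t0 by auto
        then show False using smult_cancel[OF c] that by simp
      qed
      then show ?thesis unfolding eventually_sequentially by (intro exI[of _ "Suc t0"]) auto
    qed auto
  qed
qed

lemma divisible_simps: "divisible d (d *s w)" "divisible d w \<Longrightarrow> divisible d (- w)"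
  by (simp_all add: divisible_def)

text \<open>Commuting \<open>\<xi>\<^sub>g\<close> past the sum of \<open>u_w\<close> and its
  inverse equates the sums of coefficients at \<open>y\<close> shifted by plus and minus
  \<open>act A w\<close> with those shifted by plus and minus \<open>act B' w\<close>; decay then
  forces zero. For \<open>B' = - A\<close> this says nothing. There, right multiplication of the
  same even element, with \<open>w = z - act A z\<close>, by \<open>\<xi>\<^sub>g\<close> is the sum
  of the conjugates of \<open>\<xi>\<^sub>g\<close> by the translations \<open>z\<close> and
  \<open>- z\<close>, which gives a second relation.\<close>

lemma coeff_support:
  assumes d: "d \<ge> 1" and sym: "\<And>w. divisible d w \<Longrightarrow> delta (w, sl_one) + delta (- w, sl_one) \<in> K"
    and AB: "B' \<noteq> A"
  shows "coeff (v, A) (y, B') = 0"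
proof (cases "\<forall>z. act B' z = - act A z")
  case False
  obtain w0 where w0: "act A w0 \<noteq> act B' w0" "act A w0 \<noteq> - act B' w0"
    using separating_vector[OF AB[symmetric]] False by blast
  \<comment> \<open>Multiplication by \<open>d\<close> brings the separating vector into the lattice
    where \<open>sym\<close> applies.\<close>
  define w where "w = d *s w0"
  have w: "act A w \<noteq> act B' w" "act A w \<noteq> - act B' w"
  proof -
    have d0: "d *s a = d *s b \<longleftrightarrow> a = b" for a b :: "int^'n" using d by (auto simp: vec_eq_iff)
    show "act A w \<noteq> act B' w" using w0(1) d0 by (simp add: w_def)
    have "- (d *s act B' w0) = d *s (- act B' w0)" by (simp add: vec_eq_iff)
    then show "act A w \<noteq> - act B' w" using w0(2) d0[of "act A w0" "- act B' w0"] by (simp add: w_def)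
  qed
  have f: "delta (w, id1) + delta (- w, sl_one) \<in> K" by (rule sym) (simp add: w_def divisible_simps)
  show ?thesis
  proof (rule vanishing_symmetric_difference[OF vanishing_coeff w])
    fix y
    have "((\<lambda>b. apply_ell2 (delta (w, id1) + delta (- w, sl_one)) (id b) *
        coeff (v, A) ((y, B') \<star> inva b)) has_sum
        (coeff (v, A) ((y, B') \<star> inva (w, sl_one)) +
         coeff (v, A) ((y, B') \<star> inva (- w, sl_one)))) UNIV"
      by (rule has_sum_delta_pair) auto
    then have l: "(\<Sum>\<^sub>\<infinity>b. coeff (v, A) ((y, B') \<star> inva b) *
        apply_ell2 (delta (w, id1) + delta (- w, sl_one)) b) = coeff (v, A) (y - act B' w, B') + coeff (v, A) (y + act B' w, B')"
      by (simp add: infsumI mult.commute)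
    define \<phi> where "\<phi> b = inva (v, A) \<star> ((y, B') \<star> inva b) \<star> (v, A)" for b
    have \<phi>: "\<phi> b = (s, id1) \<longleftrightarrow> b = (y - act A s, B')" for b s
      unfolding \<phi>_def affine.conj_mult_inv_eq_iff by (simp add: sl_mult_assoc algebra_simps)
    have "((\<lambda>b. apply_ell2 (delta (w, id1) + delta (- w, sl_one)) (\<phi> b) * coeff (v, A) b) has_sum
        (coeff (v, A) (y - act A w, B') + coeff (v, A) (y - act A (- w), B'))) UNIV"
      by (rule has_sum_delta_pair) (rule \<phi>)+
    then have r: "(\<Sum>\<^sub>\<infinity>b. apply_ell2 (delta (w, id1) + delta (- w, sl_one)) (\<phi> b) * coeff (v, A) b) =
        coeff (v, A) (y - act A w, B') + coeff (v, A) (y + act A w, B')"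
      by (simp add: infsumI)
    show "coeff (v, A) (y - act B' w, B') + coeff (v, A) (y + act B' w, B') =
        coeff (v, A) (y - act A w, B') + coeff (v, A) (y + act A w, B')"
      using coeff_central[OF f, of "(v, A)" "(y, B')"] unfolding l r \<phi>_def[symmetric] .
  qed
next
  case True
  define z :: "int^'n" where "z = d *s axis p 1"
  have z0: "z \<noteq> 0" using d by (auto simp: z_def vec_eq_iff axis_component)
  define w where "w = z - act A z"
  have "w = d *s (axis p 1 - act A (axis p 1))" by (simp add: w_def z_def vec_eq_iff algebra_simps)
  then have "divisible d w" using divisible_simps(1) by metis
  then have f: "delta (w, id1) + delta (- w, sl_one) \<in> K" by (rule sym)
  \<comment> \<open>On the coset of \<open>B' = - A\<close>, conjugation by \<open>z\<close> shifts
    by \<open>z + act A z\<close>, which is neither \<open>w\<close> nor \<open>- w\<close>.\<close>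
  have ne: "w \<noteq> z - act B' z" "w \<noteq> - (z - act B' z)"
  proof -
    have B': "act B' z $ i = - act A z $ i" for i using True by simp
    have "act A z \<noteq> 0" using z0 by (metis act_eq_iff act_linear(4))
    then obtain i where "act A z $ i \<noteq> 0" by (auto simp: vec_eq_iff)
    then have "w $ i \<noteq> (z - act B' z) $ i" by (simp add: w_def B')
    then show "w \<noteq> z - act B' z" by metis
    obtain j where "z $ j \<noteq> 0" using z0 by (auto simp: vec_eq_iff)
    then have "w $ j \<noteq> (- (z - act B' z)) $ j" by (simp add: w_def B')
    then show "w \<noteq> - (z - act B' z)" by metis
  qed
  show ?thesis
  proof (rule vanishing_symmetric_difference[OF vanishing_coeff ne])
    fix y
    have "right_translate affine_sl (v, A) (delta (w, id1) + delta (- w, sl_one)) = delta (w + v, A) + delta (- w + v, A)"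
    proof (rule ell2_eqI)
      fix x :: "'n affine"
      have "x \<star> inva (v, A) = (s, id1) \<longleftrightarrow> x = (s + v, A)" for s
        unfolding affine.mult_inv_eq_iff(2) by simp
      then show "apply_ell2 (right_translate affine_sl (v, A) (delta (w, id1) + delta (- w, sl_one))) x =
          apply_ell2 (delta (w + v, A) + delta (- w + v, A)) x"
        by (simp only: affine.apply_right_translate apply_ell2_simps)
    qed
    then have "apply_ell2 (proj (right_translate affine_sl (v, A) (delta (w, id1) + delta (- w, sl_one)))) (y, B') =
        coeff (w + v, A) (y, B') + coeff (- w + v, A) (y, B')"
      by (simp add: linear_simps(1)[OF proj_linear] coeff_def)
    moreover have "coeff (w + v, A) (y, B') = coeff (v, A) (y - (z - act B' z), B')"
      using coeff_shift[of v z A "y - (z - act B' z)" B'] by (simp add: w_def algebra_simps)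
    moreover have "coeff (- w + v, A) (y, B') = coeff (v, A) (y + (z - act B' z), B')"
      using coeff_shift[of v "- z" A "y + (z - act B' z)" B'] by (simp add: w_def algebra_simps)
    moreover have "((\<lambda>b. apply_ell2 (delta (w, id1) + delta (- w, sl_one)) ((y, B') \<star> inva b) * coeff (v, A) b) has_sum
        (coeff (v, A) (y - w, B') + coeff (v, A) (y - (- w), B'))) UNIV"
    proof (rule has_sum_delta_pair)
      have eq: "(y, B') \<star> inva b = (s, id1) \<longleftrightarrow> b = (y - s, B')" for b s
        unfolding affine.mult_inv_eq_iff(1) by simp
      show "(y, B') \<star> inva b = (w, id1) \<longleftrightarrow> b = (y - w, B')" for b by (rule eq)
      show "(y, B') \<star> inva b = (- w, id1) \<longleftrightarrow> b = (y - (- w), B')" for b by (rule eq)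
    qed
    ultimately show "coeff (v, A) (y - (z - act B' z), B') + coeff (v, A) (y + (z - act B' z), B') =
        coeff (v, A) (y - w, B') + coeff (v, A) (y + w, B')"
      using right_convolution_proj[OF f, of "(v, A)" "(y, B')"] by (simp add: infsumI)
  qed
qed

text \<open>The Fourier coefficients at translations of \<open>E(u\<^bsub>zg\<^esub>) E(u\<^sub>g)\<^sup>*\<close>, where \<open>zg\<close> is the conjugate of
  \<open>g\<close> by the translation \<open>z\<close>.\<close>

lemma pairing:
  obtains f where "f \<in> K" "\<And>u. apply_ell2 f (u, sl_one) =
    (\<Sum>\<^sub>\<infinity>b. coeff (v, A) (u + fst b - z + act (snd b) z, snd b) * cnj (coeff (v, A) b))"
proof -
  define g where "g = (v + z - act A z, A)"
  obtain f where f: "f \<in> K" "\<And>y. apply_ell2 f y = (\<Sum>\<^sub>\<infinity>b. coeff g (y \<star> inva b) *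
      apply_ell2 (proj (delta (inva (v, A)))) b)"
    using left_convolution_mem[OF proj_mem] by blast
  have "apply_ell2 f (u, sl_one) =
    (\<Sum>\<^sub>\<infinity>b. coeff (v, A) (u + fst b - z + act (snd b) z, snd b) * cnj (coeff (v, A) b))" for u
  proof -
    have "apply_ell2 f (u, sl_one) = (\<Sum>\<^sub>\<infinity>b. coeff g ((u, sl_one) \<star> inva (inva b)) *
        coeff (inva (v, A)) (inva b))"
      unfolding f(2) coeff_def[of "inva (v, A)"]
      by (rule infsum_reindex_bij_betw[OF affine.bij_inv, symmetric])
    also have "\<dots> = (\<Sum>\<^sub>\<infinity>b. coeff (v, A) (u + fst b - z + act (snd b) z, snd b) * cnj (coeff (v, A) b))"
    proof (rule infsum_cong)
      fix b :: "'n affine"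
      obtain y B' where b: "b = (y, B')" by fastforce
      have "coeff g ((u, sl_one) \<star> inva (inva b)) = coeff (v, A) (u + y - z + act B' z, B')"
        using coeff_shift[of v z A "u + y - z + act B' z" B'] by (simp add: g_def b algebra_simps)
      then show "coeff g ((u, sl_one) \<star> inva (inva b)) *
          coeff (inva (v, A)) (inva b) =
          coeff (v, A) (u + fst b - z + act (snd b) z, snd b) * cnj (coeff (v, A) b)"
        unfolding coeff_inv by (simp add: b)
    qed
    finally show ?thesis .
  qed
  then show ?thesis using that f(1) by blast
qed

text \<open>\<open>\<Phi>\<close> collects the translation coefficients of
  \<open>\<xi>\<^sub>g\<close> times its adjoint. It is even, and so is its translate by
  \<open>w\<close>, which comes from the conjugate by \<open>z\<close>. Two centres of symmetry make
  it periodic, so square summability forces the value at 0, the squared norm of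
  \<open>\<xi>\<^sub>g\<close>, to vanish.\<close>

lemma symmetric_case:
  assumes d: "d \<ge> 1" and proj: "\<And>v. proj (delta (v, sl_one)) =
      (if divisible d v then cscale (1 / 2) (delta (v, sl_one) + delta (- v, sl_one)) else 0)"
    and A: "A \<noteq> sl_one"
  shows "proj (delta (v, A)) = 0"
proof (rule coeff_self_0D)
  have sym: "delta (w, sl_one) + delta (- w, sl_one) \<in> K" if "divisible d w" for w
  proof -
    have "cscale 2 (proj (delta (w, sl_one))) = delta (w, sl_one) + delta (- w, sl_one)"
      using that by (intro ell2_eqI) (simp add: proj)
    then show ?thesis using cscale_K[OF proj_mem] by metis
  qed
  have even: "apply_ell2 f (- u, sl_one) = apply_ell2 f (u, sl_one)" if "f \<in> K" for f u
  proof -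
    have "divisible d (- u) \<longleftrightarrow> divisible d u" by (simp add: divisible_def)
    then have "proj (delta (- u, sl_one)) = proj (delta (u, sl_one))" by (simp add: proj add.commute)
    then show ?thesis using apply_mem[OF that] by metis
  qed
  obtain z where z: "act A z \<noteq> z" using A by (metis act_sl_one sl_eqI)
  define w where "w = z - act A z"
  have w0: "w \<noteq> 0" using z by (auto simp: w_def)
  define \<Phi> where "\<Phi> u = (\<Sum>\<^sub>\<infinity>b. coeff (v, A) (u + fst b, snd b) * cnj (coeff (v, A) b))" for u
  obtain f0 where f0: "f0 \<in> K" "\<And>u. apply_ell2 f0 (u, sl_one) =
      (\<Sum>\<^sub>\<infinity>b. coeff (v, A) (u + fst b - 0 + act (snd b) 0, snd b) * cnj (coeff (v, A) b))"
    using pairing by blast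
  then have \<Phi>0: "apply_ell2 f0 (u, sl_one) = \<Phi> u" for u by (simp add: \<Phi>_def)
  obtain f1 where f1: "f1 \<in> K" "\<And>u. apply_ell2 f1 (u, sl_one) =
      (\<Sum>\<^sub>\<infinity>b. coeff (v, A) (u + fst b - z + act (snd b) z, snd b) * cnj (coeff (v, A) b))"
    using pairing by blast
  \<comment> \<open>By \<open>coeff_support\<close> only the coset of \<open>A\<close> contributes,
    so the shift, which depends on the matrix of \<open>b\<close>, is the constant
    \<open>- w\<close>.\<close>
  have \<Phi>1: "apply_ell2 f1 (u, sl_one) = \<Phi> (u - w)" for u
    unfolding f1(2) \<Phi>_def
  proof (rule infsum_cong)
    fix b :: "'n affine"
    obtain y B' where b: "b = (y, B')" by fastforce
    show "coeff (v, A) (u + fst b - z + act (snd b) z, snd b) * cnj (coeff (v, A) b) =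
        coeff (v, A) (u - w + fst b, snd b) * cnj (coeff (v, A) b)"
    proof (cases "B' = A")
      case True then show ?thesis by (simp add: b w_def algebra_simps)
    next
      case False then show ?thesis using coeff_support[OF d sym False] by (simp add: b)
    qed
  qed
  have shift: "\<Phi> (u + w) = \<Phi> (u - w)" for u
  proof -
    have "\<Phi> (u + w) = \<Phi> (- u - w)" using even[OF f0(1), of "u + w"] unfolding \<Phi>0 by (simp add: algebra_simps)
    also have "\<dots> = \<Phi> (u - w)" using even[OF f1(1), of u] unfolding \<Phi>1 .
    finally show ?thesis .
  qed
  have per: "\<Phi> (u + 2 *s w) = \<Phi> u" for u
  proof -
    have eq: "u + 2 *s w = (u + w) + w" by (simp add: vec_eq_iff algebra_simps)
    show ?thesis unfolding eq using shift[of "u + w"] by (simp only: add_diff_cancel_right')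
  qed
  have "\<Phi> (int t *s (2 *s w)) = \<Phi> 0" for t
  proof (induction t)
    case (Suc t)
    have "int (Suc t) *s (2 *s w) = int t *s (2 *s w) + 2 *s w" by (simp add: vec_eq_iff algebra_simps)
    then show ?case using per[of "int t *s (2 *s w)"] Suc by metis
  qed simp
  moreover have "inj (\<lambda>t :: nat. (int t *s (2 *s w), id1))"
  proof (rule injI)
    fix s t :: nat assume "(int s *s (2 *s w), id1) = (int t *s (2 *s w), id1)"
    moreover have "2 *s w \<noteq> 0" using w0 by (auto simp: vec_eq_iff)
    ultimately show "s = t" using smult_cancel[of "2 *s w" "int s" "int t"] by simp
  qed
  ultimately have "\<Phi> 0 = 0"
    using ell2_inj_seq_eq_0[of "\<lambda>t. (int t *s (2 *s w), id1)" f0 "\<Phi> 0"] by (simp add: \<Phi>0)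
  moreover have "\<Phi> 0 = coeff (v, A) (v, A)"
    unfolding coeff_cinner cinner.rep_eq by (simp add: \<Phi>_def coeff_def)
  ultimately show "coeff (v, A) (v, A) = 0" by simp
qed

text \<open>The pairing of \<open>\<xi>\<^sub>g\<close> with its conjugate by \<open>z\<close> is
  the coefficient of a vector in \<open>K\<close> at the nonzero translation
  \<open>z - act A z\<close>, hence zero. For increasingly generic \<open>z\<close> the part over
  \<open>A\<close> stays in place while every other coefficient tends to 0, so the weak limit is the
  part of \<open>\<xi>\<^sub>g\<close> over \<open>A\<close>, and its norm is zero.\<close>

lemma trivial_case:
  assumes triv: "\<And>v. v \<noteq> 0 \<Longrightarrow> proj (delta (v, sl_one)) = 0" and A: "A \<noteq> sl_one"
  shows "proj (delta (v, A)) = 0"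
proof (rule coeff_self_0D)
  define \<xi> where "\<xi> = proj (delta (v, A))"
  define \<phi> where "\<phi> z b = (fst b + act (snd b) z - act A z, snd b)" for z and b :: "'n affine"
  have inj: "inj (\<phi> z)" for z by (auto simp: inj_def \<phi>_def)
  \<comment> \<open>One translation for each finite set turns genericity into convergence along
    \<open>finite_subsets_at_top\<close>.\<close>
  have "\<forall>F. finite F \<longrightarrow> (\<exists>z. act A z \<noteq> z \<and> (\<forall>(y, B')\<in>F. B' \<noteq> A \<longrightarrow> (y + act B' z - act A z, B') \<notin> F))"
    using generic_translation[OF A] by blast
  then obtain z where z: "\<And>F. finite F \<Longrightarrow> act A (z F) \<noteq> z F"
      "\<And>F y B'. finite F \<Longrightarrow> (y, B') \<in> F \<Longrightarrow> B' \<noteq> A \<Longrightarrow> (y + act B' (z F) - act A (z F), B') \<notin> F"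
    by (metis (mono_tags, lifting) case_prodD)
  have "\<forall>F. \<exists>f. (\<forall>b. apply_ell2 f b = apply_ell2 \<xi> (\<phi> (z F) b)) \<and> norm f \<le> norm \<xi>"
    using ell2_compose_inj[OF inj] by metis
  then obtain f where f: "\<And>F b. apply_ell2 (f F) b = apply_ell2 \<xi> (\<phi> (z F) b)" "\<And>F. norm (f F) \<le> norm \<xi>"
    by metis
  obtain l where l: "\<And>b. apply_ell2 l b = (if snd b = A then apply_ell2 \<xi> b else 0)"
    using ell2_restrict[of "\<lambda>b. snd b = A" \<xi>] by blast
  have "cinner (f F) \<xi> = 0" if F: "finite F" for F
  proof -
    obtain h where h: "h \<in> K" "\<And>u. apply_ell2 h (u, sl_one) =
      (\<Sum>\<^sub>\<infinity>b. coeff (v, A) (u + fst b - z F + act (snd b) (z F), snd b) * cnj (coeff (v, A) b))"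
      using pairing by blast
    have "z F - act A (z F) \<noteq> 0" using z(1)[OF F] by auto
    then have "apply_ell2 h (z F - act A (z F), sl_one) = 0"
      using apply_mem[OF h(1)] triv by simp
    then show ?thesis
      unfolding h(2) cinner.rep_eq f(1) by (simp add: \<phi>_def \<xi>_def coeff_def algebra_simps)
  qed
  then have "\<forall>\<^sub>F F in finite_subsets_at_top UNIV. cinner (f F) \<xi> = 0"
    by (intro eventually_finite_subsets_at_top_weakI) auto
  then have zero: "((\<lambda>F. cinner (f F) \<xi>) \<longlongrightarrow> 0) (finite_subsets_at_top UNIV)"
    by (rule tendsto_eventually)
  have "((\<lambda>F. cinner (f F) \<xi>) \<longlongrightarrow> cinner l \<xi>) (finite_subsets_at_top UNIV)"
  proof (rule weak_tendsto[OF f(2)])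
    fix b :: "'n affine"
    obtain y B' where b: "b = (y, B')" by fastforce
    show "((\<lambda>F. apply_ell2 (f F) b) \<longlongrightarrow> apply_ell2 l b) (finite_subsets_at_top UNIV)"
    proof (cases "B' = A")
      case True then show ?thesis by (simp add: f(1) l b \<phi>_def)
    next
      case False
      have "((\<lambda>F. apply_ell2 \<xi> (\<phi> (z F) b)) \<longlongrightarrow> 0) (finite_subsets_at_top UNIV)"
      proof (rule ell2_tendsto_0)
        fix x :: "'n affine"
        show "\<forall>\<^sub>F F in finite_subsets_at_top UNIV. \<phi> (z F) b \<noteq> x"
          unfolding eventually_finite_subsets_at_top
        proof (intro exI[of _ "{b, x}"] conjI allI impI)
          fix F assume F: "finite F \<and> {b, x} \<subseteq> F \<and> F \<subseteq> UNIV"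
          then have "\<phi> (z F) b \<notin> F" using z(2)[of F y B'] False by (simp add: \<phi>_def b)
          then show "\<phi> (z F) b \<noteq> x" using F by auto
        qed auto
      qed
      then show ?thesis using False by (simp add: f(1) l b)
    qed
  qed
  then have "cinner l \<xi> = 0" using zero tendsto_unique finite_subsets_at_top_neq_bot by blast
  moreover have "cinner l \<xi> = cinner l l" unfolding cinner.rep_eq by (intro infsum_cong) (simp add: l)
  ultimately have "l = 0" by (simp add: cinner_self)
  then have "apply_ell2 \<xi> (v, A) = 0" using l[of "(v, A)"] by simp
  then show "coeff (v, A) (v, A) = 0" by (simp add: coeff_def \<xi>_def)
qed

text \<open>The scalar by which \<open>delta g\<close> is multiplied is the squared norm of the
  resulting vector, so it is real and equal to its own square.\<close>

lemma proj_delta_01: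
  assumes "\<And>x. x \<noteq> g \<Longrightarrow> coeff g x = 0"
  shows "proj (delta g) = 0 \<or> proj (delta g) = delta g"
proof -
  have eq: "proj (delta g) = cscale (coeff g g) (delta g)"
    using assms by (intro ell2_eqI) (auto simp: coeff_def)
  have "coeff g g = coeff g g * cnj (coeff g g)"
    by (subst coeff_cinner) (simp add: eq cinner_cscale_left cinner_cscale_right)
  moreover have "cnj (coeff g g) = coeff g g" by (metis coeff_commute)
  ultimately have "coeff g g = 0 \<or> coeff g g = 1" by (metis mult_cancel_right1)
  then show ?thesis using eq coeff_self_0D[of g] by (auto intro!: ell2_eqI)
qed

text \<open>Geometrically \<open>(v, A)\<close> is the reflection in the point \<open>v / 2\<close>
  and is centralised by the affine maps fixing that point. Transvections about it move the centre of
  the reflection \<open>(y, A)\<close> through infinitely many points.\<close>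

lemma minus_one_case:
  assumes minus: "\<And>v. act A v = - v" and y: "y \<noteq> v"
  shows "coeff (v, A) (y, A) = 0"
proof -
  define b where "b = y - v"
  have "b \<noteq> 0" using y by (simp add: b_def)
  then have b0: "dot b b \<noteq> 0" by (simp add: dot_self_eq_0)
  \<comment> \<open>A nonzero vector orthogonal to \<open>b\<close>: a quarter turn of the
    \<open>p\<close>, \<open>q\<close> part of \<open>b\<close>, or a unit vector if that part is
    zero.\<close>
  define a where "a = (if b $ p = 0 \<and> b $ q = 0 then axis p 1 else axis p (b $ q) - axis q (b $ p))"
  have ab: "dot b a = 0" by (simp add: a_def)
  have a0: "a \<noteq> 0"
    unfolding a_def using pq by (auto simp: vec_eq_iff axis_component split: if_splits)
  show ?thesis
  proof (rule ell2_inj_seq_eq_0)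
    show "inj (\<lambda>t :: nat. (y + int t *s ((2 * dot b b) *s a), A))"
    proof (rule injI)
      fix s t :: nat
      assume "(y + int s *s ((2 * dot b b) *s a), A) = (y + int t *s ((2 * dot b b) *s a), A)"
      moreover have "(2 * dot b b) *s a \<noteq> 0" using a0 b0 by (auto simp: vec_eq_iff)
      ultimately show "s = t" using smult_cancel[of "(2 * dot b b) *s a" "int s" "int t"] by simp
    qed
    fix t :: nat
    obtain k where k: "\<And>x. act k x = x + (2 * dot b x) *s (int t *s a)"
      using transvection[of b "int t *s a"] ab by (metis dot_simps(6) mult_zero_right)
    \<comment> \<open>Brings \<open>act k v\<close> back to \<open>v\<close>: conjugation by
      \<open>z\<close> adds \<open>2 *s z\<close>, since \<open>A\<close> is -1.\<close>
    define z where "z = (- (int t * dot b v)) *s a"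
    have conj: "sl_mult (sl_mult k A) (sl_inv k) = A"
      by (rule sl_eqI) (simp add: minus)
    have "coeff (act k v + z - act A z, A) (act k y + z - act A z, A) = coeff (v, A) (y, A)"
      using coeff_shift[of "act k v" z A "act k y" A] coeff_act[of k v A y A] by (simp add: conj)
    moreover have "act k v + z - act A z = v"
      by (simp add: k z_def minus vec_eq_iff algebra_simps)
    moreover have "act k y + z - act A z = y + int t *s ((2 * dot b b) *s a)"
    proof -
      have eq: "dot b y = dot b b + dot b v" by (simp add: b_def)
      show ?thesis by (simp add: k z_def minus vec_eq_iff eq algebra_simps)
    qed
    ultimately show "apply_ell2 (proj (delta (v, A))) (y + int t *s ((2 * dot b b) *s a), A) = coeff (v, A) (y, A)"
      by (simp add: coeff_def)
  qed
qed

text \<open>Writing \<open>\<xi>\<^sub>g\<close> as \<open>g\<close> times a function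
  \<open>\<eta>\<close> on translations, \<open>coeff_central\<close> for the conjugate of
  \<open>\<xi>\<^sub>g\<close> by \<open>k\<close> becomes the identity \<open>rel\<close> between
  bilinear sums. For generic \<open>k\<close> the left side tends to 0 and on the right only
  \<open>u = w\<close> survives, which leaves \<open>\<eta> 0 * \<eta> w = 0\<close>. As
  \<open>\<eta> 0\<close> is the squared norm of \<open>\<xi>\<^sub>g\<close>, its vanishing is
  enough too.\<close>

lemma non_scalar_case:
  assumes supp: "\<And>v A y B'. B' \<noteq> A \<Longrightarrow> coeff (v, A) (y, B') = 0"
    and A: "A \<noteq> sl_one" "\<not> (\<forall>v. act A v = - v)" and y: "y \<noteq> v"
  shows "coeff (v, A) (y, A) = 0"
proof -
  define \<eta> where "\<eta> w = coeff (v, A) (v + act A w, A)" for w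
  define w where "w = act (sl_inv A) (y - v)"
  have "act (sl_inv A) (y - v) \<noteq> act (sl_inv A) 0" using y by (subst act_eq_iff) simp
  then have w0: "w \<noteq> 0" by (simp add: w_def)
  have rel: "(\<Sum>\<^sub>\<infinity>u. \<eta> (act k (act A (act (sl_inv k) w - u))) * \<eta> u) = (\<Sum>\<^sub>\<infinity>u. \<eta> (act (sl_inv k) (w - u)) * \<eta> u)" for k
  proof -
    define C where "C = sl_mult (sl_mult k A) (sl_inv k)"
    \<comment> \<open>The product of \<open>(v, A)\<close>, its conjugate
      \<open>(act k v, C)\<close> and the translation \<open>w\<close>: the point at which both
      sides of \<open>coeff_central\<close> are read.\<close>
    define Y where "Y = (v + act A (act k v + act C w), sl_mult A C)"
    have kC: "coeff (act k v, C) (act k x, C) = coeff (v, A) (x, A)" for x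
      unfolding C_def by (rule coeff_act)
    have "(\<Sum>\<^sub>\<infinity>s. coeff (v, A) (Y \<star> inva s) * coeff (act k v, C) s) =
        (\<Sum>\<^sub>\<infinity>u. (\<lambda>s. coeff (v, A) (Y \<star> inva s) * coeff (act k v, C) s) (act k (v + act A u), C))"
    proof (rule infsum_inj_support)
      show "inj (\<lambda>u. (act k (v + act A u), C))" by (rule injI) (simp del: act_linear(1))
      fix s :: "'n affine" assume s: "s \<notin> range (\<lambda>u. (act k (v + act A u), C))"
      obtain x D where xD: "s = (x, D)" by fastforce
      have "D \<noteq> C"
      proof
        assume "D = C"
        then have "s = (act k (v + act A (act (sl_inv A) (act (sl_inv k) x - v))), C)" by (simp add: xD)
        then show False using s by blast
      qed
      then show "coeff (v, A) (Y \<star> inva s) * coeff (act k v, C) s = 0"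
        using supp xD by simp
    qed
    also have "\<dots> = (\<Sum>\<^sub>\<infinity>u. \<eta> (act k (act A (act (sl_inv k) w - u))) * \<eta> u)"
    proof (rule infsum_cong)
      fix u
      have "Y \<star> inva (act k (v + act A u), C) = (v + act A (act k (act A (act (sl_inv k) w - u))), A)"
        by (simp add: Y_def C_def sl_mult_assoc algebra_simps)
      then show "coeff (v, A) (Y \<star> inva (act k (v + act A u), C)) * coeff (act k v, C) (act k (v + act A u), C) =
          \<eta> (act k (act A (act (sl_inv k) w - u))) * \<eta> u"
        unfolding kC by (simp only: \<eta>_def)
    qed
    finally have l: "(\<Sum>\<^sub>\<infinity>s. coeff (v, A) (Y \<star> inva s) * coeff (act k v, C) s) =
        (\<Sum>\<^sub>\<infinity>u. \<eta> (act k (act A (act (sl_inv k) w - u))) * \<eta> u)" .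
    have "(\<Sum>\<^sub>\<infinity>s. coeff (act k v, C) (inva (v, A) \<star> (Y \<star> inva s) \<star> (v, A)) * coeff (v, A) s) =
        (\<Sum>\<^sub>\<infinity>u. (\<lambda>s. coeff (act k v, C) (inva (v, A) \<star> (Y \<star> inva s) \<star> (v, A)) * coeff (v, A) s) (v + act A u, A))"
    proof (rule infsum_inj_support)
      show "inj (\<lambda>u. (v + act A u, A))" by (rule injI) simp
      fix s :: "'n affine" assume s: "s \<notin> range (\<lambda>u. (v + act A u, A))"
      obtain x D where xD: "s = (x, D)" by fastforce
      have "D \<noteq> A"
      proof
        assume "D = A"
        then have "s = (v + act A (act (sl_inv A) (x - v)), A)" by (simp add: xD)
        then show False using s by blast
      qed
      then show "coeff (act k v, C) (inva (v, A) \<star> (Y \<star> inva s) \<star> (v, A)) * coeff (v, A) s = 0"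
        using supp xD by simp
    qed
    also have "\<dots> = (\<Sum>\<^sub>\<infinity>u. \<eta> (act (sl_inv k) (w - u)) * \<eta> u)"
    proof (rule infsum_cong)
      fix u
      have "inva (v, A) \<star> (Y \<star> inva (v + act A u, A)) \<star> (v, A) =
          (act k (v + act A (act (sl_inv k) (w - u))), C)"
        by (simp add: Y_def C_def sl_mult_assoc algebra_simps)
      then show "coeff (act k v, C) (inva (v, A) \<star> (Y \<star> inva (v + act A u, A)) \<star> (v, A)) * coeff (v, A) (v + act A u, A) =
          \<eta> (act (sl_inv k) (w - u)) * \<eta> u"
        by (simp only: kC \<eta>_def)
    qed
    finally show ?thesis
      using coeff_central[OF proj_mem, of "(v, A)" Y "delta (act k v, C)"] l by (simp add: coeff_def)
  qed
  have "inj (\<lambda>w. (v + act A w, A))" by (rule injI) simp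
  then obtain h where h: "\<And>x. apply_ell2 h x = \<eta> x"
    using ell2_compose_inj[of "\<lambda>w. (v + act A w, A)" "proj (delta (v, A))"] unfolding \<eta>_def coeff_def by blast
  \<comment> \<open>Conjugating \<open>\<eta>\<close> turns the bilinear sums of \<open>rel\<close>
    into inner products, as needed for \<open>weak_tendsto\<close>.\<close>
  obtain \<theta> where \<theta>: "\<And>x. apply_ell2 \<theta> x = cnj (\<eta> x)"
    using ell2_cnj[of h] unfolding h by blast
  have "\<forall>F. finite F \<longrightarrow> (\<exists>k. (\<forall>u\<in>F. u \<noteq> w \<longrightarrow> act (sl_inv k) (w - u) \<notin> F) \<and>
      (\<forall>u\<in>F. act k (act A (act (sl_inv k) w - u)) \<notin> F))"
    using generic_conjugator[OF A w0] by blast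
  then obtain k where k: "\<And>F u. finite F \<Longrightarrow> u \<in> F \<Longrightarrow> u \<noteq> w \<Longrightarrow> act (sl_inv (k F)) (w - u) \<notin> F"
      "\<And>F u. finite F \<Longrightarrow> u \<in> F \<Longrightarrow> act (k F) (act A (act (sl_inv (k F)) w - u)) \<notin> F"
    by metis
  have "inj (\<lambda>u. act (k F) (act A (act (sl_inv (k F)) w - u)))" for F
    by (rule injI, simp only: act_eq_iff) simp
  then have "\<forall>F. \<exists>f. (\<forall>u. apply_ell2 f u = \<eta> (act (k F) (act A (act (sl_inv (k F)) w - u)))) \<and> norm f \<le> norm h"
    using ell2_compose_inj[where h = h] unfolding h by metis
  then obtain f1 where f1: "\<And>F u. apply_ell2 (f1 F) u = \<eta> (act (k F) (act A (act (sl_inv (k F)) w - u)))"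
      "\<And>F. norm (f1 F) \<le> norm h" by metis
  have "inj (\<lambda>u. act (sl_inv (k F)) (w - u))" for F
    by (rule injI, simp only: act_eq_iff) simp
  then have "\<forall>F. \<exists>f. (\<forall>u. apply_ell2 f u = \<eta> (act (sl_inv (k F)) (w - u))) \<and> norm f \<le> norm h"
    using ell2_compose_inj[where h = h] unfolding h by metis
  then obtain f2 where f2: "\<And>F u. apply_ell2 (f2 F) u = \<eta> (act (sl_inv (k F)) (w - u))"
      "\<And>F. norm (f2 F) \<le> norm h" by metis
  have lim1: "((\<lambda>F. cinner (f1 F) \<theta>) \<longlongrightarrow> cinner 0 \<theta>) (finite_subsets_at_top UNIV)"
  proof (rule weak_tendsto[OF f1(2)])
    fix u
    have "((\<lambda>F. apply_ell2 h (act (k F) (act A (act (sl_inv (k F)) w - u)))) \<longlongrightarrow> 0) (finite_subsets_at_top UNIV)"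
    proof (rule ell2_tendsto_0)
      fix x :: "int^'n"
      show "\<forall>\<^sub>F F in finite_subsets_at_top UNIV. act (k F) (act A (act (sl_inv (k F)) w - u)) \<noteq> x"
        unfolding eventually_finite_subsets_at_top
      proof (intro exI[of _ "{u, x}"] conjI allI impI)
        fix F assume F: "finite F \<and> {u, x} \<subseteq> F \<and> F \<subseteq> UNIV"
        then have "act (k F) (act A (act (sl_inv (k F)) w - u)) \<notin> F" by (intro k(2)) auto
        then show "act (k F) (act A (act (sl_inv (k F)) w - u)) \<noteq> x" using F by auto
      qed auto
    qed
    then show "((\<lambda>F. apply_ell2 (f1 F) u) \<longlongrightarrow> apply_ell2 0 u) (finite_subsets_at_top UNIV)"
      by (simp add: f1 h)
  qed
  \<comment> \<open>At \<open>u = w\<close> the argument of \<open>\<eta>\<close> is 0 for every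
    \<open>F\<close>, so this one coefficient stays at \<open>\<eta> 0\<close>.\<close>
  have lim2: "((\<lambda>F. cinner (f2 F) \<theta>) \<longlongrightarrow> cinner (cscale (\<eta> 0) (delta w)) \<theta>) (finite_subsets_at_top UNIV)"
  proof (rule weak_tendsto[OF f2(2)])
    fix u
    show "((\<lambda>F. apply_ell2 (f2 F) u) \<longlongrightarrow> apply_ell2 (cscale (\<eta> 0) (delta w)) u) (finite_subsets_at_top UNIV)"
    proof (cases "u = w")
      case True then show ?thesis by (simp add: f2)
    next
      case False
      have "((\<lambda>F. apply_ell2 h (act (sl_inv (k F)) (w - u))) \<longlongrightarrow> 0) (finite_subsets_at_top UNIV)"
      proof (rule ell2_tendsto_0)
        fix x :: "int^'n"
        show "\<forall>\<^sub>F F in finite_subsets_at_top UNIV. act (sl_inv (k F)) (w - u) \<noteq> x"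
          unfolding eventually_finite_subsets_at_top
        proof (intro exI[of _ "{u, x}"] conjI allI impI)
          fix F assume F: "finite F \<and> {u, x} \<subseteq> F \<and> F \<subseteq> UNIV"
          then have "act (sl_inv (k F)) (w - u) \<notin> F" using False by (intro k(1)) auto
          then show "act (sl_inv (k F)) (w - u) \<noteq> x" using F by auto
        qed auto
      qed
      then show ?thesis using False by (simp add: f2 h)
    qed
  qed
  have "cinner (f1 F) \<theta> = cinner (f2 F) \<theta>" for F
    unfolding cinner.rep_eq f1(1) f2(1) \<theta> complex_cnj_cnj by (rule rel)
  then have "cinner (cscale (\<eta> 0) (delta w)) \<theta> = cinner 0 \<theta>"
    by (intro tendsto_unique[OF finite_subsets_at_top_neq_bot lim2]) (use lim1 in simp)
  then have "\<eta> 0 * \<eta> w = 0" by (simp add: cinner_cscale_left \<theta>)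
  moreover have "\<eta> w = coeff (v, A) (y, A)" by (simp add: \<eta>_def w_def)
  moreover have "coeff (v, A) (y, A) = 0" if "\<eta> 0 = 0"
  proof -
    have "proj (delta (v, A)) = 0" using that by (intro coeff_self_0D) (simp add: \<eta>_def)
    then show ?thesis by (simp add: coeff_def)
  qed
  ultimately show ?thesis by auto
qed

theorem classification:
  "(\<exists>H. \<forall>g. proj (delta g) = (if g \<in> H then delta g else 0)) \<or>
   (\<exists>d\<ge>1. \<forall>g. proj (delta g) =
      (if g \<in> multiples d then cscale (1 / 2) (delta g + delta (inva g)) else 0))"
proof -
  consider "\<forall>v. v \<noteq> 0 \<longrightarrow> proj (delta (v, sl_one)) = 0"
    | d where "d \<ge> 1" "\<forall>v. proj (delta (v, sl_one)) = (if divisible d v then delta (v, sl_one) else 0)"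
    | d where "d \<ge> 1" "\<forall>v. proj (delta (v, sl_one)) =
      (if divisible d v then cscale (1 / 2) (delta (v, sl_one) + delta (- v, sl_one)) else 0)"
    using translation_trichotomy by blast
  then show ?thesis
  proof cases
    case 1
    have one: "proj (delta (0, id1)) = delta (0, sl_one)" using proj_id[OF delta_one_K] by simp
    have "proj (delta (v, A)) = (if (v, A) \<in> {(0, id1)} then delta (v, A) else 0)" for v A
    proof (cases "A = sl_one")
      case True then show ?thesis using 1 one by (cases "v = 0") auto
    next
      case False then show ?thesis using trivial_case[OF _ False] 1 by auto
    qed
    then have "\<forall>g. proj (delta g) = (if g \<in> {(0, id1)} then delta g else 0)"
      unfolding split_paired_All by blast
    then show ?thesis by blast
  next
    case 2
    \<comment> \<open>\<open>coeff_support\<close> asks for even elements only, so it serves this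
      case as well as the symmetric one.\<close>
    have sym: "delta (w, sl_one) + delta (- w, sl_one) \<in> K" if "divisible d w" for w
    proof (rule subspace_add[OF subspace_K])
      show "delta (w, id1) \<in> K" using 2(2) that proj_mem[of "delta (w, id1)"] by simp
      have "divisible d (- w)" using that by (rule divisible_simps(2))
      then show "delta (- w, id1) \<in> K" using 2(2) proj_mem[of "delta (- w, id1)"] by simp
    qed
    have supp: "coeff (v, A) (y, B') = 0" if "B' \<noteq> A" for v A y B' by (rule coeff_support[OF 2(1) sym that])
    have "proj (delta (v, A)) = 0 \<or> proj (delta (v, A)) = delta (v, A)" for v A
    proof (cases "A = sl_one")
      case True then show ?thesis using 2(2) by auto
    next
      case False
      show ?thesis
      proof (rule proj_delta_01)
        fix x assume x: "x \<noteq> (v, A)"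
        obtain y B' where yB: "x = (y, B')" by fastforce
        show "coeff (v, A) x = 0"
        proof (cases "B' = A")
          case True
          then have "y \<noteq> v" using x yB by simp
          then show ?thesis
            using minus_one_case[of A y v] non_scalar_case[OF supp False _ \<open>y \<noteq> v\<close>] unfolding yB True by blast
        qed (simp add: yB supp)
      qed
    qed
    then have "proj (delta g) = 0 \<or> proj (delta g) = delta g" for g by (cases g) simp
    then have "\<forall>g. proj (delta g) = (if g \<in> {g. proj (delta g) = delta g} then delta g else 0)" by auto
    then show ?thesis by (rule disjI1[OF exI])
  next
    case 3
    have "proj (delta (v, A)) = (if (v, A) \<in> multiples d then cscale (1 / 2) (delta (v, A) + delta (inva (v, A))) else 0)" for v A
    proof (cases "A = sl_one")
      case True
      have "(v, id1) \<in> multiples d \<longleftrightarrow> divisible d v" by (auto simp: multiples_def divisible_def)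
      then show ?thesis using 3(2) True by simp
    next
      case False
      then have "(v, A) \<notin> multiples d" by (auto simp: multiples_def)
      then show ?thesis using symmetric_case[OF 3(1) _ False] 3(2) by simp
    qed
    then have "\<forall>g. proj (delta g) =
      (if g \<in> multiples d then cscale (1 / 2) (delta g + delta (inva g)) else 0)"
      unfolding split_paired_All by blast
    then show ?thesis using 3(1) by blast
  qed
qed

end

section \<open>Invariant subalgebras\<close>

lemma subgroup_multiples: "subgroup (multiples d) affine_sl"
  by (rule affine.subgroupI) (auto simp: multiples_def intro: exI[of _ 0])

lemma multiples_conj_iff: "inva g \<star> y \<star> g \<in> multiples d \<longleftrightarrow> y \<in> multiples d"
proof -
  have *: "inva g \<star> y \<star> g \<in> multiples d" if "y \<in> multiples d" for y g :: "'a affine"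
    using that by (cases g) (auto simp: multiples_def dvd_act_iff)
  have "inva (inva g) \<star> (inva g \<star> y \<star> g) \<star> inva g = y"
    by (simp add: affine.m_assoc del: affine_inv affine_mult)
  then show ?thesis using *[of y g] *[of "inva g \<star> y \<star> g" "inva g"] by metis
qed

lemma multiples_inv_iff: "inva g \<in> multiples d \<longleftrightarrow> g \<in> multiples d"
proof -
  have *: "inva g \<in> multiples d" if "g \<in> multiples d" for g
    using subgroup.m_inv_closed[OF subgroup_multiples that] .
  show ?thesis using *[of g] *[of "inva g"] by (auto simp del: affine_inv)
qed

text \<open>The trace against \<open>u_g\<close> is the coefficient at the inverse of
  \<open>g\<close>, so the defining condition is evenness on \<open>multiples d\<close>. Off that
  set both coefficients vanish, which lets the condition range over the whole group.\<close>

lemma symmetric_part_eq: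
  "symmetric_part d = {T \<in> convolvers affine_sl UNIV.
    T (delta \<one>\<^bsub>affine_sl\<^esub>) \<in> {f. (\<forall>g. g \<notin> multiples d \<longrightarrow> apply_ell2 f g = 0) \<and>
      (\<forall>g. apply_ell2 f (inva g) = apply_ell2 f g)}}"
proof -
  have eq: "T \<in> symmetric_part d \<longleftrightarrow> T \<in> convolvers affine_sl UNIV \<and>
      (\<forall>g. g \<notin> multiples d \<longrightarrow> apply_ell2 (T (delta \<one>\<^bsub>affine_sl\<^esub>)) g = 0) \<and>
      (\<forall>g\<in>multiples d. apply_ell2 (T (delta \<one>\<^bsub>affine_sl\<^esub>)) (inva g) = apply_ell2 (T (delta \<one>\<^bsub>affine_sl\<^esub>)) g)"
    for T :: "'a affine ell2 \<Rightarrow>\<^sub>L 'a affine ell2"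
  proof -
    have "T \<in> symmetric_part d \<longleftrightarrow> T \<in> convolvers affine_sl (multiples d) \<and> (\<forall>g\<in>multiples d.
        apply_ell2 (T (delta \<one>\<^bsub>affine_sl\<^esub>)) (inva g) = apply_ell2 (T (delta \<one>\<^bsub>affine_sl\<^esub>)) g)"
      unfolding symmetric_part_def affine.group_vn_eq_convolvers[OF subgroup_multiples]
      by (auto simp: affine.trace_compose_left_reg simp del: affine_inv affine_one)
    then show ?thesis by (auto simp: convolvers_def)
  qed
  have all: "(\<forall>g\<in>multiples d. apply_ell2 f (inva g) = apply_ell2 f g) \<longleftrightarrow>
      (\<forall>g. apply_ell2 f (inva g) = apply_ell2 f g)"
    if "\<forall>g. g \<notin> multiples d \<longrightarrow> apply_ell2 f g = 0" for f :: "'a affine ell2"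
    using that multiples_inv_iff by metis
  show ?thesis unfolding set_eq_iff mem_Collect_eq eq using all by blast
qed

lemma conj_invariant_symmetric_part:
  "conj_invariant (affine_sl :: 'n::finite affine monoid) (symmetric_part d)"
proof (rule affine.conj_invariantI[OF symmetric_part_eq])
  fix g :: "'n affine" and f :: "'n affine ell2"
  assume f: "f \<in> {f. (\<forall>g. g \<notin> multiples d \<longrightarrow> apply_ell2 f g = 0) \<and>
      (\<forall>g. apply_ell2 f (inva g) = apply_ell2 f g)}"
  then have f0: "\<And>g. g \<notin> multiples d \<Longrightarrow> apply_ell2 f g = 0"
    and f1: "\<And>g. apply_ell2 f (inva g) = apply_ell2 f g" by blast+
  have "apply_ell2 (conjugate affine_sl g f) (inva y) = apply_ell2 (conjugate affine_sl g f) y" for y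
  proof -
    have "inva g \<star> inva y \<star> g = inva (inva g \<star> y \<star> g)"
      by (simp add: affine.inv_mult_group affine.m_assoc del: affine_inv affine_mult)
    then show ?thesis using f1 by (simp del: affine_inv affine_mult)
  qed
  moreover have "apply_ell2 (conjugate affine_sl g f) y = 0" if "y \<notin> multiples d" for y
    using f0 that multiples_conj_iff[of g y d] by (simp del: affine_inv affine_mult)
  ultimately show "conjugate affine_sl g f \<in> {f. (\<forall>g. g \<notin> multiples d \<longrightarrow> apply_ell2 f g = 0) \<and>
      (\<forall>g. apply_ell2 f (inva g) = apply_ell2 f g)}" by blast
qed

lemma symmetric_part_psubset:
  assumes d: "d \<ge> 1"
  shows "symmetric_part d \<subset> group_vn affine_sl (multiples d :: 'n::finite affine set)"
proof -
  fix p :: 'n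
  \<comment> \<open>A nonzero translation differs from its inverse, so its unitary violates the
    symmetry.\<close>
  define g :: "'n affine" where "g = (d *s axis p 1, sl_one)"
  have g: "g \<in> multiples d" by (auto simp: g_def multiples_def)
  have ne: "inva g \<noteq> g"
  proof
    assume "inva g = g"
    then have "fst (inva g) $ p = fst g $ p" by simp
    then show False using d by (simp add: g_def axis_component)
  qed
  have hat: "left_reg affine_sl g (delta \<one>\<^bsub>affine_sl\<^esub>) = delta g"
    by (simp add: left_reg_delta[OF affine.is_group affine.carrier_UNIV] del: affine_one)
  have "left_reg affine_sl g \<notin> symmetric_part d"
  proof
    assume "left_reg affine_sl g \<in> symmetric_part d"
    then have "apply_ell2 (delta g) (inva g) = apply_ell2 (delta g) g"
      unfolding symmetric_part_eq mem_Collect_eq hat by blast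
    then show False using ne by simp
  qed
  moreover have "left_reg affine_sl g \<in> group_vn affine_sl (multiples d)"
    unfolding affine.group_vn_eq_convolvers[OF subgroup_multiples] by (rule affine.left_reg_convolver[OF g])
  ultimately show ?thesis unfolding symmetric_part_def by blast
qed

lemma (in full_group) conj_invariant_normal:
  assumes H: "H \<lhd> G" shows "conj_invariant G (group_vn G H)"
proof -
  have sub: "subgroup H G" using H by (rule normal_imp_subgroup)
  have "inv g \<otimes> y \<otimes> g \<notin> H" if "y \<notin> H" for g y
    using normal.inv_op_closed2[OF H, of g "inv g \<otimes> y \<otimes> g"] that by (auto simp: m_assoc)
  then show ?thesis
    unfolding group_vn_eq_convolvers[OF sub]
    by (intro conj_invariantI[where W = "{f. \<forall>y. y \<notin> H \<longrightarrow> apply_ell2 f y = 0}"])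
      (auto simp: convolvers_def)
qed

text \<open>\<open>P\<close> is recovered from \<open>K\<close> by
  \<open>mem_von_neumann_algebraI\<close>, and \<open>K\<close> from the projected point masses,
  since \<open>f\<close> lies in \<open>K\<close> exactly if its coefficients are its inner products
  with them.\<close>

lemma invariant_subalgebra_classification:
  fixes P :: "('n::finite affine ell2 \<Rightarrow>\<^sub>L 'n affine ell2) set"
  assumes P: "von_neumann_algebra P" "P \<subseteq> convolvers affine_sl UNIV" "conj_invariant affine_sl P"
    and pq: "(p :: 'n) \<noteq> q"
  shows "(\<exists>H. H \<lhd> affine_sl \<and> P = group_vn affine_sl H) \<or> (\<exists>d\<ge>1. P = symmetric_part d)"
proof -
  define K where "K = closure ((\<lambda>T. blinfun_apply T (delta \<one>\<^bsub>affine_sl\<^esub>)) ` P)"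
  interpret affine_space K p q
    unfolding K_def using affine.invariant_space_closure[OF P] pq
    by (intro affine_space.intro affine_space_axioms.intro)
  have P_eq: "P = {T \<in> convolvers affine_sl UNIV. T (delta \<one>\<^bsub>affine_sl\<^esub>) \<in> K}"
  proof (intro equalityI subsetI)
    fix T assume T: "T \<in> P"
    then have "T (delta \<one>\<^bsub>affine_sl\<^esub>) \<in> K" unfolding K_def by (intro subsetD[OF closure_subset] imageI)
    then show "T \<in> {T \<in> convolvers affine_sl UNIV. T (delta \<one>\<^bsub>affine_sl\<^esub>) \<in> K}" using T P(2) by blast
  next
    fix T assume "T \<in> {T \<in> convolvers affine_sl UNIV. T (delta \<one>\<^bsub>affine_sl\<^esub>) \<in> K}"
    then show "T \<in> P" unfolding K_def using affine.mem_von_neumann_algebraI[OF P(1,2)] by blast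
  qed
  from classification show ?thesis
  proof
    assume "\<exists>H. \<forall>g. proj (delta g) = (if g \<in> H then delta g else 0)"
    then obtain H where H: "\<And>g. proj (delta g) = (if g \<in> H then delta g else 0)" by blast
    \<comment> \<open>Describing \<open>H\<close> through \<open>K\<close> hands the group laws over
      to the closure properties of \<open>K\<close>, except for products, which are taken in
      \<open>P\<close>.\<close>
    have H_iff: "g \<in> H \<longleftrightarrow> delta g \<in> K" for g
    proof
      show "delta g \<in> K" if "g \<in> H" using H[of g] that proj_mem[of "delta g"] by simp
      show "g \<in> H" if "delta g \<in> K"
      proof (rule ccontr)
        assume "g \<notin> H"
        then have "delta g = 0" using H[of g] proj_id[OF that] by simp
        then show False using norm_delta[of g] by simp
      qed
    qed
    have lr: "left_reg affine_sl g \<in> P \<longleftrightarrow> g \<in> H" for g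
      unfolding P_eq H_iff using affine.left_reg_convolver[of g UNIV]
      by (simp add: left_reg_delta[OF affine.is_group affine.carrier_UNIV] del: affine_one)
    have sub: "subgroup H affine_sl"
    proof (rule affine.subgroupI)
      show "H \<subseteq> carrier affine_sl" by simp
      show "H \<noteq> {}" using delta_one_K H_iff by blast
      show "inva g \<in> H" if "g \<in> H" for g
        using that involution_K[of "delta g"] unfolding H_iff involution_delta by blast
      show "g \<star> h \<in> H" if "g \<in> H" "h \<in> H" for g h
      proof -
        have "left_reg affine_sl g o\<^sub>L left_reg affine_sl h \<in> P"
          using P(1) that by (simp add: von_neumann_algebra_def lr)
        then have "(left_reg affine_sl g o\<^sub>L left_reg affine_sl h) (delta \<one>\<^bsub>affine_sl\<^esub>) \<in> K"
          using P_eq by blast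
        then show ?thesis
          unfolding H_iff by (simp add: left_reg_delta[OF affine.is_group affine.carrier_UNIV] del: affine_one affine_mult)
      qed
    qed
    have "x \<star> h \<star> inva x \<in> H" if "h \<in> H" for x h
      using that conjugate_K[of "delta h" x] unfolding H_iff conjugate_delta by blast
    then have "H \<lhd> affine_sl"
      unfolding affine.normal_inv_iff using sub by blast
    moreover have "P = group_vn affine_sl H"
    proof -
      have "f \<in> K \<longleftrightarrow> (\<forall>y. y \<notin> H \<longrightarrow> apply_ell2 f y = 0)" for f
      proof
        assume "f \<in> K"
        then show "\<forall>y. y \<notin> H \<longrightarrow> apply_ell2 f y = 0" using apply_mem[of f] H by simp
      next
        assume f: "\<forall>y. y \<notin> H \<longrightarrow> apply_ell2 f y = 0"
        show "f \<in> K"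
        proof (rule memI)
          show "apply_ell2 f g = cinner f (proj (delta g))" for g
            unfolding H using f by (cases "g \<in> H") (simp_all del: split_paired_All)
        qed
      qed
      then show ?thesis
        unfolding affine.group_vn_eq_convolvers[OF sub] P_eq by (auto simp: convolvers_def)
    qed
    ultimately show ?thesis by blast
  next
    assume "\<exists>d\<ge>1. \<forall>g. proj (delta g) =
      (if g \<in> multiples d then cscale (1 / 2) (delta g + delta (inva g)) else 0)"
    then obtain d where d: "d \<ge> 1" "\<And>g. proj (delta g) =
      (if g \<in> multiples d then cscale (1 / 2) (delta g + delta (inva g)) else 0)" by blast
    have inner: "cinner f (proj (delta g)) = (if g \<in> multiples d then (apply_ell2 f g + apply_ell2 f (inva g)) / 2 else 0)" for f g
      unfolding d(2) by (simp add: cinner_cscale_right cinner_add_right del: affine_inv)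
    have "f \<in> K \<longleftrightarrow> (\<forall>g. g \<notin> multiples d \<longrightarrow> apply_ell2 f g = 0) \<and>
        (\<forall>g. apply_ell2 f (inva g) = apply_ell2 f g)" for f
    proof
      assume f: "f \<in> K"
      have zero: "apply_ell2 f g = 0" if "g \<notin> multiples d" for g
        using apply_mem[OF f, of g] inner[of f g] that by simp
      moreover have "apply_ell2 f (inva g) = apply_ell2 f g" for g
      proof (cases "g \<in> multiples d")
        case True
        then have "apply_ell2 f g = (apply_ell2 f g + apply_ell2 f (inva g)) / 2"
          using apply_mem[OF f, of g] inner[of f g] by simp
        then show ?thesis by (simp add: field_simps del: affine_inv)
      next
        case False
        then show ?thesis using zero multiples_inv_iff[of g d] by simp
      qed
      ultimately show "(\<forall>g. g \<notin> multiples d \<longrightarrow> apply_ell2 f g = 0) \<and>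
        (\<forall>g. apply_ell2 f (inva g) = apply_ell2 f g)" by blast
    next
      assume f: "(\<forall>g. g \<notin> multiples d \<longrightarrow> apply_ell2 f g = 0) \<and>
        (\<forall>g. apply_ell2 f (inva g) = apply_ell2 f g)"
      show "f \<in> K"
      proof (rule memI)
        show "apply_ell2 f g = cinner f (proj (delta g))" for g
          using f unfolding inner by (cases "g \<in> multiples d") (simp_all del: affine_inv split_paired_All)
      qed
    qed
    then have "P = symmetric_part d" unfolding P_eq symmetric_part_eq by simp
    then show ?thesis using d(1) by blast
  qed
qed

theorem theorem1p1:
  assumes "CARD('n::finite) \<ge> 2"
  shows "(\<forall>P. von_neumann_subalgebra P (group_vn affine_sl (carrier affine_sl)) \<longrightarrow>
      (conj_invariant (affine_sl :: 'n affine monoid) P \<longleftrightarrow>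
        (\<exists>H. H \<lhd> affine_sl \<and> P = group_vn affine_sl H) \<or>
        (\<exists>d\<ge>1. P = symmetric_part d))) \<and>
    (\<forall>d\<ge>1. symmetric_part d \<subset> group_vn affine_sl (multiples d :: 'n affine set))"
proof (intro conjI allI impI)
  \<comment> \<open>The two coordinates demanded by \<open>affine_space\<close>.\<close>
  obtain p q :: 'n where pq: "p \<noteq> q"
    using assms by (metis One_nat_def Suc_1 card_le_Suc0_iff_eq finite not_less_eq_eq)
  fix P assume P: "von_neumann_subalgebra P (group_vn affine_sl (carrier (affine_sl :: 'n affine monoid)))"
  have L: "group_vn affine_sl (carrier affine_sl) = convolvers (affine_sl :: 'n affine monoid) UNIV"
    using affine.group_vn_eq_convolvers[OF affine.subgroup_self] by simp
  show "conj_invariant affine_sl P \<longleftrightarrow>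
      (\<exists>H. H \<lhd> affine_sl \<and> P = group_vn affine_sl H) \<or> (\<exists>d\<ge>1. P = symmetric_part d)"
  proof
    assume "conj_invariant affine_sl P"
    then show "(\<exists>H. H \<lhd> affine_sl \<and> P = group_vn affine_sl H) \<or> (\<exists>d\<ge>1. P = symmetric_part d)"
      using P pq unfolding von_neumann_subalgebra_def L
      by (intro invariant_subalgebra_classification) auto
  next
    assume "(\<exists>H. H \<lhd> affine_sl \<and> P = group_vn affine_sl H) \<or> (\<exists>d\<ge>1. P = symmetric_part d)"
    then show "conj_invariant affine_sl P"
      using affine.conj_invariant_normal conj_invariant_symmetric_part by blast
  qed
qed (rule symmetric_part_psubset)

end
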